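(* Let $\Omega$ be a bounded $H^1,H^2$-extension domain of $\mathbb R^3$. Then the restricted tangential gradient operator $$\nabla_T:\mathcal B^2(\partial\Omega)\to\boldsymbol B_T(\partial\Omega),\qquad\mathrm{Tr}\,v\mapsto\nabla_T(\mathrm{Tr}\,v)=\boldsymbol\pi_T(\nabla v)\quad(v\in H^2(\Omega)),$$ is a well-defined, linear and continuous mapping.
   Context: All functions are real-valued. A bounded domain (bounded open connected set) $\Omega\subset\mathbb R^3$ is an $H^k$-extension domain ($k=1,2$) if there is a bounded linear operator $E_k:H^k(\Omega)\to H^k(\mathbb R^3)$ with $(E_ku)|_\Omega=u$ for all $u\in H^k(\Omega)$; it is an $H^1,H^2$-extension domain if it is both an $H^1$- and an $H^2$-extension domain. For an $H^1$-extension domain, the trace of $u\in H^1(\Omega)$ is defined for quasi-every $x\in\partial\Omega$ (with respect to the capacity associated with $H^1(\mathbb R^3)$) by $\mathrm{Tr}\,u(x)=\lim_{r\to0^+}\frac{1}{\lambda(\Omega\cap B_r(x))}\int_{\Omega\cap B_r(x)}u(y)\,dy$, where $\lambda$ is Lebesgue measure; functions on $\partial\Omega$ are identified when they agree quasi-everywhere. The trace space is $\mathcal B(\partial\Omega):=\mathrm{Tr}(H^1(\Omega))$ with norm $\|f\|_{\mathcal B(\partial\Omega)}=\min\{\|v\|_{H^1(\Omega)} : \mathrm{Tr}\,v=f\}$. It is known that $\mathcal B(\partial\Omega)$ is a Hilbert space and that $\mathrm{Ker}\,\mathrm{Tr}=H^1_0(\Omega)$. The space $\mathcal B^2(\partial\Omega):=\mathrm{Tr}(H^2(\Omega))$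 is a Hilbert space with norm $\|f\|_{\mathcal B^2(\partial\Omega)}=\min\{\|v\|_{H^2(\Omega)}:v\in H^2(\Omega),\ \mathrm{Tr}\,v=f\}$. Vector-valued versions: $\boldsymbol H^1(\Omega)=H^1(\Omega)^3$, $\boldsymbol B(\partial\Omega)=\mathcal B(\partial\Omega)^3$, $\boldsymbol{\mathrm{Tr}}$ is the componentwise trace, $\boldsymbol B'(\partial\Omega)$ the dual of $\boldsymbol B(\partial\Omega)$. Primes denote dual spaces. Stokes form: $b(\boldsymbol u,\boldsymbol v)=\int_\Omega(\boldsymbol u\cdot\mathbf{curl}\,\boldsymbol v-\boldsymbol v\cdot\mathbf{curl}\,\boldsymbol u)\,dx$. Tangential trace on $\boldsymbol H^1(\Omega)$: $\boldsymbol{\mathrm{Tr}}_T\boldsymbol u\in\boldsymbol B'(\partial\Omega)$ is the (well-defined) continuous functional with $\langle\boldsymbol{\mathrm{Tr}}_T\boldsymbol u,\boldsymbol{\mathrm{Tr}}\,\boldsymbol v\rangle=b(\boldsymbol u,\boldsymbol v)$ for all $\boldsymbol v\in\boldsymbol H^1(\Omega)$. $\boldsymbol K:=\mathrm{Ker}(\boldsymbol{\mathrm{Tr}}_T)\subset\boldsymbol H^1(\Omega)$ and $\boldsymbol K^\perp$ is its orthogonal complement in $\boldsymbol H^1(\Omega)$. $\boldsymbol B_\perp(\partial\Omega):=\boldsymbol{\mathrm{Tr}}_T(\boldsymbol H^1(\Omega))$ has the quotient norm; each $\boldsymbol f\in\boldsymbol B_\perp(\partial\Omega)$ has a unique lift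 $\boldsymbol w_f\in\boldsymbol K^\perp$ with $\boldsymbol{\mathrm{Tr}}_T\boldsymbol w_f=\boldsymbol f$. Tangential component trace on $\boldsymbol H^1(\Omega)$: $\boldsymbol\pi_T\boldsymbol u\in\boldsymbol B'_\perp(\partial\Omega)$ is defined by $\langle\boldsymbol\pi_T\boldsymbol u,\boldsymbol f\rangle_{\boldsymbol B'_\perp,\boldsymbol B_\perp}:=-b(\boldsymbol u,\boldsymbol w_f)$ for all $\boldsymbol f\in\boldsymbol B_\perp(\partial\Omega)$. $\boldsymbol B_T(\partial\Omega):=\boldsymbol\pi_T(\boldsymbol H^1(\Omega))\subset\boldsymbol B'_\perp(\partial\Omega)$ has the quotient norm $\|\boldsymbol f\|_{\boldsymbol B_T}=\inf\{\|\boldsymbol v\|_{\boldsymbol H^1(\Omega)}:\boldsymbol\pi_T\boldsymbol v=\boldsymbol f\}$. *)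

theory Defs
  imports "HOL-Analysis.Analysis"
begin

text \<open>
  Functions that the mathematics identifies almost everywhere (on a domain) or quasi-everywhere
  (on its boundary) are represented by total functions on \<open>real^3\<close>; their values off the domain,
  respectively off the boundary, play no role.  Linear functionals are total functions that vanish
  outside the space on which they act, so that equality of functionals is equality in HOL and the
  vector space operations are pointwise.
\<close>

type_synonym scalar_field = "real^3 \<Rightarrow> real"
type_synonym vector_field = "real^3 \<Rightarrow> real^3"


section \<open>Linear maps between spaces of functions\<close>

text \<open>The relation \<open>eq\<close> is the identification in force on the target space; the norms may be
  seminorms on representatives.\<close>

definition bounded_linear_between ::
  "('a \<Rightarrow> 'b::real_vector) set \<Rightarrow> (('a \<Rightarrow> 'b) \<Rightarrow> real) \<Rightarrow>
   ('c \<Rightarrow> 'd::real_vector) set \<Rightarrow> (('c \<Rightarrow> 'd) \<Rightarrow> real) \<Rightarrow>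
   (('c \<Rightarrow> 'd) \<Rightarrow> ('c \<Rightarrow> 'd) \<Rightarrow> bool) \<Rightarrow> (('a \<Rightarrow> 'b) \<Rightarrow> ('c \<Rightarrow> 'd)) \<Rightarrow> bool" where
  "bounded_linear_between X nX Y nY eq T \<longleftrightarrow>
     (\<forall>f\<in>X. T f \<in> Y) \<and>
     (\<forall>f\<in>X. \<forall>g\<in>X. eq (T (\<lambda>x. f x + g x)) (\<lambda>y. T f y + T g y)) \<and>
     (\<forall>c. \<forall>f\<in>X. eq (T (\<lambda>x. c *\<^sub>R f x)) (\<lambda>y. c *\<^sub>R T f y)) \<and>
     (\<exists>C. \<forall>f\<in>X. nY (T f) \<le> C * nX f)"

text \<open>Boundedness makes every element of the dual respect the identification of functions
  at seminorm distance 0.\<close>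

definition dual_space ::
  "('a \<Rightarrow> 'b::real_vector) set \<Rightarrow> (('a \<Rightarrow> 'b) \<Rightarrow> real) \<Rightarrow> (('a \<Rightarrow> 'b) \<Rightarrow> real) set" where
  "dual_space X nX =
     {F. (\<forall>f. f \<notin> X \<longrightarrow> F f = 0) \<and>
         (\<forall>f\<in>X. \<forall>g\<in>X. F (\<lambda>x. f x + g x) = F f + F g) \<and>
         (\<forall>c. \<forall>f\<in>X. F (\<lambda>x. c *\<^sub>R f x) = c * F f) \<and>
         (\<exists>C. \<forall>f\<in>X. \<bar>F f\<bar> \<le> C * nX f)}"


section \<open>Sobolev spaces\<close>

definition partial :: "3 \<Rightarrow> scalar_field \<Rightarrow> scalar_field" where
  "partial i f = (\<lambda>x. frechet_derivative f (at x) (axis i 1))"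

primrec C_k :: "nat \<Rightarrow> scalar_field \<Rightarrow> bool" where
  "C_k 0 f \<longleftrightarrow> continuous_on UNIV f"
| "C_k (Suc k) f \<longleftrightarrow> (\<forall>x. f differentiable (at x)) \<and> (\<forall>i. C_k k (partial i f))"

definition test_functions :: "(real^3) set \<Rightarrow> scalar_field set" where
  "test_functions \<Omega> = {\<phi>. (\<forall>k. C_k k \<phi>) \<and>
     compact (closure {x. \<phi> x \<noteq> 0}) \<and> closure {x. \<phi> x \<noteq> 0} \<subseteq> \<Omega>}"

definition L2 :: "(real^3) set \<Rightarrow> scalar_field set" where
  "L2 \<Omega> = {u. u \<in> borel_measurable (lebesgue_on \<Omega>) \<and>
              integrable (lebesgue_on \<Omega>) (\<lambda>x. (u x)\<^sup>2)}"

definition is_weak_partial :: "(real^3) set \<Rightarrow> 3 \<Rightarrow> scalar_field \<Rightarrow> scalar_field \<Rightarrow> bool" where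
  "is_weak_partial \<Omega> i u g \<longleftrightarrow>
     (\<forall>\<phi>\<in>test_functions \<Omega>.
        (LINT x|lebesgue_on \<Omega>. u x * partial i \<phi> x) = - (LINT x|lebesgue_on \<Omega>. g x * \<phi> x))"

text \<open>The weak derivative is unique up to null sets; the operator below picks a representative.\<close>

definition weak_partial :: "(real^3) set \<Rightarrow> 3 \<Rightarrow> scalar_field \<Rightarrow> scalar_field" where
  "weak_partial \<Omega> i u = (SOME g. g \<in> L2 \<Omega> \<and> is_weak_partial \<Omega> i u g)"

primrec sobolev :: "nat \<Rightarrow> (real^3) set \<Rightarrow> scalar_field set" where
  "sobolev 0 \<Omega> = L2 \<Omega>"
| "sobolev (Suc k) \<Omega> = {u \<in> L2 \<Omega>. \<forall>i. \<exists>g\<in>sobolev k \<Omega>. is_weak_partial \<Omega> i u g}"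

primrec sobolev_inner ::
  "nat \<Rightarrow> (real^3) set \<Rightarrow> scalar_field \<Rightarrow> scalar_field \<Rightarrow> real" where
  "sobolev_inner 0 \<Omega> u v = (LINT x|lebesgue_on \<Omega>. u x * v x)"
| "sobolev_inner (Suc k) \<Omega> u v = (LINT x|lebesgue_on \<Omega>. u x * v x) +
     (\<Sum>i\<in>UNIV. sobolev_inner k \<Omega> (weak_partial \<Omega> i u) (weak_partial \<Omega> i v))"

definition sobolev_norm :: "nat \<Rightarrow> (real^3) set \<Rightarrow> scalar_field \<Rightarrow> real" where
  "sobolev_norm k \<Omega> u = sqrt (sobolev_inner k \<Omega> u u)"

definition vsobolev :: "nat \<Rightarrow> (real^3) set \<Rightarrow> vector_field set" where
  "vsobolev k \<Omega> = {u. \<forall>i. (\<lambda>x. u x $ i) \<in> sobolev k \<Omega>}"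

definition vsobolev_inner ::
  "nat \<Rightarrow> (real^3) set \<Rightarrow> vector_field \<Rightarrow> vector_field \<Rightarrow> real" where
  "vsobolev_inner k \<Omega> u v = (\<Sum>i\<in>UNIV. sobolev_inner k \<Omega> (\<lambda>x. u x $ i) (\<lambda>x. v x $ i))"

definition vsobolev_norm :: "nat \<Rightarrow> (real^3) set \<Rightarrow> vector_field \<Rightarrow> real" where
  "vsobolev_norm k \<Omega> u = sqrt (vsobolev_inner k \<Omega> u u)"

definition weak_grad :: "(real^3) set \<Rightarrow> scalar_field \<Rightarrow> vector_field" where
  "weak_grad \<Omega> u = (\<lambda>x. \<chi> i. weak_partial \<Omega> i u x)"

definition weak_curl :: "(real^3) set \<Rightarrow> vector_field \<Rightarrow> vector_field" where
  "weak_curl \<Omega> u = (let d = (\<lambda>i j. weak_partial \<Omega> i (\<lambda>y. u y $ j)) in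
     (\<lambda>x. vector [d 2 3 x - d 3 2 x, d 3 1 x - d 1 3 x, d 1 2 x - d 2 1 x]))"


section \<open>Extension domains\<close>

definition bounded_domain :: "(real^3) set \<Rightarrow> bool" where
  "bounded_domain \<Omega> \<longleftrightarrow> bounded \<Omega> \<and> open \<Omega> \<and> connected \<Omega>"

definition sobolev_extension_domain :: "nat \<Rightarrow> (real^3) set \<Rightarrow> bool" where
  "sobolev_extension_domain k \<Omega> \<longleftrightarrow> bounded_domain \<Omega> \<and>
     (\<exists>E. bounded_linear_between (sobolev k \<Omega>) (sobolev_norm k \<Omega>)
            (sobolev k UNIV) (sobolev_norm k UNIV) (\<lambda>f g. AE x in lebesgue. f x = g x) E \<and>
          (\<forall>u\<in>sobolev k \<Omega>. AE x in lebesgue_on \<Omega>. E u x = u x))"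


section \<open>Capacity and traces\<close>

definition capacity :: "(real^3) set \<Rightarrow> ennreal" where
  "capacity A = (INF u\<in>{u \<in> sobolev 1 UNIV.
       \<exists>U. open U \<and> A \<subseteq> U \<and> (AE x in lebesgue. x \<in> U \<longrightarrow> 1 \<le> u x)}.
     ennreal ((sobolev_norm 1 UNIV u)\<^sup>2))"

definition qe_on :: "(real^3) set \<Rightarrow> (real^3 \<Rightarrow> bool) \<Rightarrow> bool" where
  "qe_on A P \<longleftrightarrow> capacity {x \<in> A. \<not> P x} = 0"

text \<open>\<open>has_trace \<Omega> u f\<close> says that \<open>f\<close> is a representative of the trace of \<open>u\<close>: for quasi-every
  boundary point the limit of the averages exists and is the value of \<open>f\<close>.\<close>

definition has_trace :: "(real^3) set \<Rightarrow> scalar_field \<Rightarrow> scalar_field \<Rightarrow> bool" where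
  "has_trace \<Omega> u f \<longleftrightarrow> qe_on (frontier \<Omega>)
     (\<lambda>x. ((\<lambda>r. (LINT y|lebesgue_on (\<Omega> \<inter> ball x r). u y) / measure lebesgue (\<Omega> \<inter> ball x r))
            \<longlongrightarrow> f x) (at_right 0))"

text \<open>\<open>trace_space 1\<close> and \<open>trace_space 2\<close> are the images of the trace on \<open>H\<^sup>1\<close> and \<open>H\<^sup>2\<close>.  The infimum
  in the norm is the minimum whenever the latter exists.\<close>

definition trace_space :: "nat \<Rightarrow> (real^3) set \<Rightarrow> scalar_field set" where
  "trace_space k \<Omega> = {f. \<exists>v\<in>sobolev k \<Omega>. has_trace \<Omega> v f}"

definition trace_norm :: "nat \<Rightarrow> (real^3) set \<Rightarrow> scalar_field \<Rightarrow> real" where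
  "trace_norm k \<Omega> f = Inf {sobolev_norm k \<Omega> v |v. v \<in> sobolev k \<Omega> \<and> has_trace \<Omega> v f}"

definition has_vtrace :: "(real^3) set \<Rightarrow> vector_field \<Rightarrow> vector_field \<Rightarrow> bool" where
  "has_vtrace \<Omega> u g \<longleftrightarrow> (\<forall>i. has_trace \<Omega> (\<lambda>x. u x $ i) (\<lambda>x. g x $ i))"

definition vtrace_space :: "(real^3) set \<Rightarrow> vector_field set" where
  "vtrace_space \<Omega> = {g. \<forall>i. (\<lambda>x. g x $ i) \<in> trace_space 1 \<Omega>}"

definition vtrace_norm :: "(real^3) set \<Rightarrow> vector_field \<Rightarrow> real" where
  "vtrace_norm \<Omega> g = sqrt (\<Sum>i\<in>UNIV. (trace_norm 1 \<Omega> (\<lambda>x. g x $ i))\<^sup>2)"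


section \<open>Tangential traces\<close>

definition stokes_form :: "(real^3) set \<Rightarrow> vector_field \<Rightarrow> vector_field \<Rightarrow> real" where
  "stokes_form \<Omega> u v =
     (LINT x|lebesgue_on \<Omega>. u x \<bullet> weak_curl \<Omega> v x - v x \<bullet> weak_curl \<Omega> u x)"

type_synonym functional = "vector_field \<Rightarrow> real"

definition tan_trace :: "(real^3) set \<Rightarrow> vector_field \<Rightarrow> functional" where
  "tan_trace \<Omega> u = (THE F. F \<in> dual_space (vtrace_space \<Omega>) (vtrace_norm \<Omega>) \<and>
     (\<forall>v\<in>vsobolev 1 \<Omega>. \<forall>g. has_vtrace \<Omega> v g \<longrightarrow> F g = stokes_form \<Omega> u v))"

definition ker_tan_trace :: "(real^3) set \<Rightarrow> vector_field set" where
  "ker_tan_trace \<Omega> = {u \<in> vsobolev 1 \<Omega>. tan_trace \<Omega> u = (\<lambda>_. 0)}"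

definition ker_tan_trace_perp :: "(real^3) set \<Rightarrow> vector_field set" where
  "ker_tan_trace_perp \<Omega> =
     {w \<in> vsobolev 1 \<Omega>. \<forall>k\<in>ker_tan_trace \<Omega>. vsobolev_inner 1 \<Omega> w k = 0}"

definition B_perp :: "(real^3) set \<Rightarrow> functional set" where
  "B_perp \<Omega> = tan_trace \<Omega> ` vsobolev 1 \<Omega>"

text \<open>Every element of \<open>B_perp \<Omega>\<close> has a lift that is unique up to null sets; the fallback value only
  makes the function total.\<close>

definition lift :: "(real^3) set \<Rightarrow> functional \<Rightarrow> vector_field" where
  "lift \<Omega> f = (if \<exists>w\<in>ker_tan_trace_perp \<Omega>. tan_trace \<Omega> w = f
               then SOME w. w \<in> ker_tan_trace_perp \<Omega> \<and> tan_trace \<Omega> w = f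
               else (\<lambda>_. 0))"

definition pi_T :: "(real^3) set \<Rightarrow> vector_field \<Rightarrow> (functional \<Rightarrow> real)" where
  "pi_T \<Omega> u = (\<lambda>f. if f \<in> B_perp \<Omega> then - stokes_form \<Omega> u (lift \<Omega> f) else 0)"

definition B_T :: "(real^3) set \<Rightarrow> (functional \<Rightarrow> real) set" where
  "B_T \<Omega> = pi_T \<Omega> ` vsobolev 1 \<Omega>"

definition B_T_norm :: "(real^3) set \<Rightarrow> (functional \<Rightarrow> real) \<Rightarrow> real" where
  "B_T_norm \<Omega> h = Inf {vsobolev_norm 1 \<Omega> v |v. v \<in> vsobolev 1 \<Omega> \<and> pi_T \<Omega> v = h}"

text \<open>The description is meaningful exactly when \<open>pi_T \<Omega> (weak_grad \<Omega> v)\<close> does not depend on the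
  choice of \<open>v\<close> with trace \<open>f\<close>.\<close>

definition tan_grad :: "(real^3) set \<Rightarrow> scalar_field \<Rightarrow> (functional \<Rightarrow> real)" where
  "tan_grad \<Omega> f =
     (THE h. \<exists>v\<in>sobolev 2 \<Omega>. has_trace \<Omega> v f \<and> h = pi_T \<Omega> (weak_grad \<Omega> v))"

end

theory Submission
  imports Defs
begin

text \<open>
  Functions in \<open>H\<^sup>2\<close> of the whole space are continuous, so the trace of \<open>v\<close> in \<open>H\<^sup>2(\<Omega>)\<close> is the restriction of the
  continuous representative \<open>V\<close> of an extension, and all boundary points are Lebesgue points.  Since the weak curl of
  a gradient vanishes, \<open>b(\<nabla>v, u)\<close> is the integral of \<open>\<nabla>v \<bullet> curl u\<close>; if \<open>V = 0\<close> quasi-everywhere on the boundary, it is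
  zero because \<open>\<nabla>v\<close> is then a limit of gradients of functions with compact support in \<open>\<Omega>\<close>, and \<open>curl u\<close> is
  orthogonal to those.  Such functions are obtained by truncating \<open>v\<close> at small values, which takes care of the boundary
  points where \<open>V\<close> vanishes, and multiplying by \<open>1 - u\<close> for a function \<open>u\<close> of small \<open>H\<^sup>1\<close> norm that equals 1 near the
  remaining boundary points, which form a set of capacity zero.  Continuity holds with constant 1, since
  the \<open>H\<^sup>1\<close> norm of \<open>\<nabla>v\<close> is at most the \<open>H\<^sup>2\<close> norm of \<open>v\<close>.

  The \<open>H\<^sup>2\<close> embedding is read off the mollifications: for a suitable mollifier
  \<open>\<partial>\<^sub>r (v * \<eta>\<^sub>r) = \<Delta>v * \<kappa>\<^sub>r\<close>, where \<open>\<kappa>\<^sub>r\<close> has \<open>L\<^sup>2\<close> norm of order \<open>r powr (-1/2)\<close>, which is integrable at 0.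
\<close>

section \<open>Smooth bump functions\<close>

text \<open>The obstacle is that the trace vanishes only quasi-everywhere: V may be nonzero on a
  boundary set of capacity zero, such as an isolated point, so truncating small values alone does
  not move the support away from the boundary. For a fixed truncation level d the boundary points
  with |V| \<ge> d/2 form a compact set inside the open set where the capacity competitor u is at
  least 1. At all other boundary points the mollified function is eventually below d, because it
  converges to V uniformly; this is what the estimate in the embedding is for. Set to 0 outside
  \<Omega>, the product is therefore C^1 with compact support in \<Omega>. Three limits follow, in
  this order: the mollification radius tends to 0 for fixed u and d, then u tends to 0 in H^1, then
  d tends to 0. In the last one the slope of the truncation tends to the indicator of V \<noteq> 0,
  and the gradient is 0 almost everywhere on the rest. Weak derivatives are chosen representatives,
  so identities between them hold only almost everywhere; they become exact in the Stokes
  form.\<close>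

definition flat_exp :: "nat \<Rightarrow> real \<Rightarrow> real" where
  "flat_exp m t = (if t \<le> 0 then 0 else exp (- (1 / t)) / t ^ m)"

lemma flat_exp_nonneg: "0 \<le> flat_exp m t"
  by (simp add: flat_exp_def)

text \<open>From the right, the substitution s = 1/t turns the quotient into s^m / exp s; from the
  left the function is 0.\<close>

lemma flat_exp_tendsto_0: "(flat_exp m \<longlongrightarrow> 0) (at 0)"
proof -
  have "((\<lambda>t::real. inverse t ^ m / exp (inverse t)) \<longlongrightarrow> 0) (at_right 0)"
    by (rule filterlim_compose[OF tendsto_power_div_exp_0 filterlim_inverse_at_top_right])
  moreover have "eventually (\<lambda>t::real. inverse t ^ m / exp (inverse t) = flat_exp m t) (at_right 0)"
    by (auto simp: eventually_at_right_field flat_exp_def exp_minus field_simps intro!: exI[of _ 1])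
  ultimately have r: "(flat_exp m \<longlongrightarrow> 0) (at_right 0)"
    by (rule Lim_transform_eventually)
  have "eventually (\<lambda>t::real. 0 = flat_exp m t) (at_left 0)"
    by (auto simp: eventually_at_left_field flat_exp_def intro!: exI[of _ "-1"])
  then have l: "(flat_exp m \<longlongrightarrow> 0) (at_left 0)"
    by (rule Lim_transform_eventually[rotated]) simp
  show ?thesis using l r by (simp add: filterlim_at_split)
qed

text \<open>Dividing by all powers of t makes the family closed under differentiation up to linear
  combinations, so smoothness of the bumps requires no formula for higher derivatives. For m = 0 the
  derivative is exactly \<open>flat_exp 2\<close>; the choice of the mollifier rests on
  this.\<close>

lemma flat_exp_has_derivative:
  "(flat_exp m has_real_derivative flat_exp (m + 2) t - of_nat m * flat_exp (m + 1) t) (at t)"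
proof (cases t "0::real" rule: linorder_cases)
  case less
  have "((\<lambda>_. 0) has_real_derivative 0) (at t)" by simp
  then have "(flat_exp m has_real_derivative 0) (at t)"
    by (rule has_field_derivative_transform_within_open[where S = "{..<0}"])
       (use less in \<open>auto simp: flat_exp_def\<close>)
  then show ?thesis using less by (simp add: flat_exp_def)
next
  case equal
  \<comment> \<open>The difference quotient of \<open>flat_exp m\<close> at 0 is
    \<open>flat_exp (Suc m)\<close>.\<close>
  have "((\<lambda>y. (flat_exp m y - flat_exp m 0) / (y - 0)) \<longlongrightarrow> 0) (at 0)"
    by (rule Lim_transform_eventually[OF flat_exp_tendsto_0[of "Suc m"]])
       (auto simp: flat_exp_def eventually_at_filter)
  then show ?thesis using equal by (simp add: has_field_derivative_iff flat_exp_def)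
next
  case greater
  have "((\<lambda>t. exp (- (1 / t)) / t ^ m) has_real_derivative
         exp (- (1 / t)) / t ^ (m + 2) - of_nat m * (exp (- (1 / t)) / t ^ (m + 1))) (at t)"
  proof (cases m)
    case 0
    then show ?thesis
      using greater by (auto intro!: derivative_eq_intros simp: field_simps power2_eq_square)
  next
    case (Suc n)
    have "((\<lambda>t. t ^ m) has_real_derivative real m * t ^ n) (at t)"
      using DERIV_pow[of m t] Suc by simp
    moreover have "((\<lambda>t. exp (- (1 / t))) has_real_derivative exp (- (1 / t)) / t\<^sup>2) (at t)"
      using greater by (auto intro!: derivative_eq_intros simp: field_simps power2_eq_square)
    ultimately show ?thesis
      using greater Suc
      by (auto intro!: DERIV_cong[OF DERIV_divide] simp: field_simps power2_eq_square)
  qed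
  then have "(flat_exp m has_real_derivative
         exp (- (1 / t)) / t ^ (m + 2) - of_nat m * (exp (- (1 / t)) / t ^ (m + 1))) (at t)"
    by (rule has_field_derivative_transform_within_open[where S = "{0<..}"])
       (use greater in \<open>auto simp: flat_exp_def\<close>)
  then show ?thesis using greater by (simp add: flat_exp_def)
qed

section \<open>Classical partial derivatives\<close>

lemma partial_eq: "(f has_derivative f') (at x) \<Longrightarrow> partial i f x = f' (axis i 1)"
  unfolding partial_def by (metis frechet_derivative_at)

lemma vec3_sum_axis: "(h :: real^3) = (\<Sum>i\<in>UNIV. h $ i *\<^sub>R axis i 1)"
  by (simp add: vec_eq_iff axis_def if_distrib [of "\<lambda>z. _ * z"] cong: if_cong)

lemma has_derivative_partial:
  assumes "f differentiable (at x)"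
  shows "(f has_derivative (\<lambda>h. \<Sum>i\<in>UNIV. h $ i * partial i f x)) (at x)"
proof -
  obtain f' where f': "(f has_derivative f') (at x)"
    using assms by (auto simp: differentiable_def)
  interpret bounded_linear f' by (rule has_derivative_bounded_linear[OF f'])
  have "f' h = (\<Sum>i\<in>UNIV. h $ i * partial i f x)" for h
    by (subst vec3_sum_axis[of h]) (simp add: sum scaleR partial_eq[OF f'])
  then have "f' = (\<lambda>h. \<Sum>i\<in>UNIV. h $ i * partial i f x)" by (rule ext)
  with f' show ?thesis by simp
qed

text \<open>The set is closed under partial derivatives
  (\<open>bump_algebra_differentiable\<close>), so a single induction on k shows that all its
  members are C^k.\<close>

inductive_set bump_algebra :: "real \<Rightarrow> scalar_field set" for r :: real where
  const: "(\<lambda>x. c) \<in> bump_algebra r"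
| coord: "(\<lambda>x. x $ i) \<in> bump_algebra r"
| bump: "(\<lambda>x. flat_exp m (1 - (x \<bullet> x) / r\<^sup>2)) \<in> bump_algebra r"
| add: "f \<in> bump_algebra r \<Longrightarrow> g \<in> bump_algebra r \<Longrightarrow> (\<lambda>x. f x + g x) \<in> bump_algebra r"
| mult: "f \<in> bump_algebra r \<Longrightarrow> g \<in> bump_algebra r \<Longrightarrow> (\<lambda>x. f x * g x) \<in> bump_algebra r"

lemma bump_has_derivative:
  "((\<lambda>x::real^3. flat_exp m (1 - (x \<bullet> x) / r\<^sup>2)) has_derivative
     (\<lambda>h. (flat_exp (m + 2) (1 - (x \<bullet> x) / r\<^sup>2) - of_nat m * flat_exp (m + 1) (1 - (x \<bullet> x) / r\<^sup>2))
          * (- 2 * (x \<bullet> h) / r\<^sup>2))) (at x)"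
proof -
  have "((\<lambda>x::real^3. 1 - (x \<bullet> x) / r\<^sup>2) has_derivative (\<lambda>h. - 2 * (x \<bullet> h) / r\<^sup>2)) (at x)"
    unfolding divide_inverse
    by (auto intro!: derivative_eq_intros simp: inner_commute)
  from has_derivative_compose[OF this flat_exp_has_derivative[unfolded has_field_derivative_def]]
  show ?thesis .
qed

lemma partial_bump:
  "partial i (\<lambda>x. flat_exp m (1 - (x \<bullet> x) / r\<^sup>2)) x =
     (flat_exp (m + 2) (1 - (x \<bullet> x) / r\<^sup>2) - of_nat m * flat_exp (m + 1) (1 - (x \<bullet> x) / r\<^sup>2))
       * (- 2 * (x $ i) / r\<^sup>2)"
  by (simp only: partial_eq[OF bump_has_derivative] inner_axis) simp

lemma partial_add: "f differentiable (at x) \<Longrightarrow> g differentiable (at x) \<Longrightarrow>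
    partial i (\<lambda>x. f x + g x) x = partial i f x + partial i g x"
  by (subst partial_eq[OF has_derivative_add[OF has_derivative_partial has_derivative_partial]])
     (auto simp: axis_def if_distrib [of "\<lambda>z. z * _"] cong: if_cong)

lemma partial_mult: "f differentiable (at x) \<Longrightarrow> g differentiable (at x) \<Longrightarrow>
    partial i (\<lambda>x. f x * g x) x = f x * partial i g x + partial i f x * g x"
  by (subst partial_eq[OF has_derivative_mult[OF has_derivative_partial has_derivative_partial]])
     (auto simp: axis_def if_distrib [of "\<lambda>z. z * _"] cong: if_cong)

lemma partial_const [simp]: "partial i (\<lambda>x. c) = (\<lambda>x. 0)"
  by (rule ext) (simp add: partial_eq[OF has_derivative_const])

lemma partial_coord: "partial i (\<lambda>x. x $ j) = (\<lambda>x. if i = j then 1 else 0)"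
proof
  fix x :: "real^3"
  have "((\<lambda>x::real^3. x $ j) has_derivative (\<lambda>h. h $ j)) (at x)"
    by (rule bounded_linear_imp_has_derivative[OF bounded_linear_vec_nth])
  from partial_eq[OF this, of i] show "partial i (\<lambda>x. x $ j) x = (if i = j then 1 else 0)"
    by (simp add: axis_def)
qed

lemma bump_algebra_differentiable:
  assumes "f \<in> bump_algebra r"
  shows "(\<forall>x. f differentiable (at x)) \<and> (\<forall>i. partial i f \<in> bump_algebra r)"
  using assms
proof induction
  case (coord i)
  then show ?case
    by (auto simp: partial_coord differentiable_def intro: bump_algebra.intros bounded_linear_imp_has_derivative[OF bounded_linear_vec_nth])
next
  case (bump m)
  have "partial i (\<lambda>x. flat_exp m (1 - (x \<bullet> x) / r\<^sup>2)) = 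
    (\<lambda>x. (flat_exp (m + 2) (1 - (x \<bullet> x) / r\<^sup>2) + (- of_nat m) * flat_exp (m + 1) (1 - (x \<bullet> x) / r\<^sup>2))
       * ((- 2 / r\<^sup>2) * (x $ i)))" for i
    by (rule ext) (simp add: partial_bump)
  moreover have "\<dots> i \<in> bump_algebra r" for i
    by (intro bump_algebra.intros)
  ultimately show ?case
    by (auto intro: differentiableI[OF bump_has_derivative])
next
  case (add f g)
  then have "partial i (\<lambda>x. f x + g x) = (\<lambda>x. partial i f x + partial i g x)" for i
    by (intro ext partial_add) auto
  with add show ?case by (auto intro: bump_algebra.intros)
next
  case (mult f g)
  then have "partial i (\<lambda>x. f x * g x) = (\<lambda>x. f x * partial i g x + partial i f x * g x)" for i
    by (intro ext partial_mult) auto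
  moreover have "(\<lambda>x. f x * partial i g x + partial i f x * g x) \<in> bump_algebra r" for i
    using mult by (intro bump_algebra.add bump_algebra.mult) auto
  ultimately show ?case using mult by auto
qed (auto intro: bump_algebra.intros)

lemma bump_algebra_C_k: "f \<in> bump_algebra r \<Longrightarrow> C_k k f"
proof (induction k arbitrary: f)
  case 0
  then show ?case
    using bump_algebra_differentiable[OF 0]
    by (auto simp: continuous_on_eq_continuous_within intro: differentiable_imp_continuous_within)
next
  case (Suc k)
  then show ?case using bump_algebra_differentiable by auto
qed

section \<open>Regularity and supports of test functions\<close>

lemma C_k_SucD: "C_k (Suc k) f \<Longrightarrow> C_k k f"
proof (induction k arbitrary: f)
  case 0
  then show ?case
    by (auto simp: continuous_on_eq_continuous_within intro: differentiable_imp_continuous_within)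
qed auto

lemma C_k_1D:
  assumes "C_k (Suc 0) f"
  shows "f differentiable (at x)" "continuous_on UNIV (partial i f)" "continuous_on UNIV f"
  using assms C_k_SucD[of 0 f] by auto

lemma reflect_shift_has_derivative:
  assumes "f differentiable (at (x - y))"
  shows "((\<lambda>y. a * f (x - y)) has_derivative (\<lambda>h. a * (\<Sum>i\<in>UNIV. (- h) $ i * partial i f (x - y)))) (at y)"
proof -
  have "((\<lambda>y. x - y) has_derivative (\<lambda>h. - h)) (at y)"
    by (auto intro!: derivative_eq_intros)
  from has_derivative_compose[OF this has_derivative_partial[OF assms]]
  show ?thesis by (rule has_derivative_mult_right)
qed

lemma partial_reflect_shift:
  "f differentiable (at (x - y)) \<Longrightarrow> partial i (\<lambda>y. a * f (x - y)) y = - a * partial i f (x - y)"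
  by (subst partial_eq[OF reflect_shift_has_derivative])
     (auto simp: axis_def if_distrib [of "\<lambda>z. z * _"] if_distrib [of uminus] cong: if_cong)

text \<open>The factor \<open>a\<close> is there for the induction: each differentiation in y
  multiplies it by -1.\<close>

lemma C_k_reflect_shift: "C_k k f \<Longrightarrow> C_k k (\<lambda>y. a * f (x - y))"
proof (induction k arbitrary: f a)
  case 0
  then have "continuous_on UNIV f" by simp
  then have "continuous_on UNIV (\<lambda>y. f (x - y))"
    by (rule continuous_on_compose2) (auto intro!: continuous_intros)
  then show ?case by (simp add: continuous_on_mult_left)
next
  case (Suc k)
  then have "partial i (\<lambda>y. a * f (x - y)) = (\<lambda>y. - a * partial i f (x - y))" for i
    by (intro ext partial_reflect_shift) auto
  moreover have "(\<lambda>y. a * f (x - y)) differentiable (at y)" for y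
    using Suc.prems by (intro differentiableI[OF reflect_shift_has_derivative]) simp
  moreover have "C_k k (\<lambda>y. - a * partial i f (x - y))" for i
    using Suc.prems by (intro Suc.IH) simp
  ultimately show ?case by simp
qed

lemma partial_support: "{x. partial i f x \<noteq> 0} \<subseteq> closure {x. f x \<noteq> 0}"
proof -
  have "partial i f x = 0" if "x \<notin> closure {x. f x \<noteq> 0}" for x
  proof -
    have "(f has_derivative (\<lambda>h. 0)) (at x)"
      by (rule has_derivative_transform_within_open[where f = "\<lambda>x. 0" and s = "- closure {x. f x \<noteq> 0}"])
         (use that closure_subset[of "{x. f x \<noteq> 0}"] in auto)
    then show ?thesis by (simp add: partial_eq)
  qed
  then show ?thesis by auto
qed

lemma closure_partial_support: "closure {x. partial i f x \<noteq> 0} \<subseteq> closure {x. f x \<noteq> 0}"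
  by (simp add: closure_minimal partial_support)

lemma test_functions_partial:
  assumes "\<phi> \<in> test_functions \<Omega>"
  shows "partial i \<phi> \<in> test_functions \<Omega>"
proof -
  have "C_k k (partial i \<phi>)" for k
  proof -
    have "C_k (Suc k) \<phi>" using assms by (auto simp: test_functions_def simp del: C_k.simps)
    then show ?thesis by simp
  qed
  moreover have "compact (closure {x. partial i \<phi> x \<noteq> 0})"
    using assms bounded_subset[OF bounded_closure partial_support[of i \<phi>]]
    by (simp add: test_functions_def compact_closure)
  moreover have "closure {x. partial i \<phi> x \<noteq> 0} \<subseteq> \<Omega>"
    using assms closure_partial_support[of i \<phi>] by (auto simp: test_functions_def)
  ultimately show ?thesis by (simp add: test_functions_def)
qed

lemma test_functions_mono: "\<Omega> \<subseteq> \<Omega>' \<Longrightarrow> test_functions \<Omega> \<subseteq> test_functions \<Omega>'"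
  by (auto simp: test_functions_def)

section \<open>Square-integrable functions and differentiation under the integral\<close>

text \<open>Stated for an arbitrary measure, so that the same lemmas serve \<open>lebesgue\<close>
  and \<open>lebesgue_on \<Omega>\<close>.\<close>

definition sq_integrable :: "'a measure \<Rightarrow> ('a \<Rightarrow> real) \<Rightarrow> bool" where
  "sq_integrable M f \<longleftrightarrow> f \<in> borel_measurable M \<and> integrable M (\<lambda>x. (f x)\<^sup>2)"

lemma L2_iff: "u \<in> L2 \<Omega> \<longleftrightarrow> sq_integrable (lebesgue_on \<Omega>) u"
  by (simp add: L2_def sq_integrable_def)

lemma sq_integrableD:
  assumes "sq_integrable M f"
  shows "f \<in> borel_measurable M" "integrable M (\<lambda>x. (f x)\<^sup>2)"
  using assms by (auto simp: sq_integrable_def)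

lemma sq_integrable_mult:
  assumes "sq_integrable M f" "sq_integrable M g"
  shows "integrable M (\<lambda>x. f x * g x)"
proof (rule Bochner_Integration.integrable_bound)
  show "integrable M (\<lambda>x. (f x)\<^sup>2 + (g x)\<^sup>2)"
    using assms by (simp add: sq_integrable_def)
  show "(\<lambda>x. f x * g x) \<in> borel_measurable M"
    using assms by (auto simp: sq_integrable_def intro: borel_measurable_times)
  have "\<bar>a * b\<bar> \<le> a\<^sup>2 + b\<^sup>2" for a b :: real
  proof -
    have "0 \<le> (\<bar>a\<bar> - \<bar>b\<bar>)\<^sup>2" by simp
    then have "2 * \<bar>a * b\<bar> \<le> a\<^sup>2 + b\<^sup>2" by (simp add: power2_diff abs_mult)
    then show ?thesis by simp
  qed
  then show "AE x in M. norm (f x * g x) \<le> norm ((f x)\<^sup>2 + (g x)\<^sup>2)" by simp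
qed

lemma sq_integrable_add:
  assumes "sq_integrable M f" "sq_integrable M g"
  shows "sq_integrable M (\<lambda>x. f x + g x)"
  using assms sq_integrable_mult[OF assms]
  by (auto simp: sq_integrable_def power2_sum mult.assoc)

lemma sq_integrable_cmult: "sq_integrable M f \<Longrightarrow> sq_integrable M (\<lambda>x. c * f x)"
  by (auto simp: sq_integrable_def power_mult_distrib)

lemma sq_integrable_diff:
  "sq_integrable M f \<Longrightarrow> sq_integrable M g \<Longrightarrow> sq_integrable M (\<lambda>x. f x - g x)"
  using sq_integrable_add[of M f "\<lambda>x. - 1 * g x"] sq_integrable_cmult[of M g "-1"] by simp

lemma sq_integrable_zero [simp]: "sq_integrable M (\<lambda>x. 0)"
  by (simp add: sq_integrable_def)

lemma sq_integrable_bounded_mult: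
  assumes "sq_integrable M f" "a \<in> borel_measurable M" "\<And>x. x \<in> space M \<Longrightarrow> \<bar>a x\<bar> \<le> C"
  shows "sq_integrable M (\<lambda>x. a x * f x)"
  unfolding sq_integrable_def
proof
  show [measurable]: "(\<lambda>x. a x * f x) \<in> borel_measurable M"
    using assms by (auto simp: sq_integrable_def intro: borel_measurable_times)
  show "integrable M (\<lambda>x. (a x * f x)\<^sup>2)"
  proof (rule Bochner_Integration.integrable_bound)
    show "integrable M (\<lambda>x. C\<^sup>2 * (f x)\<^sup>2)" using assms(1) by (simp add: sq_integrable_def)
    show "(\<lambda>x. (a x * f x)\<^sup>2) \<in> borel_measurable M" by measurable
    have "(a x * f x)\<^sup>2 \<le> C\<^sup>2 * (f x)\<^sup>2" if "x \<in> space M" for x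
      using power_mono[OF assms(3)[OF that], of 2] by (simp add: power_mult_distrib mult_right_mono)
    then show "AE x in M. norm ((a x * f x)\<^sup>2) \<le> norm (C\<^sup>2 * (f x)\<^sup>2)"
      by (intro AE_I2) simp
  qed
qed

lemma sq_integrable_AE_cong:
  assumes "sq_integrable M f" "g \<in> borel_measurable M" "AE x in M. f x = g x"
  shows "sq_integrable M g"
  unfolding sq_integrable_def
proof
  have "integrable M (\<lambda>x. (f x)\<^sup>2) = integrable M (\<lambda>x. (g x)\<^sup>2)"
    by (rule integrable_cong_AE) (use assms in \<open>auto simp: sq_integrable_def\<close>)
  then show "integrable M (\<lambda>x. (g x)\<^sup>2)" using assms by (simp add: sq_integrable_def)
qed (fact assms)

lemma sq_integrable_Cauchy_Schwarz_square:
  assumes "sq_integrable M f" "sq_integrable M g"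
  shows "(LINT x|M. f x * g x)\<^sup>2 \<le> (LINT x|M. (f x)\<^sup>2) * (LINT x|M. (g x)\<^sup>2)"
proof -
  define A B b where "A = (LINT x|M. (f x)\<^sup>2)" and "B = (LINT x|M. (g x)\<^sup>2)"
    and "b = (LINT x|M. f x * g x)"
  have q: "0 \<le> s\<^sup>2 * A - 2 * s * t * b + t\<^sup>2 * B" for s t
  proof -
    have "0 \<le> (LINT x|M. (s * f x - t * g x)\<^sup>2)" by simp
    also have "\<dots> = (LINT x|M. s\<^sup>2 * (f x)\<^sup>2 - 2 * s * t * (f x * g x) + t\<^sup>2 * (g x)\<^sup>2)"
      by (intro Bochner_Integration.integral_cong) (auto simp: algebra_simps power2_eq_square)
    also have "\<dots> = s\<^sup>2 * A - 2 * s * t * b + t\<^sup>2 * B"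
      using assms sq_integrable_mult[OF assms] by (simp add: sq_integrable_def A_def B_def b_def)
    finally show ?thesis .
  qed
  have "b\<^sup>2 \<le> A * B"
  proof (cases "B = 0")
    case True
    have "0 \<le> A - 2 * t * b" for t using q[of 1 t] True by simp
    \<comment> \<open>For b \<noteq> 0 this value of t would turn the inequality into 0 \<le>
      -1.\<close>
    from this[of "(A + 1) / (2 * b)"] have "b = 0" by (auto split: if_splits)
    then show ?thesis using True by simp
  next
    case False
    have "0 \<le> B" by (simp add: B_def)
    with False have "0 < B" by simp
    \<comment> \<open>Up to scaling, s = B and t = b is the minimiser of the quadratic form.\<close>
    have "0 \<le> B * (A * B - b\<^sup>2)" using q[of B b] by (simp add: algebra_simps power2_eq_square)
    with \<open>0 < B\<close> show ?thesis by (simp add: zero_le_mult_iff)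
  qed
  then show ?thesis by (simp add: A_def B_def b_def)
qed

lemma sq_integrable_Cauchy_Schwarz:
  assumes "sq_integrable M f" "sq_integrable M g"
  shows "\<bar>LINT x|M. f x * g x\<bar> \<le> sqrt (LINT x|M. (f x)\<^sup>2) * sqrt (LINT x|M. (g x)\<^sup>2)"
  using real_sqrt_le_mono[OF sq_integrable_Cauchy_Schwarz_square[OF assms]]
  by (simp add: real_sqrt_mult)

lemma integral_square_add_le:
  assumes "sq_integrable M f" "sq_integrable M g"
  shows "(LINT x|M. (f x + g x)\<^sup>2) \<le> 2 * (LINT x|M. (f x)\<^sup>2) + 2 * (LINT x|M. (g x)\<^sup>2)"
proof -
  have "(LINT x|M. (f x + g x)\<^sup>2) \<le> (LINT x|M. 2 * (f x)\<^sup>2 + 2 * (g x)\<^sup>2)"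
  proof (rule integral_mono)
    show "(f x + g x)\<^sup>2 \<le> 2 * (f x)\<^sup>2 + 2 * (g x)\<^sup>2" for x
      using zero_le_power2[of "f x - g x"] by (simp add: power2_sum power2_diff)
  qed (use assms sq_integrable_add[OF assms] in \<open>auto simp: sq_integrable_def\<close>)
  also have "\<dots> = 2 * (LINT x|M. (f x)\<^sup>2) + 2 * (LINT x|M. (g x)\<^sup>2)"
    using assms by (simp add: sq_integrable_def)
  finally show ?thesis .
qed

text \<open>The limits of products below take this form: \<open>f n\<close> converges only in L^2,
  \<open>a n\<close> only almost everywhere but boundedly. The integrand splits into (f n - f') a n
  c, which Cauchy-Schwarz controls, and f' a n c, where dominated convergence applies.\<close>

lemma tendsto_integral_bounded_L2:
  fixes a :: "nat \<Rightarrow> 'a \<Rightarrow> real"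
  assumes f: "\<And>n. sq_integrable M (f n)" "sq_integrable M f'"
    and conv: "(\<lambda>n. LINT x|M. (f n x - f' x)\<^sup>2) \<longlonglongrightarrow> 0"
    and a: "\<And>n. a n \<in> borel_measurable M" "a' \<in> borel_measurable M"
    and bound: "\<And>n x. x \<in> space M \<Longrightarrow> \<bar>a n x\<bar> \<le> C"
    and lim: "AE x in M. (\<lambda>n. a n x) \<longlonglongrightarrow> a' x"
    and c: "sq_integrable M c"
  shows "(\<lambda>n. LINT x|M. a n x * f n x * c x) \<longlonglongrightarrow> (LINT x|M. a' x * f' x * c x)"
proof -
  have ac: "sq_integrable M (\<lambda>x. a n x * c x)" for n
    by (rule sq_integrable_bounded_mult[OF c a(1) bound])
  have fd: "sq_integrable M (\<lambda>x. f n x - f' x)" for n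
    by (rule sq_integrable_diff[OF f])
  have i1: "integrable M (\<lambda>x. (f n x - f' x) * (a n x * c x))" for n
    by (rule sq_integrable_mult[OF fd ac])
  have i2: "integrable M (\<lambda>x. f' x * (a n x * c x))" for n
    by (rule sq_integrable_mult[OF f(2) ac])
  have b: "norm (LINT x|M. (f n x - f' x) * (a n x * c x)) \<le>
     sqrt (LINT x|M. (f n x - f' x)\<^sup>2) * (\<bar>C\<bar> * sqrt (LINT x|M. (c x)\<^sup>2))" for n
  proof -
    have "(LINT x|M. (a n x * c x)\<^sup>2) \<le> (LINT x|M. C\<^sup>2 * (c x)\<^sup>2)"
    proof (rule integral_mono)
      show "(a n x * c x)\<^sup>2 \<le> C\<^sup>2 * (c x)\<^sup>2" if "x \<in> space M" for x
        using power_mono[OF bound[OF that, of n], of 2] by (simp add: power_mult_distrib mult_right_mono)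
    qed (use ac c in \<open>auto simp: sq_integrable_def\<close>)
    then have "sqrt (LINT x|M. (a n x * c x)\<^sup>2) \<le> sqrt (C\<^sup>2 * (LINT x|M. (c x)\<^sup>2))"
      by (intro real_sqrt_le_mono) simp
    then have "sqrt (LINT x|M. (a n x * c x)\<^sup>2) \<le> \<bar>C\<bar> * sqrt (LINT x|M. (c x)\<^sup>2)"
      by (simp add: real_sqrt_mult)
    then have "sqrt (LINT x|M. (f n x - f' x)\<^sup>2) * sqrt (LINT x|M. (a n x * c x)\<^sup>2)
      \<le> sqrt (LINT x|M. (f n x - f' x)\<^sup>2) * (\<bar>C\<bar> * sqrt (LINT x|M. (c x)\<^sup>2))"
      by (rule mult_left_mono) simp
    with sq_integrable_Cauchy_Schwarz[OF fd ac, of n n] show ?thesis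
      unfolding real_norm_def by (rule order_trans)
  qed
  have l0: "(\<lambda>n. sqrt (LINT x|M. (f n x - f' x)\<^sup>2) * (\<bar>C\<bar> * sqrt (LINT x|M. (c x)\<^sup>2))) \<longlonglongrightarrow> 0"
    using tendsto_mult_left_zero[OF tendsto_real_sqrt[OF conv, unfolded real_sqrt_zero]] .
  have l1: "(\<lambda>n. LINT x|M. (f n x - f' x) * (a n x * c x)) \<longlonglongrightarrow> 0"
    by (rule Lim_null_comparison[OF always_eventually[OF allI[OF b]] l0])
  have l2: "(\<lambda>n. LINT x|M. f' x * (a n x * c x)) \<longlonglongrightarrow> (LINT x|M. f' x * (a' x * c x))"
  proof (rule integral_dominated_convergence[where w = "\<lambda>x. \<bar>C\<bar> * \<bar>f' x * c x\<bar>"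
        and s = "\<lambda>n x. f' x * (a n x * c x)" and f = "\<lambda>x. f' x * (a' x * c x)"])
    show "integrable M (\<lambda>x. \<bar>C\<bar> * \<bar>f' x * c x\<bar>)"
      using sq_integrable_mult[OF f(2) c] by simp
    show "AE x in M. (\<lambda>n. f' x * (a n x * c x)) \<longlonglongrightarrow> f' x * (a' x * c x)"
      using lim by eventually_elim (intro tendsto_intros)
    show "AE x in M. norm (f' x * (a n x * c x)) \<le> \<bar>C\<bar> * \<bar>f' x * c x\<bar>" for n
    proof (rule AE_I2)
      fix x assume "x \<in> space M"
      then have "\<bar>a n x\<bar> \<le> \<bar>C\<bar>" using bound[of x n] by simp
      then have "\<bar>a n x\<bar> * \<bar>f' x * c x\<bar> \<le> \<bar>C\<bar> * \<bar>f' x * c x\<bar>" by (rule mult_right_mono) simp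
      then show "norm (f' x * (a n x * c x)) \<le> \<bar>C\<bar> * \<bar>f' x * c x\<bar>"
        by (simp add: abs_mult ac_simps)
    qed
    show "(\<lambda>x. f' x * (a' x * c x)) \<in> borel_measurable M"
      using a f(2) c by (intro borel_measurable_times) (auto simp: sq_integrable_def)
    show "(\<lambda>x. f' x * (a n x * c x)) \<in> borel_measurable M" for n
      using a f(2) c by (intro borel_measurable_times) (auto simp: sq_integrable_def)
  qed
  have eq: "(LINT x|M. a n x * f n x * c x) =
      (LINT x|M. (f n x - f' x) * (a n x * c x)) + (LINT x|M. f' x * (a n x * c x))" for n
    unfolding Bochner_Integration.integral_add[OF i1 i2, symmetric]
    by (rule Bochner_Integration.integral_cong) (simp_all add: left_diff_distrib)
  have "(LINT x|M. f' x * (a' x * c x)) = (LINT x|M. a' x * f' x * c x)"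
    by (rule Bochner_Integration.integral_cong) simp_all
  with tendsto_add[OF l1 l2] show ?thesis unfolding eq by simp
qed

text \<open>Dominated convergence for the remainders of the difference quotients, which are bounded
  by 2 g. The parameter ranges over any Euclidean space because it will be a point
  (\<open>conv_has_derivative\<close>), the length of a shift (\<open>integral_partial_eq_0\<close>)
  and a radius (\<open>conv_moll_has_derivative_radius\<close>).\<close>

lemma has_derivative_lebesgue_integral:
  fixes F :: "'a::euclidean_space \<Rightarrow> 'b \<Rightarrow> real" and F' :: "'b \<Rightarrow> 'a \<Rightarrow> real"
  assumes d: "0 < d"
    and F: "\<And>x. x \<in> ball x0 d \<Longrightarrow> integrable M (F x)"
    and deriv: "\<And>y. y \<in> space M \<Longrightarrow> ((\<lambda>x. F x y) has_derivative F' y) (at x0)"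
    and lip: "\<And>x y. x \<in> ball x0 d \<Longrightarrow> y \<in> space M \<Longrightarrow> \<bar>F x y - F x0 y\<bar> \<le> g y * norm (x - x0)"
    and F'b: "\<And>y h. y \<in> space M \<Longrightarrow> \<bar>F' y h\<bar> \<le> g y * norm h"
    and g: "integrable M g"
    and F': "\<And>h. (\<lambda>y. F' y h) \<in> borel_measurable M"
  shows "((\<lambda>x. LINT y|M. F x y) has_derivative (\<lambda>h. LINT y|M. F' y h)) (at x0)"
proof -
  have g0: "0 \<le> g y" if "y \<in> space M" for y
  proof -
    obtain b :: 'a where "b \<in> Basis" using nonempty_Basis by blast
    then show ?thesis using F'b[OF that, of b] by simp
  qed
  have iF': "integrable M (\<lambda>y. F' y h)" for h
  proof (rule Bochner_Integration.integrable_bound)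
    show "integrable M (\<lambda>y. g y * norm h)" using g by simp
    show "AE y in M. norm (F' y h) \<le> norm (g y * norm h)"
      using F'b[of _ h] g0 by (intro AE_I2) (simp add: abs_mult)
  qed (rule F')
  have lin: "linear (F' y)" if "y \<in> space M" for y
    using deriv[OF that] has_derivative_linear by blast
  have bl: "bounded_linear (\<lambda>h. LINT y|M. F' y h)"
  proof (rule bounded_linear_intro[where K = "LINT y|M. g y"])
    show "(LINT y|M. F' y (a + b)) = (LINT y|M. F' y a) + (LINT y|M. F' y b)" for a b
      by (subst Bochner_Integration.integral_add[symmetric])
         (auto intro!: Bochner_Integration.integral_cong iF' simp: linear_add[OF lin])
    show "(LINT y|M. F' y (r *\<^sub>R a)) = r *\<^sub>R (LINT y|M. F' y a)" for a r
      by (simp add: linear_cmul[OF lin] cong: Bochner_Integration.integral_cong)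
    show "norm (LINT y|M. F' y h) \<le> norm h * (LINT y|M. g y)" for h
    proof -
      have "norm (LINT y|M. F' y h) \<le> (LINT y|M. norm h * g y)"
        using F'b[of _ h] g
        by (intro order_trans[OF integral_norm_bound integral_mono] integrable_norm iF') (auto simp: mult.commute)
      then show ?thesis by simp
    qed
  qed
  have "((\<lambda>x. norm ((LINT y|M. F x y) - (LINT y|M. F x0 y) - (LINT y|M. F' y (x - x0))) / norm (x - x0))
      \<longlongrightarrow> 0) (at x0 within ball x0 d)"
    unfolding tendsto_at_iff_sequentially
  proof (intro allI impI)
    fix X assume X: "\<forall>i. X i \<in> ball x0 d - {x0}" "X \<longlonglongrightarrow> x0"
    let ?Q = "\<lambda>i y. (F (X i) y - F x0 y - F' y (X i - x0)) / norm (X i - x0)"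
    have "(\<lambda>i. LINT y|M. ?Q i y) \<longlonglongrightarrow> (LINT y|M. 0)"
    proof (rule integral_dominated_convergence[where w = "\<lambda>y. 2 * g y"])
      show "?Q i \<in> borel_measurable M" for i
        using F[of "X i"] F[of x0] X(1) d F' by auto
      show "integrable M (\<lambda>y. 2 * g y)" using g by simp
      show "AE y in M. (\<lambda>i. ?Q i y) \<longlonglongrightarrow> 0"
      proof (rule AE_I2)
        fix y assume "y \<in> space M"
        then have "((\<lambda>x. norm (F x y - F x0 y - F' y (x - x0)) / norm (x - x0)) \<longlongrightarrow> 0) (at x0)"
          using deriv unfolding has_derivative_iff_norm by blast
        then have "(\<lambda>i. norm (F (X i) y - F x0 y - F' y (X i - x0)) / norm (X i - x0)) \<longlonglongrightarrow> 0"
          using X unfolding tendsto_at_iff_sequentially by (auto simp: o_def)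
        then have "(\<lambda>i. norm (?Q i y)) \<longlonglongrightarrow> 0" by simp
        then show "(\<lambda>i. ?Q i y) \<longlonglongrightarrow> 0" by (rule tendsto_norm_zero_cancel)
      qed
      show "AE y in M. norm (?Q i y) \<le> 2 * g y" for i
      proof (rule AE_I2)
        fix y assume y: "y \<in> space M"
        have p: "0 < norm (X i - x0)" using X(1) by auto
        have "\<bar>F (X i) y - F x0 y - F' y (X i - x0)\<bar> \<le> g y * norm (X i - x0) + g y * norm (X i - x0)"
          using lip[of "X i" y] F'b[of y "X i - x0"] X(1) y abs_triangle_ineq4 add_mono order_trans
          by (metis (no_types, lifting) DiffD1)
        then show "norm (?Q i y) \<le> 2 * g y"
          using p by (simp add: field_simps)
      qed
    qed simp
    then have *: "(\<lambda>i. norm (LINT y|M. ?Q i y)) \<longlonglongrightarrow> 0"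
      using tendsto_norm_zero by fastforce
    have eq: "norm (LINT y|M. ?Q i y) =
       norm ((LINT y|M. F (X i) y) - (LINT y|M. F x0 y) - (LINT y|M. F' y (X i - x0))) / norm (X i - x0)" for i
    proof -
      have "integrable M (F (X i))" "integrable M (F x0)" using F X(1) d by auto
      then show ?thesis using iF'[of "X i - x0"] by simp
    qed
    from *[unfolded eq]
    show "((\<lambda>x. norm ((LINT y|M. F x y) - (LINT y|M. F x0 y) - (LINT y|M. F' y (x - x0))) / norm (x - x0)) \<circ> X)
        \<longlonglongrightarrow> 0"
      by (simp add: o_def)
  qed
  then show ?thesis
    using bl d by (simp add: has_derivative_iff_norm at_within_open[of x0 "ball x0 d"])
qed

lemma continuous_bounded_support_bounded:
  fixes f :: "real^3 \<Rightarrow> real"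
  assumes "continuous_on UNIV f" "bounded {x. f x \<noteq> 0}"
  obtains B where "0 < B" "\<And>x. \<bar>f x\<bar> \<le> B"
proof -
  let ?K = "closure {x. f x \<noteq> 0}"
  have "compact ?K" using assms by (simp add: compact_closure)
  then have "bounded (f ` ?K)"
    by (intro compact_imp_bounded compact_continuous_image continuous_on_subset[OF assms(1)]) auto
  then obtain B where B: "0 < B" "\<And>x. x \<in> ?K \<Longrightarrow> \<bar>f x\<bar> \<le> B"
    by (auto simp: bounded_pos)
  have "\<bar>f x\<bar> \<le> B" for x
    using B closure_subset[of "{x. f x \<noteq> 0}"] by (cases "f x = 0") auto
  with B that show thesis by blast
qed

text \<open>One constant L bounds the increments and the derivative, the two bounds that
  \<open>has_derivative_lebesgue_integral\<close> asks for.\<close>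

lemma C1_bounded_support_Lipschitz:
  assumes "C_k (Suc 0) f" "bounded {x. f x \<noteq> 0}"
  obtains L where "0 < L" "\<And>x y. \<bar>f x - f y\<bar> \<le> L * norm (x - y)"
    "\<And>x h. \<bar>\<Sum>i\<in>UNIV. h $ i * partial i f x\<bar> \<le> L * norm h"
proof -
  have "\<exists>B. 0 < B \<and> (\<forall>x. \<bar>partial i f x\<bar> \<le> B)" for i
    by (rule continuous_bounded_support_bounded[OF C_k_1D(2)[OF assms(1), of i]
          bounded_subset[OF bounded_closure[OF assms(2)] partial_support[of i]]]) blast
  then have "\<forall>i. \<exists>B. 0 < B \<and> (\<forall>x. \<bar>partial i f x\<bar> \<le> B)" ..
  from choice[OF this]
  obtain B where B: "\<And>i. 0 < B i" "\<And>i x. \<bar>partial i f x\<bar> \<le> B i" by blast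
  let ?L = "\<Sum>i\<in>UNIV. B i"
  have h: "\<bar>\<Sum>i\<in>UNIV. h $ i * partial i f x\<bar> \<le> ?L * norm h" for x h
  proof -
    have "\<bar>\<Sum>i\<in>UNIV. h $ i * partial i f x\<bar> \<le> (\<Sum>i\<in>UNIV. \<bar>h $ i * partial i f x\<bar>)"
      by (rule sum_abs)
    also have "\<dots> \<le> (\<Sum>i\<in>UNIV. norm h * B i)"
      unfolding abs_mult by (intro sum_mono mult_mono component_le_norm_cart B norm_ge_zero abs_ge_zero)
    also have "\<dots> = ?L * norm h" unfolding sum_distrib_right by (simp only: mult.commute)
    finally show ?thesis .
  qed
  have "norm (f x - f y) \<le> ?L * norm (x - y)" for x y
  proof (rule differentiable_bound[OF convex_UNIV])
    fix z :: "real^3"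
    show "(f has_derivative (\<lambda>h. \<Sum>i\<in>UNIV. h $ i * partial i f z)) (at z within UNIV)"
      using has_derivative_partial[OF C_k_1D(1)[OF assms(1)]] .
    show "onorm (\<lambda>h. \<Sum>i\<in>UNIV. h $ i * partial i f z) \<le> ?L"
      using h[of _ z] by (intro onorm_le) (simp only: real_norm_def)
  qed (rule UNIV_I)+
  then have lip: "\<bar>f x - f y\<bar> \<le> ?L * norm (x - y)" for x y
    by (simp only: real_norm_def)
  have "0 < ?L" by (intro sum_pos B) auto
  then show thesis by (rule that[OF _ lip h])
qed

lemma test_functionsD:
  assumes "\<phi> \<in> test_functions \<Omega>"
  shows "C_k k \<phi>" "continuous_on UNIV \<phi>" "bounded {x. \<phi> x \<noteq> 0}" "\<phi> differentiable (at x)"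
    "\<phi> \<in> borel_measurable borel"
proof -
  show "C_k k \<phi>" using assms by (auto simp: test_functions_def)
  have "C_k (Suc 0) \<phi>" using assms unfolding test_functions_def by blast
  from C_k_1D[OF this] show c: "continuous_on UNIV \<phi>" and "\<phi> differentiable (at x)" by auto
  show "bounded {x. \<phi> x \<noteq> 0}" using assms
    by (auto simp: test_functions_def compact_closure)
  show "\<phi> \<in> borel_measurable borel" using c by (rule borel_measurable_continuous_onI)
qed

lemma test_functions_UNIV_iff:
  "\<phi> \<in> test_functions UNIV \<longleftrightarrow> (\<forall>k. C_k k \<phi>) \<and> bounded {x. \<phi> x \<noteq> 0}"
  by (simp add: test_functions_def compact_closure)

section \<open>Convolution\<close>

lemma L2_UNIV_iff: "u \<in> L2 UNIV \<longleftrightarrow> sq_integrable lebesgue u"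
  by (simp add: L2_iff lebesgue_on_UNIV_eq)

lemma bounded_subset_cballE:
  fixes S :: "(real^3) set"
  assumes "bounded S"
  obtains R where "0 < R" "S \<subseteq> cball 0 R"
  using bounded_subset_ballD[OF assms, of 0] ball_subset_cball by (metis order_trans)

lemma continuous_lebesgue_measurable:
  fixes f :: "real^3 \<Rightarrow> real"
  shows "continuous_on UNIV f \<Longrightarrow> f \<in> borel_measurable lebesgue"
  by (intro measurable_completion) (simp add: borel_measurable_continuous_onI)

lemma integrable_indicator_cball: "integrable lebesgue (indicator (cball a r) :: real^3 \<Rightarrow> real)"
  using lmeasurable_cball[of a r] by (simp add: fmeasurable_def)

lemma sq_integrable_indicator_cball: "sq_integrable lebesgue (indicator (cball a r) :: real^3 \<Rightarrow> real)"
proof -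
  have "(\<lambda>x. (indicator (cball a r) x :: real)\<^sup>2) = indicator (cball a r)"
    by (auto simp: indicator_def)
  then show ?thesis using integrable_indicator_cball[of a r] by (simp add: sq_integrable_def)
qed

lemma continuous_bounded_support_integrable:
  fixes f :: "real^3 \<Rightarrow> real"
  assumes "continuous_on UNIV f" "bounded {x. f x \<noteq> 0}"
  shows "integrable lebesgue f"
proof -
  obtain B where B: "0 < B" "\<And>x. \<bar>f x\<bar> \<le> B"
    by (rule continuous_bounded_support_bounded[OF assms]) blast
  obtain R where R: "{x. f x \<noteq> 0} \<subseteq> cball 0 R"
    using assms(2) by (elim bounded_subset_cballE) blast
  show ?thesis
  proof (rule Bochner_Integration.integrable_bound)
    show "integrable lebesgue (\<lambda>x. B * indicator (cball (0::real^3) R) x)"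
      by (intro integrable_mult_right integrable_indicator_cball)
    show "f \<in> borel_measurable lebesgue"
      by (rule continuous_lebesgue_measurable[OF assms(1)])
    have "norm (f x) \<le> norm (B * indicator (cball (0::real^3) R) x)" for x
      using B R by (cases "f x = 0") (auto simp: indicator_def subset_iff)
    then show "AE x in lebesgue. norm (f x) \<le> norm (B * indicator (cball (0::real^3) R) x)"
      by simp
  qed
qed

lemma continuous_bounded_support_sq_integrable:
  fixes f :: "real^3 \<Rightarrow> real"
  assumes "continuous_on UNIV f" "bounded {x. f x \<noteq> 0}"
  shows "sq_integrable lebesgue f"
  unfolding sq_integrable_def
proof
  show "integrable lebesgue (\<lambda>x. (f x)\<^sup>2)"
    by (rule continuous_bounded_support_integrable)
       (use assms in \<open>auto intro!: continuous_intros simp: zero_eq_power2\<close>)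
qed (rule continuous_lebesgue_measurable[OF assms(1)])

text \<open>The change of variables is an identity for \<open>lborel\<close>; hence the assumption
  of Borel measurability, with \<open>integral_completion\<close> carrying the result to
  \<open>lebesgue\<close>.\<close>

lemma integral_translation:
  fixes f :: "real^3 \<Rightarrow> real"
  assumes [measurable]: "f \<in> borel_measurable borel"
  shows "(LINT x|lebesgue. f (a + x)) = (LINT x|lebesgue. f x)"
proof -
  have *: "lborel = distr lborel borel (\<lambda>x::real^3. a + x)"
    using lborel_affine[of 1 a] by (simp add: density_1)
  have "(LINT x|lborel. f x) = (LINT x|lborel. f (a + x))"
    by (subst *) (simp add: integral_distr)
  then show ?thesis by (simp add: integral_completion)
qed

lemma integral_reflection:
  fixes f :: "real^3 \<Rightarrow> real"
  assumes [measurable]: "f \<in> borel_measurable borel"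
  shows "(LINT x|lebesgue. f (a - x)) = (LINT x|lebesgue. f x)"
proof -
  have *: "lborel = distr lborel borel (\<lambda>x::real^3. a - x)"
    using lborel_affine[of "-1" a] by (simp add: density_1)
  have "(LINT x|lborel. f x) = (LINT x|lborel. f (a - x))"
    by (subst *) (simp add: integral_distr)
  then show ?thesis by (simp add: integral_completion)
qed

lemma integral_scaling:
  fixes f :: "real^3 \<Rightarrow> real"
  assumes [measurable]: "f \<in> borel_measurable borel" and r: "0 < r"
  shows "(LINT x|lebesgue. f x) = r ^ 3 * (LINT x|lebesgue. f (r *\<^sub>R x))"
proof -
  have *: "lborel = density (distr lborel borel (\<lambda>x::real^3. r *\<^sub>R x)) (\<lambda>_. ennreal (r ^ 3))"
    using lborel_affine[of r "0::real^3"] r by (simp add: ennreal_power)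
  have "(LINT x|lborel. f x) = (LINT x|lborel. r ^ 3 * f (r *\<^sub>R x))"
    by (subst *, subst integral_density) (use r in \<open>auto simp: integral_distr\<close>)
  then show ?thesis by (simp add: integral_completion)
qed

text \<open>The second argument carries the smoothness and takes the derivatives; the first one is
  in general only in L^2.\<close>

definition conv :: "scalar_field \<Rightarrow> scalar_field \<Rightarrow> scalar_field" where
  "conv g \<phi> x = (LINT y|lebesgue. g y * \<phi> (x - y))"

lemma reflect_shift_support:
  fixes \<phi> :: scalar_field
  assumes "{x. \<phi> x \<noteq> 0} \<subseteq> cball 0 r"
  shows "{y. \<phi> (x - y) \<noteq> 0} \<subseteq> cball x r"
  using assms by (auto simp: dist_norm subset_iff)

lemma bounded_reflect_shift_support:
  fixes \<phi> :: scalar_field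
  assumes "bounded {x. \<phi> x \<noteq> 0}"
  shows "bounded {y. \<phi> (x - y) \<noteq> 0}"
proof -
  obtain R where "{x. \<phi> x \<noteq> 0} \<subseteq> cball 0 R" using assms by (elim bounded_subset_cballE) blast
  from reflect_shift_support[OF this] show ?thesis by (rule bounded_subset[OF bounded_cball])
qed

lemma continuous_reflect_shift:
  fixes \<phi> :: scalar_field
  shows "continuous_on UNIV \<phi> \<Longrightarrow> continuous_on UNIV (\<lambda>y. \<phi> (x - y))"
  by (rule continuous_on_compose2[of UNIV \<phi>]) (auto intro!: continuous_intros)

lemma sq_integrable_reflect_shift:
  fixes \<phi> :: scalar_field
  assumes "continuous_on UNIV \<phi>" "bounded {x. \<phi> x \<noteq> 0}"
  shows "sq_integrable lebesgue (\<lambda>y. \<phi> (x - y))"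
  by (intro continuous_bounded_support_sq_integrable continuous_reflect_shift bounded_reflect_shift_support assms)

lemma conv_integrable:
  fixes \<phi> :: scalar_field
  assumes "sq_integrable lebesgue g" "continuous_on UNIV \<phi>" "bounded {x. \<phi> x \<noteq> 0}"
  shows "integrable lebesgue (\<lambda>y. g y * \<phi> (x - y))"
  by (rule sq_integrable_mult[OF assms(1) sq_integrable_reflect_shift[OF assms(2,3)]])

lemma test_functions_reflect_shift:
  assumes "\<phi> \<in> test_functions UNIV" "{x. \<phi> x \<noteq> 0} \<subseteq> cball 0 r" "cball x r \<subseteq> \<Omega>"
  shows "(\<lambda>y. \<phi> (x - y)) \<in> test_functions \<Omega>"
proof -
  have s: "closure {y. \<phi> (x - y) \<noteq> 0} \<subseteq> cball x r"
    by (intro closure_minimal reflect_shift_support assms) simp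
  have "C_k k (\<lambda>y. \<phi> (x - y))" for k
    using C_k_reflect_shift[of k \<phi> 1 x] test_functionsD(1)[OF assms(1)] by simp
  moreover have "bounded {y. \<phi> (x - y) \<noteq> 0}"
    by (intro bounded_reflect_shift_support test_functionsD(3)[OF assms(1)])
  ultimately show ?thesis using s assms(3) by (auto simp: test_functions_def compact_closure)
qed

lemma partial_reflect:
  assumes "\<phi> differentiable (at (x - y))"
  shows "partial i (\<lambda>y. \<phi> (x - y)) y = - partial i \<phi> (x - y)"
  using partial_reflect_shift[OF assms, of i 1] by simp

lemma conv_has_derivative:
  assumes g: "sq_integrable lebesgue g" and \<phi>: "C_k (Suc 0) \<phi>" "bounded {x. \<phi> x \<noteq> 0}"
  shows "(conv g \<phi> has_derivative (\<lambda>h. \<Sum>i\<in>UNIV. h $ i * conv g (partial i \<phi>) x)) (at x)"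
proof -
  obtain L where L: "0 < L" "\<And>x y. \<bar>\<phi> x - \<phi> y\<bar> \<le> L * norm (x - y)"
    "\<And>x h. \<bar>\<Sum>i\<in>UNIV. h $ i * partial i \<phi> x\<bar> \<le> L * norm h"
    by (rule C1_bounded_support_Lipschitz[OF \<phi>]) blast
  obtain R where R: "{x. \<phi> x \<noteq> 0} \<subseteq> cball 0 R"
    using \<phi>(2) by (elim bounded_subset_cballE) blast
  have cl: "closure {x. \<phi> x \<noteq> 0} \<subseteq> cball 0 R"
    by (intro closure_minimal R) simp
  \<comment> \<open>While z stays in the unit ball around x, the integrand is supported in this
    ball, on which the L^2 function g is integrable.\<close>
  let ?I = "indicator (cball x (R + 1)) :: real^3 \<Rightarrow> real"
  have z: "\<phi> (z - y) = 0" if "z \<in> ball x 1" "y \<notin> cball x (R + 1)" for z y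
  proof -
    have "dist z y > R" using that dist_triangle[of x y z] by (auto simp: dist_commute)
    then show ?thesis using R by (auto simp: dist_norm subset_iff not_le)
  qed
  have pz: "partial i \<phi> (x - y) = 0" if "y \<notin> cball x (R + 1)" for y i
  proof -
    have "x - y \<notin> cball 0 R" using that by (auto simp: dist_norm norm_minus_commute)
    then show ?thesis using partial_support[of i \<phi>] cl by blast
  qed
  have pc: "continuous_on UNIV (partial i \<phi>)" for i by (rule C_k_1D[OF \<phi>(1)])
  have pb: "bounded {x. partial i \<phi> x \<noteq> 0}" for i
    by (rule bounded_subset[OF bounded_closure[OF \<phi>(2)] partial_support])
  have "((\<lambda>x. LINT y|lebesgue. g y * \<phi> (x - y)) has_derivative
      (\<lambda>h. LINT y|lebesgue. g y * (\<Sum>i\<in>UNIV. h $ i * partial i \<phi> (x - y)))) (at x)"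
  proof (rule has_derivative_lebesgue_integral[where d = 1 and g = "\<lambda>y. L * \<bar>g y * ?I y\<bar>"])
    show "integrable lebesgue (\<lambda>y. g y * \<phi> (z - y))" for z
      by (rule conv_integrable[OF g C_k_1D(3)[OF \<phi>(1)] \<phi>(2)])
    show "((\<lambda>x. g y * \<phi> (x - y)) has_derivative
         (\<lambda>h. g y * (\<Sum>i\<in>UNIV. h $ i * partial i \<phi> (x - y)))) (at x)" for y
    proof -
      have "((\<lambda>x. x - y) has_derivative (\<lambda>h. h)) (at x)"
        by (auto intro!: derivative_eq_intros)
      from has_derivative_compose[OF this has_derivative_partial[OF C_k_1D(1)[OF \<phi>(1)]]]
      show ?thesis by (rule has_derivative_mult_right)
    qed
    show "\<bar>g y * \<phi> (z - y) - g y * \<phi> (x - y)\<bar> \<le> L * \<bar>g y * ?I y\<bar> * norm (z - x)"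
      if "z \<in> ball x 1" for z y
    proof (cases "y \<in> cball x (R + 1)")
      case True
      have "\<bar>\<phi> (z - y) - \<phi> (x - y)\<bar> \<le> L * norm (z - x)" using L(2)[of "z - y" "x - y"] by simp
      then have "\<bar>g y\<bar> * \<bar>\<phi> (z - y) - \<phi> (x - y)\<bar> \<le> \<bar>g y\<bar> * (L * norm (z - x))"
        by (rule mult_left_mono) simp
      then show ?thesis using True by (simp add: right_diff_distrib[symmetric] abs_mult ac_simps)
    next
      case False
      then have "\<phi> (z - y) = 0" "\<phi> (x - y) = 0" using z[of z y] z[of x y] that by auto
      then show ?thesis using L(1) by simp
    qed
    show "\<bar>g y * (\<Sum>i\<in>UNIV. h $ i * partial i \<phi> (x - y))\<bar> \<le> L * \<bar>g y * ?I y\<bar> * norm h" for y h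
    proof (cases "y \<in> cball x (R + 1)")
      case True
      have "\<bar>g y\<bar> * \<bar>\<Sum>i\<in>UNIV. h $ i * partial i \<phi> (x - y)\<bar> \<le> \<bar>g y\<bar> * (L * norm h)"
        by (rule mult_left_mono[OF L(3)]) simp
      then show ?thesis using True by (simp add: abs_mult ac_simps)
    next
      case False
      then show ?thesis using L(1) by (simp add: pz)
    qed
    from sq_integrable_mult[OF g sq_integrable_indicator_cball]
    show "integrable lebesgue (\<lambda>y. L * \<bar>g y * ?I y\<bar>)" by simp
    show "(\<lambda>y. g y * (\<Sum>i\<in>UNIV. h $ i * partial i \<phi> (x - y))) \<in> borel_measurable lebesgue" for h
      by (intro borel_measurable_times borel_measurable_sum borel_measurable_const sq_integrableD(1)[OF g]
          continuous_lebesgue_measurable continuous_reflect_shift pc)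
  qed simp
  moreover have "(LINT y|lebesgue. g y * (\<Sum>i\<in>UNIV. h $ i * partial i \<phi> (x - y))) =
      (\<Sum>i\<in>UNIV. h $ i * conv g (partial i \<phi>) x)" for h
  proof -
    have "(LINT y|lebesgue. g y * (\<Sum>i\<in>UNIV. h $ i * partial i \<phi> (x - y))) =
       (LINT y|lebesgue. (\<Sum>i\<in>UNIV. h $ i * (g y * partial i \<phi> (x - y))))"
      by (intro Bochner_Integration.integral_cong refl) (simp add: sum_distrib_left ac_simps)
    also have "\<dots> = (\<Sum>i\<in>UNIV. LINT y|lebesgue. h $ i * (g y * partial i \<phi> (x - y)))"
      by (rule Bochner_Integration.integral_sum) (intro integrable_mult_right conv_integrable g pc pb)
    finally show ?thesis by (simp add: conv_def)
  qed
  ultimately show ?thesis by (simp add: conv_def[abs_def])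
qed

lemma conv_partial:
  assumes "sq_integrable lebesgue g" "C_k (Suc 0) \<phi>" "bounded {x. \<phi> x \<noteq> 0}"
  shows "partial i (conv g \<phi>) = conv g (partial i \<phi>)" "conv g \<phi> differentiable (at x)"
proof -
  show "partial i (conv g \<phi>) = conv g (partial i \<phi>)"
    by (rule ext, subst partial_eq[OF conv_has_derivative[OF assms]])
       (simp add: axis_def if_distrib [of "\<lambda>z. z * _"] cong: if_cong)
  show "conv g \<phi> differentiable (at x)"
    by (rule differentiableI[OF conv_has_derivative[OF assms]])
qed

lemma conv_C_k:
  assumes "sq_integrable lebesgue g" "\<phi> \<in> test_functions UNIV"
  shows "C_k k (conv g \<phi>)"
  using assms(2)
proof (induction k arbitrary: \<phi>)
  case 0
  have "conv g \<phi> differentiable (at x)" for x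
    by (rule conv_partial(2)[OF assms(1) test_functionsD(1,3)[OF 0]])
  then show ?case
    by (auto simp: continuous_on_eq_continuous_within intro: differentiable_imp_continuous_within)
next
  case (Suc k)
  note c = conv_partial[OF assms(1) test_functionsD(1,3)[OF Suc.prems]]
  show ?case
    using Suc.IH[OF test_functions_partial[OF Suc.prems]] c by simp
qed

lemma conv_support:
  assumes "{x. g x \<noteq> 0} \<subseteq> S" "{x. \<phi> x \<noteq> 0} \<subseteq> cball 0 r"
  shows "{x. conv g \<phi> x \<noteq> 0} \<subseteq> {x. \<exists>y\<in>S. dist y x \<le> r}"
proof
  fix x assume x: "x \<in> {x. conv g \<phi> x \<noteq> 0}"
  have "\<exists>y. g y * \<phi> (x - y) \<noteq> 0"
  proof (rule ccontr)
    assume "\<not> ?thesis"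
    then have "(\<lambda>y. g y * \<phi> (x - y)) = (\<lambda>y. 0)" by auto
    then show False using x by (simp add: conv_def)
  qed
  then obtain y where y: "g y \<noteq> 0" "\<phi> (x - y) \<noteq> 0" by auto
  then have "x - y \<in> cball 0 r" using assms(2) by blast
  then have "dist y x \<le> r" by (simp add: dist_norm norm_minus_commute)
  with y assms(1) show "x \<in> {x. \<exists>y\<in>S. dist y x \<le> r}" by auto
qed

text \<open>The integral of \<phi> (y + t e_i) over y does not depend on t, so its derivative at t =
  0 vanishes; that derivative is the integral of the partial derivative.\<close>

lemma integral_partial_eq_0:
  assumes \<phi>: "C_k (Suc 0) \<phi>" "bounded {x. \<phi> x \<noteq> 0}"
  shows "(LINT x|lebesgue. partial i \<phi> x) = 0"
proof -
  obtain L where L: "0 < L" "\<And>x y. \<bar>\<phi> x - \<phi> y\<bar> \<le> L * norm (x - y)"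
    "\<And>x h. \<bar>\<Sum>i\<in>UNIV. h $ i * partial i \<phi> x\<bar> \<le> L * norm h"
    by (rule C1_bounded_support_Lipschitz[OF \<phi>]) blast
  obtain R where R: "{x. \<phi> x \<noteq> 0} \<subseteq> cball 0 R"
    using \<phi>(2) by (elim bounded_subset_cballE) blast
  have cl: "closure {x. \<phi> x \<noteq> 0} \<subseteq> cball 0 R"
    by (intro closure_minimal R) simp
  let ?I = "indicator (cball 0 (R + 1)) :: real^3 \<Rightarrow> real"
  have n: "norm (t *\<^sub>R axis i (1::real) :: real^3) = \<bar>t\<bar>" for t by simp
  have z: "\<phi> (y + t *\<^sub>R axis i 1) = 0" if "t \<in> ball 0 1" "y \<notin> cball 0 (R + 1)" for t y
  proof -
    have "norm (y + t *\<^sub>R axis i 1) > R" using that norm_diff_ineq[of y "t *\<^sub>R axis i 1"] n[of t] by simp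
    then show ?thesis using R by (auto simp: subset_iff not_le)
  qed
  have pz: "partial i \<phi> y = 0" if "y \<notin> cball 0 (R + 1)" for y
  proof -
    have "y \<notin> cball 0 R" using that by auto
    then show ?thesis using partial_support[of i \<phi>] cl by blast
  qed
  have pc: "continuous_on UNIV (partial i \<phi>)" by (rule C_k_1D[OF \<phi>(1)])
  have tc: "continuous_on UNIV (\<lambda>y. \<phi> (y + t *\<^sub>R axis i 1))" for t
    by (rule continuous_on_compose2[OF C_k_1D(3)[OF \<phi>(1)]]) (auto intro!: continuous_intros)
  have "((\<lambda>t::real. LINT y|lebesgue. \<phi> (y + t *\<^sub>R axis i 1)) has_derivative
      (\<lambda>h. LINT y|lebesgue. h * partial i \<phi> y)) (at 0)"
  proof (rule has_derivative_lebesgue_integral[where d = 1 and g = "\<lambda>y. L * ?I y"])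
    show "integrable lebesgue (\<lambda>y. \<phi> (y + t *\<^sub>R axis i 1))" if "t \<in> ball 0 1" for t
    proof (rule continuous_bounded_support_integrable[OF tc])
      have "{y. \<phi> (y + t *\<^sub>R axis i 1) \<noteq> 0} \<subseteq> cball 0 (R + 1)" using z[OF that] by blast
      then show "bounded {y. \<phi> (y + t *\<^sub>R axis i 1) \<noteq> 0}" by (rule bounded_subset[OF bounded_cball])
    qed
    show "((\<lambda>t. \<phi> (y + t *\<^sub>R axis i 1)) has_derivative (\<lambda>h. h * partial i \<phi> y)) (at 0)" for y
    proof -
      have "((\<lambda>t. y + t *\<^sub>R axis i 1) has_derivative (\<lambda>h::real. h *\<^sub>R axis i 1)) (at 0)"
        by (auto intro!: derivative_eq_intros)
      moreover have "(\<phi> has_derivative (\<lambda>h. \<Sum>j\<in>UNIV. h $ j * partial j \<phi> y)) (at (y + 0 *\<^sub>R axis i 1))"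
        using has_derivative_partial[OF C_k_1D(1)[OF \<phi>(1)]] by simp
      ultimately have "((\<lambda>t. \<phi> (y + t *\<^sub>R axis i 1)) has_derivative
          (\<lambda>h. \<Sum>j\<in>UNIV. (h *\<^sub>R axis i 1) $ j * partial j \<phi> y)) (at 0)"
        by (rule has_derivative_compose)
      moreover have "(\<lambda>h. \<Sum>j\<in>UNIV. (h *\<^sub>R axis i (1::real)) $ j * partial j \<phi> y) = (\<lambda>h. h * partial i \<phi> y)"
        by (simp add: axis_def if_distrib [of "\<lambda>z. z * _"] if_distrib [of "\<lambda>z. _ * z"] cong: if_cong)
      ultimately show ?thesis by simp
    qed
    show "\<bar>\<phi> (y + t *\<^sub>R axis i 1) - \<phi> (y + 0 *\<^sub>R axis i 1)\<bar> \<le> L * ?I y * norm (t - 0)"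
      if "t \<in> ball 0 1" for t y
    proof (cases "y \<in> cball 0 (R + 1)")
      case True
      then show ?thesis using L(2)[of "y + t *\<^sub>R axis i 1" y] by simp
    next
      case False
      then show ?thesis using z[of t y] z[of 0 y] that by simp
    qed
    show "\<bar>h * partial i \<phi> y\<bar> \<le> L * ?I y * norm h" for h y
    proof (cases "y \<in> cball 0 (R + 1)")
      case True
      have "(\<Sum>j\<in>UNIV. (h *\<^sub>R axis i 1) $ j * partial j \<phi> y) = h * partial i \<phi> y"
        by (simp add: axis_def if_distrib [of "\<lambda>z. z * _"] if_distrib [of "\<lambda>z. _ * z"] cong: if_cong)
      then show ?thesis using L(3)[of "h *\<^sub>R axis i 1" y] True by simp
    next
      case False
      then show ?thesis by (simp add: pz)
    qed
    show "integrable lebesgue (\<lambda>y. L * ?I y)" by (intro integrable_mult_right integrable_indicator_cball)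
    show "(\<lambda>y. h * partial i \<phi> y) \<in> borel_measurable lebesgue" for h
      by (intro borel_measurable_times borel_measurable_const continuous_lebesgue_measurable pc)
  qed simp
  moreover have "(LINT y|lebesgue. \<phi> (y + t *\<^sub>R axis i 1)) = (LINT y|lebesgue. \<phi> y)" for t
    using integral_translation[of \<phi> "t *\<^sub>R axis i 1"]
      borel_measurable_continuous_onI[OF C_k_1D(3)[OF \<phi>(1)]] by (simp add: add.commute)
  ultimately have "((\<lambda>t::real. LINT y|lebesgue. \<phi> y) has_derivative
      (\<lambda>h. LINT y|lebesgue. h * partial i \<phi> y)) (at 0)" by simp
  from has_derivative_unique[OF this has_derivative_const]
  have "(\<lambda>h. LINT y|lebesgue. h * partial i \<phi> y) = (\<lambda>h. 0)" .
  from fun_cong[OF this, of 1] show ?thesis by simp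
qed

text \<open>Integration by parts: the product f \<phi> is C^1 with bounded support, so
  \<open>integral_partial_eq_0\<close> applies to it.\<close>

lemma C1_is_weak_partial:
  assumes f: "C_k (Suc 0) f"
  shows "is_weak_partial UNIV i f (partial i f)"
  unfolding is_weak_partial_def lebesgue_on_UNIV_eq
proof
  fix \<phi> assume \<phi>: "\<phi> \<in> test_functions UNIV"
  note t = test_functionsD[OF \<phi>]
  note d = C_k_1D[OF f] C_k_1D[OF t(1)]
  have p: "partial j (\<lambda>x. f x * \<phi> x) = (\<lambda>x. f x * partial j \<phi> x + partial j f x * \<phi> x)" for j
    by (intro ext partial_mult d)
  have b: "bounded {x. f x * \<phi> x \<noteq> 0}" using t(3) by (rule bounded_subset) auto
  have "C_k (Suc 0) (\<lambda>x. f x * \<phi> x)"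
    using d by (auto simp: p intro!: continuous_intros)
  from integral_partial_eq_0[OF this b, of i]
  have "(LINT x|lebesgue. f x * partial i \<phi> x + partial i f x * \<phi> x) = 0" by (simp add: p)
  moreover have "integrable lebesgue (\<lambda>x. f x * partial i \<phi> x)"
    by (intro continuous_bounded_support_integrable continuous_intros d
        bounded_subset[OF test_functionsD(3)[OF test_functions_partial[OF \<phi>, of i]]]) auto
  moreover have "integrable lebesgue (\<lambda>x. partial i f x * \<phi> x)"
    by (intro continuous_bounded_support_integrable continuous_intros d bounded_subset[OF t(3)]) auto
  ultimately show "(LINT x|lebesgue. f x * partial i \<phi> x) = - (LINT x|lebesgue. partial i f x * \<phi> x)"
    by simp
qed

text \<open>Reflecting the argument changes the sign of the derivative, which cancels the sign in
  the definition of the weak derivative.\<close>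

lemma conv_weak_partial:
  assumes "is_weak_partial UNIV i u g" "\<phi> \<in> test_functions UNIV"
  shows "conv u (partial i \<phi>) = conv g \<phi>"
proof
  fix x
  have t: "(\<lambda>y. \<phi> (x - y)) \<in> test_functions UNIV"
  proof -
    obtain r where "{x. \<phi> x \<noteq> 0} \<subseteq> cball 0 r"
      using test_functionsD(3)[OF assms(2)] by (elim bounded_subset_cballE) blast
    then show ?thesis by (rule test_functions_reflect_shift[OF assms(2)]) simp
  qed
  have "partial i (\<lambda>y. \<phi> (x - y)) = (\<lambda>y. - partial i \<phi> (x - y))"
    by (intro ext partial_reflect test_functionsD(4)[OF assms(2)])
  with assms(1) t show "conv u (partial i \<phi>) x = conv g \<phi> x"
    unfolding is_weak_partial_def lebesgue_on_UNIV_eq conv_def by fastforce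
qed

section \<open>Mollifiers\<close>

definition bump :: "nat \<Rightarrow> real \<Rightarrow> scalar_field" where
  "bump m r x = flat_exp m (1 - (x \<bullet> x) / r\<^sup>2)"

lemma bump_support:
  assumes "0 < r"
  shows "{x. bump m r x \<noteq> 0} \<subseteq> cball 0 r"
proof
  fix x assume "x \<in> {x. bump m r x \<noteq> 0}"
  then have "(x \<bullet> x) / r\<^sup>2 < 1" by (auto simp: bump_def flat_exp_def split: if_splits)
  then have "(norm x)\<^sup>2 < r\<^sup>2" using assms by (simp add: dot_square_norm)
  then have "norm x < r" using assms by (simp add: power2_less_imp_less)
  then show "x \<in> cball 0 r" by simp
qed

lemma bump_in_algebra: "bump m r \<in> bump_algebra r"
  using bump_algebra.bump[of m r] by (simp add: bump_def[abs_def])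

lemma bump_test_function:
  assumes "0 < r"
  shows "bump m r \<in> test_functions UNIV"
  unfolding test_functions_UNIV_iff
  using bump_algebra_C_k[OF bump_in_algebra] bounded_subset[OF bounded_cball bump_support[OF assms]] by blast

lemma bump_nonneg: "0 \<le> bump m r x"
  by (simp add: bump_def flat_exp_nonneg)

lemma partial_bump_eq:
  "partial i (bump m r) = (\<lambda>x. (bump (m + 2) r x - of_nat m * bump (m + 1) r x) * (- 2 * x $ i / r\<^sup>2))"
  using partial_bump[of i m r] by (intro ext) (simp only: bump_def[abs_def])

lemma bump_differentiable: "bump m r differentiable (at x)"
  using bump_algebra_differentiable[OF bump_in_algebra] by blast

lemma partial_cmult:
  assumes "f differentiable (at x)"
  shows "partial i (\<lambda>x. c * f x) x = c * partial i f x"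
  using partial_mult[of "\<lambda>x. c" x f i] assms by simp

text \<open>The explicit formula serves twice: it is symmetric in i and j, and its trace is the
  Laplacian in \<open>laplace_bump_eq\<close>.\<close>

lemma partial_partial_bump:
  "partial j (partial i (bump m r)) x =
    (bump (m + 2) r x - of_nat m * bump (m + 1) r x) * (- 2 * (if i = j then 1 else 0) / r\<^sup>2)
    + (bump (m + 4) r x - of_nat (m + 2) * bump (m + 3) r x
        - of_nat m * (bump (m + 3) r x - of_nat (m + 1) * bump (m + 2) r x)) * (4 * (x $ i * x $ j) / r ^ 4)"
proof -
  let ?A = "\<lambda>x. bump (m + 2) r x + (- of_nat m) * bump (m + 1) r x"
  let ?B = "\<lambda>x::real^3. (- 2 / r\<^sup>2) * x $ i"
  have e: "partial i (bump m r) = (\<lambda>x. ?A x * ?B x)"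
    by (auto simp: partial_bump_eq)
  have c: "(\<lambda>x::real^3. x $ i) differentiable (at x)"
    by (rule differentiableI[OF bounded_linear_imp_has_derivative[OF bounded_linear_vec_nth]])
  have dm: "(\<lambda>x. (- of_nat m) * bump (m + 1) r x) differentiable (at x)"
    by (intro differentiable_mult differentiable_const bump_differentiable)
  have dA: "?A differentiable (at x)"
    by (intro differentiable_add dm bump_differentiable)
  have dB: "?B differentiable (at x)"
    by (intro differentiable_mult differentiable_const c)
  have pA: "partial j ?A x = partial j (bump (m + 2) r) x + (- of_nat m) * partial j (bump (m + 1) r) x"
    by (simp only: partial_add[OF bump_differentiable dm] partial_cmult[OF bump_differentiable])
  have pB: "partial j ?B x = (- 2 / r\<^sup>2) * (if i = j then 1 else 0)"
    by (simp only: partial_cmult[OF c] partial_coord) simp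
  have n: "m + 2 + 2 = m + 4" "m + 2 + 1 = m + 3" "m + 1 + 2 = m + 3" "m + 1 + 1 = m + 2" by simp_all
  have "partial j (partial i (bump m r)) x = ?A x * partial j ?B x + partial j ?A x * ?B x"
    unfolding e by (rule partial_mult[OF dA dB])
  also have "\<dots> = ?A x * ((- 2 / r\<^sup>2) * (if i = j then 1 else 0)) +
      ((bump (m + 4) r x - of_nat (m + 2) * bump (m + 3) r x) * (- 2 * x $ j / r\<^sup>2) +
       (- of_nat m) * ((bump (m + 3) r x - of_nat (m + 1) * bump (m + 2) r x) * (- 2 * x $ j / r\<^sup>2))) * ?B x"
    unfolding pA pB partial_bump_eq n ..
  also have "\<dots> = (bump (m + 2) r x - of_nat m * bump (m + 1) r x) * (- 2 * (if i = j then 1 else 0) / r\<^sup>2)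
    + (bump (m + 4) r x - of_nat (m + 2) * bump (m + 3) r x
        - of_nat m * (bump (m + 3) r x - of_nat (m + 1) * bump (m + 2) r x)) * (4 * (x $ i * x $ j) / r ^ 4)"
    by (simp add: algebra_simps divide_inverse power4_eq_xxxx power2_eq_square)
  finally show ?thesis .
qed

definition bump_mass :: real where "bump_mass = (LINT x|lebesgue. bump 2 1 x)"

lemma bump_mass_pos: "0 < bump_mass"
proof -
  \<comment> \<open>On this ball t = 1 - x \<bullet> x lies between 3/4 and 1, so exp (-1/t) / t^2
    is at least exp (-4/3).\<close>
  let ?I = "indicator (cball (0::real^3) (1/2)) :: real^3 \<Rightarrow> real"
  have "exp (- (4/3)) * measure lebesgue (cball (0::real^3) (1/2)) = (LINT x|lebesgue. exp (- (4/3)) * ?I x)"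
    by simp
  also have "\<dots> \<le> bump_mass"
    unfolding bump_mass_def
  proof (rule integral_mono)
    show "integrable lebesgue (\<lambda>x. exp (- (4/3)) * ?I x)"
      by (intro integrable_mult_right integrable_indicator_cball)
    show "integrable lebesgue (bump 2 1)"
      by (rule continuous_bounded_support_integrable) (rule test_functionsD[OF bump_test_function], simp)+
    show "exp (- (4/3)) * ?I x \<le> bump 2 1 x" for x
    proof (cases "x \<in> cball 0 (1/2)")
      case True
      then have "(norm x)\<^sup>2 \<le> (1/2)\<^sup>2" by (intro power_mono) auto
      then have t: "3/4 \<le> 1 - x \<bullet> x" by (simp add: dot_square_norm power2_eq_square)
      let ?t = "1 - x \<bullet> x"
      have "1 / ?t \<le> 4/3" using t by (simp add: field_simps)
      then have "exp (- (4/3)) \<le> exp (- (1 / ?t))" by simp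
      also have "\<dots> \<le> exp (- (1 / ?t)) / ?t\<^sup>2"
      proof -
        have "?t\<^sup>2 \<le> 1" using t by (intro power_le_one) auto
        then show ?thesis using t by (simp add: field_simps)
      qed
      also have "\<dots> = bump 2 1 x" using t by (simp add: bump_def flat_exp_def)
      finally show ?thesis using True by simp
    next
      case False
      then show ?thesis by (simp add: bump_nonneg)
    qed
  qed
  finally have "exp (- (4/3)) * measure lebesgue (cball (0::real^3) (1/2)) \<le> bump_mass" .
  moreover have "0 < exp (- (4/3)) * measure lebesgue (cball (0::real^3) (1/2))"
    by (intro mult_pos_pos exp_gt_zero content_cball_pos) simp
  ultimately show ?thesis by (rule less_le_trans[rotated])
qed

text \<open>The profile is \<open>flat_exp 2\<close> and not the customary
  \<open>flat_exp 0\<close>, whose derivative it is; this is what turns the derivative in r into a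
  Laplacian. The power r^3 is the scaling of volume.\<close>

definition moll :: "real \<Rightarrow> scalar_field" where
  "moll r x = 1 / (r ^ 3 * bump_mass) * bump 2 r x"

lemma moll_test_function:
  assumes "0 < r"
  shows "moll r \<in> test_functions UNIV"
proof -
  have "moll r \<in> bump_algebra r"
    unfolding moll_def[abs_def]
    by (intro bump_algebra.mult bump_algebra.const bump_in_algebra)
  moreover have "{x. moll r x \<noteq> 0} \<subseteq> cball 0 r"
    using bump_support[OF assms, of 2] by (auto simp: moll_def)
  ultimately show ?thesis
    unfolding test_functions_UNIV_iff using bump_algebra_C_k bounded_subset[OF bounded_cball] by blast
qed

lemma moll_support: "0 < r \<Longrightarrow> {x. moll r x \<noteq> 0} \<subseteq> cball 0 r"
  using bump_support[of r 2] by (auto simp: moll_def)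

lemma moll_nonneg: "0 < r \<Longrightarrow> 0 \<le> moll r x"
  using bump_mass_pos by (simp add: moll_def bump_nonneg)

lemmas mollD = test_functionsD[OF moll_test_function]

lemma integral_moll:
  assumes r: "0 < r"
  shows "(LINT x|lebesgue. moll r x) = 1"
proof -
  have "(LINT x|lebesgue. bump 2 r x) = r ^ 3 * (LINT x|lebesgue. bump 2 r (r *\<^sub>R x))"
    by (rule integral_scaling[OF test_functionsD(5)[OF bump_test_function[OF r]] r])
  also have "(\<lambda>x. bump 2 r (r *\<^sub>R x)) = bump 2 1"
    using r by (auto simp: bump_def power2_eq_square)
  finally have "(LINT x|lebesgue. bump 2 r x) = r ^ 3 * bump_mass"
    by (simp add: bump_mass_def)
  then show ?thesis
    using r bump_mass_pos by (simp add: moll_def[abs_def])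
qed

lemma integral_moll_reflect: "0 < r \<Longrightarrow> (LINT y|lebesgue. moll r (x - y)) = 1"
  using integral_reflection[OF mollD(5)] integral_moll by simp

lemma conv_moll_integrable:
  "sq_integrable lebesgue g \<Longrightarrow> 0 < r \<Longrightarrow> integrable lebesgue (\<lambda>y. g y * moll r (x - y))"
  by (rule conv_integrable[OF _ mollD(2) mollD(3)])

text \<open>The mollifier is a nonnegative weight of mass 1 supported in the ball of radius r. The
  bound on g is assumed only almost everywhere so that the lemma applies to capacity competitors,
  which are at least 1 on an open set in this sense.\<close>

lemma conv_moll_ge:
  assumes "sq_integrable lebesgue g" "0 < r" "AE y in lebesgue. y \<in> cball x r \<longrightarrow> a \<le> g y"
  shows "a \<le> conv g (moll r) x"
proof -
  have "a = (LINT y|lebesgue. a * moll r (x - y))"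
    using integral_moll_reflect[OF assms(2)] by simp
  also have "\<dots> \<le> (LINT y|lebesgue. g y * moll r (x - y))"
  proof (rule integral_mono_AE)
    show "integrable lebesgue (\<lambda>y. a * moll r (x - y))"
      by (intro integrable_mult_right continuous_bounded_support_integrable
          continuous_reflect_shift bounded_reflect_shift_support mollD(2,3) assms(2))
    show "integrable lebesgue (\<lambda>y. g y * moll r (x - y))"
      by (rule conv_moll_integrable[OF assms(1,2)])
    show "AE y in lebesgue. a * moll r (x - y) \<le> g y * moll r (x - y)"
      using assms(3)
    proof eventually_elim
      fix y assume y: "y \<in> cball x r \<longrightarrow> a \<le> g y"
      show "a * moll r (x - y) \<le> g y * moll r (x - y)"
      proof (cases "moll r (x - y) = 0")
        case False
        then have "y \<in> cball x r" using reflect_shift_support[OF moll_support[OF assms(2)], of x] by blast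
        then show ?thesis using y moll_nonneg[OF assms(2)] by (intro mult_right_mono) auto
      qed simp
    qed
  qed
  finally show ?thesis by (simp add: conv_def)
qed

lemma conv_minus: "conv (\<lambda>x. - g x) \<phi> x = - conv g \<phi> x"
  by (simp add: conv_def)

lemma conv_diff:
  assumes "sq_integrable lebesgue g" "sq_integrable lebesgue h" "0 < r"
  shows "conv (\<lambda>x. g x - h x) (moll r) x = conv g (moll r) x - conv h (moll r) x"
  unfolding conv_def left_diff_distrib
  by (rule Bochner_Integration.integral_diff) (intro conv_moll_integrable assms)+

lemma conv_moll_le:
  assumes "sq_integrable lebesgue g" "0 < r" "AE y in lebesgue. y \<in> cball x r \<longrightarrow> g y \<le> a"
  shows "conv g (moll r) x \<le> a"
proof -
  have "sq_integrable lebesgue (\<lambda>x. - g x)" using sq_integrable_cmult[OF assms(1), of "-1"] by simp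
  moreover have "AE y in lebesgue. y \<in> cball x r \<longrightarrow> - a \<le> - g y"
    using assms(3) by eventually_elim auto
  ultimately show ?thesis using conv_moll_ge[of "\<lambda>x. - g x" r x "- a"] assms(2) by (simp add: conv_minus)
qed

section \<open>Mollification in L^2\<close>

lemma sq_integrable_borel_version:
  assumes "sq_integrable lebesgue (g :: scalar_field)"
  obtains g' where "g' \<in> borel_measurable borel" "sq_integrable lebesgue g'"
    "AE x in lebesgue. g x = g' x"
proof -
  obtain g' where g': "g' \<in> borel_measurable lborel" "AE x in lborel. g x = g' x"
    using completion_ex_borel_measurable_real[OF sq_integrableD(1)[OF assms]] by blast
  have m: "g' \<in> borel_measurable lebesgue" by (rule measurable_completion[OF g'(1)])
  have ae: "AE x in lebesgue. g x = g' x" by (rule AE_completion[OF g'(2)])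
  show thesis
    by (rule that[OF _ sq_integrable_AE_cong[OF assms m ae] ae]) (use g'(1) in simp)
qed

lemma conv_AE_cong:
  assumes "g \<in> borel_measurable lebesgue" "h \<in> borel_measurable lebesgue" "AE x in lebesgue. g x = h x"
    and "continuous_on UNIV \<phi>"
  shows "conv g \<phi> = conv h \<phi>"
proof
  fix x
  have m: "(\<lambda>y. \<phi> (x - y)) \<in> borel_measurable lebesgue"
    by (rule continuous_lebesgue_measurable[OF continuous_reflect_shift[OF assms(4)]])
  show "conv g \<phi> x = conv h \<phi> x"
    unfolding conv_def
  proof (rule integral_cong_AE)
    show "AE y in lebesgue. g y * \<phi> (x - y) = h y * \<phi> (x - y)"
      using assms(3) by eventually_elim simp
  qed (intro borel_measurable_times assms m)+
qed

text \<open>Cauchy-Schwarz for the probability density \<open>moll r\<close> bounds the square of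
  the mollified g by the mollified g^2, and integrating in x by Tonelli leaves the integral of g^2.
  The Borel version g' enters because the integrals are exchanged in \<open>lborel\<close>.\<close>

lemma conv_moll_L2:
  assumes g: "sq_integrable lebesgue g" and r: "0 < r"
  shows "sq_integrable lebesgue (conv g (moll r))"
    "(LINT x|lebesgue. (conv g (moll r) x)\<^sup>2) \<le> (LINT x|lebesgue. (g x)\<^sup>2)"
proof -
  obtain g' where g': "g' \<in> borel_measurable borel" "sq_integrable lebesgue g'"
    "AE x in lebesgue. g x = g' x"
    by (rule sq_integrable_borel_version[OF g])
  note [measurable] = g'(1) mollD(5)[OF r]
  let ?\<eta> = "moll r"
  have cc: "conv g ?\<eta> = conv g' ?\<eta>"
    by (rule conv_AE_cong[OF sq_integrableD(1)[OF g] sq_integrableD(1)[OF g'(2)] g'(3) mollD(2)[OF r]])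
  have int: "integrable lebesgue (\<lambda>y. (g' y)\<^sup>2 * ?\<eta> (x - y))"
    and pt: "(conv g' ?\<eta> x)\<^sup>2 \<le> (LINT y|lebesgue. (g' y)\<^sup>2 * ?\<eta> (x - y))" for x
  proof -
    \<comment> \<open>The square root of the density goes to both factors, so that Cauchy-Schwarz
      yields the weighted integral of g'^2 times the mass 1.\<close>
    let ?s = "\<lambda>y. sqrt (?\<eta> (x - y))"
    have sc: "continuous_on UNIV ?s"
      by (intro continuous_intros continuous_reflect_shift mollD(2) r)
    have sb: "bounded {y. ?s y \<noteq> 0}"
      using bounded_reflect_shift_support[OF mollD(3)[OF r]] by simp
    have s2: "(?s y)\<^sup>2 = ?\<eta> (x - y)" for y
      using moll_nonneg[OF r] by simp
    obtain B where B: "\<And>y. \<bar>?s y\<bar> \<le> B"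
      using continuous_bounded_support_bounded[OF sc sb] by blast
    have ss: "sq_integrable lebesgue ?s"
      by (rule continuous_bounded_support_sq_integrable[OF sc sb])
    have gs: "sq_integrable lebesgue (\<lambda>y. ?s y * g' y)"
      by (rule sq_integrable_bounded_mult[OF g'(2) sq_integrableD(1)[OF ss] B])
    have e: "(?s y * g' y)\<^sup>2 = (g' y)\<^sup>2 * ?\<eta> (x - y)" for y
      by (simp only: power_mult_distrib s2 mult.commute)
    show "integrable lebesgue (\<lambda>y. (g' y)\<^sup>2 * ?\<eta> (x - y))"
      using sq_integrableD(2)[OF gs] unfolding e .
    have e2: "?s y * g' y * ?s y = g' y * ?\<eta> (x - y)" for y
      using s2[of y] by (simp add: power2_eq_square mult.commute mult.left_commute)
    show "(conv g' ?\<eta> x)\<^sup>2 \<le> (LINT y|lebesgue. (g' y)\<^sup>2 * ?\<eta> (x - y))"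
      using sq_integrable_Cauchy_Schwarz_square[OF gs ss]
      unfolding e e2 s2 conv_def integral_moll_reflect[OF r] by simp
  qed
  have meas: "conv g' ?\<eta> \<in> borel_measurable borel"
  proof -
    have "continuous_on UNIV (conv g' ?\<eta>)"
      using conv_C_k[OF g'(2) moll_test_function[OF r], of 0] by simp
    then show ?thesis by (rule borel_measurable_continuous_onI)
  qed
  have inner: "(\<integral>\<^sup>+x. ennreal ((g' y)\<^sup>2 * ?\<eta> (x - y)) \<partial>lborel) = ennreal ((g' y)\<^sup>2)" for y
  proof -
    have m: "(\<lambda>x. ?\<eta> (x - y)) \<in> borel_measurable borel" by measurable
    have c: "continuous_on UNIV (\<lambda>x. ?\<eta> (x - y))"
      by (rule continuous_on_compose2[OF mollD(2)[OF r]]) (auto intro!: continuous_intros)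
    have "{x. ?\<eta> (x - y) \<noteq> 0} \<subseteq> cball y r"
      using moll_support[OF r] by (auto simp: dist_norm subset_iff norm_minus_commute)
    then have b: "bounded {x. ?\<eta> (x - y) \<noteq> 0}" by (rule bounded_subset[OF bounded_cball])
    have i: "integrable lebesgue (\<lambda>x. ?\<eta> (x - y))"
      by (rule continuous_bounded_support_integrable[OF c b])
    have "(\<integral>\<^sup>+x. ennreal (?\<eta> (x - y)) \<partial>lborel) = (\<integral>\<^sup>+x. ennreal (?\<eta> (x - y)) \<partial>lebesgue)"
      by (rule nn_integral_completion[symmetric])
    also have "\<dots> = ennreal (LINT x|lebesgue. ?\<eta> (x - y))"
      using i moll_nonneg[OF r] by (intro nn_integral_eq_integral) auto
    also have "(LINT x|lebesgue. ?\<eta> (x - y)) = 1"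
      using integral_translation[OF mollD(5)[OF r], of "- y"] integral_moll[OF r] by simp
    finally have "(\<integral>\<^sup>+x. ennreal (?\<eta> (x - y)) \<partial>lborel) = 1" by simp
    moreover have "(\<integral>\<^sup>+x. ennreal ((g' y)\<^sup>2 * ?\<eta> (x - y)) \<partial>lborel) =
       (\<integral>\<^sup>+x. ennreal ((g' y)\<^sup>2) * ennreal (?\<eta> (x - y)) \<partial>lborel)"
      by (intro nn_integral_cong) (simp add: ennreal_mult moll_nonneg[OF r])
    moreover have "\<dots> = ennreal ((g' y)\<^sup>2) * (\<integral>\<^sup>+x. ennreal (?\<eta> (x - y)) \<partial>lborel)"
      by (rule nn_integral_cmult) measurable
    ultimately show ?thesis by simp
  qed
  have "(\<integral>\<^sup>+x. ennreal ((conv g' ?\<eta> x)\<^sup>2) \<partial>lborel)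
      \<le> (\<integral>\<^sup>+x. (\<integral>\<^sup>+y. ennreal ((g' y)\<^sup>2 * ?\<eta> (x - y)) \<partial>lborel) \<partial>lborel)"
  proof (rule nn_integral_mono)
    fix x
    have "ennreal ((conv g' ?\<eta> x)\<^sup>2) \<le> ennreal (LINT y|lebesgue. (g' y)\<^sup>2 * ?\<eta> (x - y))"
      by (rule ennreal_leI[OF pt])
    also have "\<dots> = (\<integral>\<^sup>+y. ennreal ((g' y)\<^sup>2 * ?\<eta> (x - y)) \<partial>lebesgue)"
      using int moll_nonneg[OF r] by (intro nn_integral_eq_integral[symmetric]) auto
    also have "\<dots> = (\<integral>\<^sup>+y. ennreal ((g' y)\<^sup>2 * ?\<eta> (x - y)) \<partial>lborel)"
      by (rule nn_integral_completion)
    finally show "ennreal ((conv g' ?\<eta> x)\<^sup>2) \<le> (\<integral>\<^sup>+y. ennreal ((g' y)\<^sup>2 * ?\<eta> (x - y)) \<partial>lborel)" .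
  qed
  also have "\<dots> = (\<integral>\<^sup>+y. (\<integral>\<^sup>+x. ennreal ((g' y)\<^sup>2 * ?\<eta> (x - y)) \<partial>lborel) \<partial>lborel)"
    by (rule lborel_pair.Fubini'[symmetric]) measurable
  also have "\<dots> = (\<integral>\<^sup>+y. ennreal ((g' y)\<^sup>2) \<partial>lborel)" by (simp only: inner)
  also have "\<dots> = (\<integral>\<^sup>+y. ennreal ((g' y)\<^sup>2) \<partial>lebesgue)" by (rule nn_integral_completion[symmetric])
  also have "\<dots> = ennreal (LINT y|lebesgue. (g' y)\<^sup>2)"
    by (rule nn_integral_eq_integral[OF sq_integrableD(2)[OF g'(2)]]) simp
  finally have le: "(\<integral>\<^sup>+x. ennreal ((conv g' ?\<eta> x)\<^sup>2) \<partial>lebesgue) \<le> ennreal (LINT y|lebesgue. (g' y)\<^sup>2)"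
    by (simp only: nn_integral_completion)
  have ml: "conv g' ?\<eta> \<in> borel_measurable lebesgue"
    by (rule measurable_completion) (use meas in simp)
  have ii: "integrable lebesgue (\<lambda>x. (conv g' ?\<eta> x)\<^sup>2)"
  proof (rule integrableI_bounded)
    show "(\<lambda>x. (conv g' ?\<eta> x)\<^sup>2) \<in> borel_measurable lebesgue" using ml by (rule borel_measurable_power)
    show "(\<integral>\<^sup>+x. ennreal (norm ((conv g' ?\<eta> x)\<^sup>2)) \<partial>lebesgue) < \<infinity>"
      using le_less_trans[OF le ennreal_less_top] by simp
  qed
  then show "sq_integrable lebesgue (conv g ?\<eta>)" using ml by (simp add: sq_integrable_def cc)
  have "ennreal (LINT x|lebesgue. (conv g' ?\<eta> x)\<^sup>2) \<le> ennreal (LINT y|lebesgue. (g' y)\<^sup>2)"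
    using le nn_integral_eq_integral[OF ii] by simp
  then have "(LINT x|lebesgue. (conv g' ?\<eta> x)\<^sup>2) \<le> (LINT y|lebesgue. (g' y)\<^sup>2)"
    by (subst (asm) ennreal_le_iff) auto
  also have "\<dots> = (LINT y|lebesgue. (g y)\<^sup>2)"
  proof (rule integral_cong_AE)
    show "AE x in lebesgue. (g' x)\<^sup>2 = (g x)\<^sup>2" using g'(3) by eventually_elim simp
  qed (use sq_integrableD(1)[OF g] sq_integrableD(1)[OF g'(2)] in \<open>auto intro: borel_measurable_power\<close>)
  finally show "(LINT x|lebesgue. (conv g ?\<eta> x)\<^sup>2) \<le> (LINT x|lebesgue. (g x)\<^sup>2)" by (simp add: cc)
qed

lemma square_le_if_abs_le: "\<bar>a\<bar> \<le> b \<Longrightarrow> a\<^sup>2 \<le> (b::real)\<^sup>2"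
  by (metis abs_ge_zero power2_abs power_mono)

text \<open>Measurability gives continuous functions \<open>g n\<close> tending to f almost
  everywhere, but without an integrable bound. Hence both are clipped to [-k, k] and multiplied by
  the cut-off \<open>ct k\<close>: for large k this changes f little in L^2, and for that fixed k
  the clipped \<open>g n\<close> have a common bound, so dominated convergence applies.\<close>

lemma L2_approx_continuous:
  assumes f: "sq_integrable lebesgue (f :: scalar_field)" and "0 < e"
  obtains h where "continuous_on UNIV h" "bounded {x. h x \<noteq> 0}"
    "(LINT x|lebesgue. (f x - h x)\<^sup>2) < e"
proof -
  have "f measurable_on UNIV"
    using sq_integrableD(1)[OF f] by (subst measurable_on_iff_borel_measurable) (auto simp: lebesgue_on_UNIV_eq)
  then obtain N g where N: "negligible N" and gc: "\<And>n. continuous_on UNIV (g n)"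
    and gl: "\<And>x. x \<notin> N \<Longrightarrow> (\<lambda>n. g n x) \<longlonglongrightarrow> f x"
    unfolding measurable_on_def by auto
  have aeN: "AE x in lebesgue. x \<notin> N"
    using N by (simp add: AE_not_in negligible_iff_null_sets)
  define ct :: "nat \<Rightarrow> real^3 \<Rightarrow> real" where "ct k x = max 0 (min 1 (real k + 1 - norm x))" for k x
  define clip :: "nat \<Rightarrow> real \<Rightarrow> real" where "clip k s = max (- real k) (min (real k) s)" for k s
  have ctc: "continuous_on UNIV (ct k)" for k
    unfolding ct_def by (intro continuous_intros)
  have clipc: "continuous_on UNIV (clip k)" for k
    unfolding clip_def by (intro continuous_intros)
  have ctb: "0 \<le> ct k x" "ct k x \<le> 1" for k x by (auto simp: ct_def)
  have cts: "{x. ct k x \<noteq> 0} \<subseteq> cball 0 (real k + 1)" for k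
    by (auto simp: ct_def max_def min_def split: if_splits)
  have clipb: "\<bar>clip k s\<bar> \<le> real k" "\<bar>clip k s\<bar> \<le> \<bar>s\<bar>" for k s by (auto simp: clip_def)
  define F where "F k x = ct k x * clip k (f x)" for k x
  define H where "H k n x = ct k x * clip k (g n x)" for k n x
  have clipm: "(\<lambda>x. clip k (u x)) \<in> borel_measurable lebesgue"
    if "u \<in> borel_measurable lebesgue" for k and u :: scalar_field
    using measurable_compose[OF that borel_measurable_continuous_onI[OF clipc]] by simp
  have Fm: "F k \<in> borel_measurable lebesgue" for k
    unfolding F_def
    by (intro borel_measurable_times continuous_lebesgue_measurable ctc clipm sq_integrableD(1)[OF f])
  have Fle: "\<bar>f x - F k x\<bar> \<le> 2 * \<bar>f x\<bar>" for k x
  proof -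
    have "\<bar>F k x\<bar> = ct k x * \<bar>clip k (f x)\<bar>" using ctb[of k x] by (simp add: F_def abs_mult)
    also have "\<dots> \<le> 1 * \<bar>f x\<bar>" by (intro mult_mono ctb clipb) auto
    finally show ?thesis by simp
  qed
  have Flim: "(\<lambda>k. F k x) \<longlonglongrightarrow> f x" for x
  proof (rule tendsto_eventually)
    obtain K where K: "norm x + \<bar>f x\<bar> \<le> real K" using real_arch_simple by blast
    show "eventually (\<lambda>k. F k x = f x) sequentially"
      using eventually_ge_at_top[of K]
    proof eventually_elim
      fix k assume "K \<le> k"
      then have "norm x + \<bar>f x\<bar> \<le> real k" using K by linarith
      then have "norm x \<le> real k" "\<bar>f x\<bar> \<le> real k" using norm_ge_zero[of x] by linarith+
      then show "F k x = f x" by (auto simp: F_def ct_def clip_def)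
    qed
  qed
  have "(\<lambda>k. LINT x|lebesgue. (f x - F k x)\<^sup>2) \<longlonglongrightarrow> (LINT x|(lebesgue :: (real^3) measure). 0)"
  proof (rule integral_dominated_convergence[where w = "\<lambda>x. 4 * (f x)\<^sup>2"])
    show "integrable lebesgue (\<lambda>x. 4 * (f x)\<^sup>2)" using sq_integrableD(2)[OF f] by simp
    show "(\<lambda>x. (f x - F k x)\<^sup>2) \<in> borel_measurable lebesgue" for k
      by (intro borel_measurable_power borel_measurable_diff Fm sq_integrableD(1)[OF f])
    show "AE x in lebesgue. (\<lambda>k. (f x - F k x)\<^sup>2) \<longlonglongrightarrow> 0"
    proof (rule AE_I2)
      fix x
      have "(\<lambda>k. (f x - F k x)\<^sup>2) \<longlonglongrightarrow> (f x - f x)\<^sup>2" by (intro tendsto_intros Flim)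
      then show "(\<lambda>k. (f x - F k x)\<^sup>2) \<longlonglongrightarrow> 0" by simp
    qed
    show "AE x in lebesgue. norm ((f x - F k x)\<^sup>2) \<le> 4 * (f x)\<^sup>2" for k
      using square_le_if_abs_le[OF Fle[where k = k]] by (intro AE_I2) (simp add: power_mult_distrib)
  qed simp
  then have "eventually (\<lambda>k. (LINT x|lebesgue. (f x - F k x)\<^sup>2) < e / 4) sequentially"
    using \<open>0 < e\<close> by (intro order_tendstoD(2)) auto
  then obtain k where k: "(LINT x|lebesgue. (f x - F k x)\<^sup>2) < e / 4"
    by (auto simp: eventually_sequentially)
  have Hc: "continuous_on UNIV (H k n)" for n
    unfolding H_def by (intro continuous_intros ctc continuous_on_compose2[OF clipc gc]) auto
  have Hb: "bounded {x. H k n x \<noteq> 0}" for n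
    by (rule bounded_subset[OF bounded_cball, of _ 0 "real k + 1"]) (use cts[of k] in \<open>auto simp: H_def\<close>)
  let ?I = "indicator (cball 0 (real k + 1)) :: real^3 \<Rightarrow> real"
  have FH: "\<bar>F k x - H k n x\<bar> \<le> 2 * real k * ?I x" for x n
  proof (cases "x \<in> cball 0 (real k + 1)")
    case True
    have "\<bar>F k x - H k n x\<bar> = ct k x * \<bar>clip k (f x) - clip k (g n x)\<bar>"
      using ctb[of k x] by (simp add: F_def H_def right_diff_distrib[symmetric] abs_mult)
    also have "\<dots> \<le> 1 * (2 * real k)"
      using clipb(1)[of k "f x"] clipb(1)[of k "g n x"] by (intro mult_mono ctb) auto
    finally show ?thesis using True by simp
  next
    case False
    then have "ct k x = 0" using cts[of k] by blast
    then show ?thesis by (simp add: F_def H_def)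
  qed
  have "(\<lambda>n. LINT x|lebesgue. (F k x - H k n x)\<^sup>2) \<longlonglongrightarrow> (LINT x|(lebesgue :: (real^3) measure). 0)"
  proof (rule integral_dominated_convergence[where w = "\<lambda>x. (2 * real k * ?I x)\<^sup>2"])
    show "integrable lebesgue (\<lambda>x. (2 * real k * ?I x)\<^sup>2)"
      using sq_integrableD(2)[OF sq_integrable_cmult[OF sq_integrable_indicator_cball]] .
    show "(\<lambda>x. (F k x - H k n x)\<^sup>2) \<in> borel_measurable lebesgue" for n
      by (intro borel_measurable_power borel_measurable_diff Fm continuous_lebesgue_measurable Hc)
    show "AE x in lebesgue. (\<lambda>n. (F k x - H k n x)\<^sup>2) \<longlonglongrightarrow> 0"
      using aeN
    proof eventually_elim
      fix x assume "x \<notin> N"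
      then have "(\<lambda>n. clip k (g n x)) \<longlonglongrightarrow> clip k (f x)"
        using continuous_on_tendsto_compose[OF clipc gl] by simp
      then have "(\<lambda>n. (F k x - H k n x)\<^sup>2) \<longlonglongrightarrow> (F k x - ct k x * clip k (f x))\<^sup>2"
        unfolding H_def by (intro tendsto_intros)
      then show "(\<lambda>n. (F k x - H k n x)\<^sup>2) \<longlonglongrightarrow> 0" by (simp add: F_def)
    qed
    show "AE x in lebesgue. norm ((F k x - H k n x)\<^sup>2) \<le> (2 * real k * ?I x)\<^sup>2" for n
      using square_le_if_abs_le[OF FH[where n = n]] by (intro AE_I2) simp
  qed simp
  then have "eventually (\<lambda>n. (LINT x|lebesgue. (F k x - H k n x)\<^sup>2) < e / 4) sequentially"
    using \<open>0 < e\<close> by (intro order_tendstoD(2)) auto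
  then obtain n where n: "(LINT x|lebesgue. (F k x - H k n x)\<^sup>2) < e / 4"
    by (auto simp: eventually_sequentially)
  have Hq: "sq_integrable lebesgue (H k n)"
    by (rule continuous_bounded_support_sq_integrable[OF Hc Hb])
  have Fq: "sq_integrable lebesgue (F k)"
    unfolding F_def
  proof (rule sq_integrable_bounded_mult[where C = 1])
    show "sq_integrable lebesgue (\<lambda>x. clip k (f x))"
      unfolding sq_integrable_def
    proof
      show "(\<lambda>x. clip k (f x)) \<in> borel_measurable lebesgue" by (rule clipm[OF sq_integrableD(1)[OF f]])
      then have "(\<lambda>x. (clip k (f x))\<^sup>2) \<in> borel_measurable lebesgue" by (rule borel_measurable_power)
      then show "integrable lebesgue (\<lambda>x. (clip k (f x))\<^sup>2)"
        by (rule Bochner_Integration.integrable_bound[OF sq_integrableD(2)[OF f]])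
           (use square_le_if_abs_le[OF clipb(2)[where k = k]] in simp)
    qed
  qed (use ctb in \<open>auto intro: continuous_lebesgue_measurable[OF ctc]\<close>)
  have "(LINT x|lebesgue. ((f x - F k x) + (F k x - H k n x))\<^sup>2)
      \<le> 2 * (LINT x|lebesgue. (f x - F k x)\<^sup>2) + 2 * (LINT x|lebesgue. (F k x - H k n x)\<^sup>2)"
    by (intro integral_square_add_le sq_integrable_diff f Fq Hq)
  also have "\<dots> < e" using k n by linarith
  finally have "(LINT x|lebesgue. (f x - H k n x)\<^sup>2) < e" by simp
  with Hc Hb that show thesis by blast
qed

lemma conv_moll_tendsto_continuous:
  assumes h: "continuous_on UNIV h" "sq_integrable lebesgue h"
    and r: "\<And>n. 0 < r n" "r \<longlonglongrightarrow> 0"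
  shows "(\<lambda>n. conv h (moll (r n)) x) \<longlonglongrightarrow> h x"
proof (rule LIMSEQ_I)
  fix e :: real assume "0 < e"
  then have e: "0 < e / 2" by simp
  have "isCont h x" using h(1) by (simp add: continuous_on_eq_continuous_at)
  then obtain d where d: "0 < d" "\<And>y. dist y x < d \<Longrightarrow> dist (h y) (h x) < e / 2"
    using e unfolding continuous_at_eps_delta by blast
  obtain n0 where n0: "\<And>n. n0 \<le> n \<Longrightarrow> r n < d"
    using order_tendstoD(2)[OF r(2) d(1)] by (auto simp: eventually_sequentially)
  have "norm (conv h (moll (r n)) x - h x) < e" if "n0 \<le> n" for n
  proof -
    have l: "h x - e / 2 \<le> h y" "h y \<le> h x + e / 2" if "y \<in> cball x (r n)" for y
    proof -
      have "dist y x < d" using n0[OF \<open>n0 \<le> n\<close>] that by (simp add: dist_commute)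
      then have "\<bar>h y - h x\<bar> < e / 2" using d(2) by (simp add: dist_real_def[symmetric])
      then show "h x - e / 2 \<le> h y" "h y \<le> h x + e / 2" by linarith+
    qed
    have "h x - e / 2 \<le> conv h (moll (r n)) x"
      by (rule conv_moll_ge[OF h(2) r(1)]) (intro AE_I2 impI l)
    moreover have "conv h (moll (r n)) x \<le> h x + e / 2"
      by (rule conv_moll_le[OF h(2) r(1)]) (intro AE_I2 impI l)
    ultimately show ?thesis using \<open>0 < e\<close> by (simp add: abs_if)
  qed
  then show "\<exists>n0. \<forall>n\<ge>n0. norm (conv h (moll (r n)) x - h x) < e" by blast
qed

text \<open>A density argument: for a continuous h of bounded support the convergence is pointwise
  and dominated, and since mollification does not increase the L^2 norm of f - h, replacing f by h
  costs an error that is uniform in the radius.\<close>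

lemma conv_moll_tendsto_L2:
  assumes f: "sq_integrable lebesgue f"
    and r: "\<And>n. 0 < r n" "r \<longlonglongrightarrow> 0"
  shows "(\<lambda>n. LINT x|lebesgue. (conv f (moll (r n)) x - f x)\<^sup>2) \<longlonglongrightarrow> 0"
proof (rule LIMSEQ_I)
  fix e :: real assume "0 < e"
  \<comment> \<open>The final estimate has the coefficients 6 and 4, and 10/16 < 1.\<close>
  then have e: "0 < e / 16" by simp
  obtain h where h: "continuous_on UNIV h" "bounded {x. h x \<noteq> 0}"
    "(LINT x|lebesgue. (f x - h x)\<^sup>2) < e / 16"
    using L2_approx_continuous[OF f e] by blast
  have hq: "sq_integrable lebesgue h"
    by (rule continuous_bounded_support_sq_integrable[OF h(1,2)])
  obtain B where B: "0 < B" "\<And>x. \<bar>h x\<bar> \<le> B"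
    using continuous_bounded_support_bounded[OF h(1,2)] by blast
  have Bl: "- B \<le> h x" for x using B(2)[of x] by linarith
  obtain R where R: "{x. h x \<noteq> 0} \<subseteq> cball 0 R"
    using h(2) by (elim bounded_subset_cballE) blast
  obtain K where K: "\<And>n. r n \<le> K"
  proof -
    obtain K where "\<forall>n. norm (r n) \<le> K"
      using convergent_imp_Bseq[OF convergentI[OF r(2)]] by (rule BseqE)
    then have "r n \<le> K" for n by (auto intro: abs_le_D1)
    then show thesis by (rule that)
  qed
  \<comment> \<open>K bounds all radii, so this ball contains the supports of h and of all its
    mollifications.\<close>
  let ?I = "indicator (cball 0 (R + K)) :: real^3 \<Rightarrow> real"
  have d: "\<bar>conv h (moll (r n)) x - h x\<bar> \<le> 2 * B * ?I x" for n x
  proof (cases "x \<in> cball 0 (R + K)")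
    case True
    have "conv h (moll (r n)) x \<le> B"
      by (rule conv_moll_le[OF hq r(1)]) (intro AE_I2 impI abs_le_D1[OF B(2)])
    moreover have "- B \<le> conv h (moll (r n)) x"
      by (rule conv_moll_ge[OF hq r(1)]) (intro AE_I2 impI Bl)
    ultimately show ?thesis using B(2)[of x] True by simp
  next
    case False
    have "0 < K" using K[of 0] r(1)[of 0] by linarith
    have "x \<notin> cball 0 R" using False \<open>0 < K\<close> by auto
    then have "h x = 0" using R by blast
    moreover have "conv h (moll (r n)) x = 0"
    proof (rule ccontr)
      assume "\<not> ?thesis"
      then obtain y where "y \<in> cball 0 R" "dist y x \<le> r n"
        using conv_support[OF R moll_support[OF r(1)[of n]]] by blast
      then show False using False K[of n] dist_triangle[of 0 x y] by simp
    qed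
    ultimately show ?thesis using B(1) by simp
  qed
  have cq: "sq_integrable lebesgue (conv u (moll (r n)))" if "sq_integrable lebesgue u" for u n
    by (rule conv_moll_L2[OF that r(1)])
  have "(\<lambda>n. LINT x|lebesgue. (conv h (moll (r n)) x - h x)\<^sup>2) \<longlonglongrightarrow> (LINT x|(lebesgue :: (real^3) measure). 0)"
  proof (rule integral_dominated_convergence[where w = "\<lambda>x. (2 * B * ?I x)\<^sup>2"])
    show "integrable lebesgue (\<lambda>x. (2 * B * ?I x)\<^sup>2)"
      using sq_integrableD(2)[OF sq_integrable_cmult[OF sq_integrable_indicator_cball]] .
    show "(\<lambda>x. (conv h (moll (r n)) x - h x)\<^sup>2) \<in> borel_measurable lebesgue" for n
      by (intro borel_measurable_power borel_measurable_diff sq_integrableD(1)[OF cq] sq_integrableD(1) hq)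
    show "AE x in lebesgue. (\<lambda>n. (conv h (moll (r n)) x - h x)\<^sup>2) \<longlonglongrightarrow> 0"
    proof (rule AE_I2)
      fix x
      have "(\<lambda>n. (conv h (moll (r n)) x - h x)\<^sup>2) \<longlonglongrightarrow> (h x - h x)\<^sup>2"
        by (intro tendsto_intros conv_moll_tendsto_continuous[OF h(1) hq r])
      then show "(\<lambda>n. (conv h (moll (r n)) x - h x)\<^sup>2) \<longlonglongrightarrow> 0" by simp
    qed
    show "AE x in lebesgue. norm ((conv h (moll (r n)) x - h x)\<^sup>2) \<le> (2 * B * ?I x)\<^sup>2" for n
      using square_le_if_abs_le[OF d[where n = n]] by (intro AE_I2) simp
  qed simp
  then have "eventually (\<lambda>n. (LINT x|lebesgue. (conv h (moll (r n)) x - h x)\<^sup>2) < e / 16) sequentially"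
    using e by (intro order_tendstoD(2)) auto
  then obtain n0 where n0: "\<And>n. n0 \<le> n \<Longrightarrow> (LINT x|lebesgue. (conv h (moll (r n)) x - h x)\<^sup>2) < e / 16"
    by (auto simp: eventually_sequentially)
  have "norm ((LINT x|lebesgue. (conv f (moll (r n)) x - f x)\<^sup>2) - 0) < e" if "n0 \<le> n" for n
  proof -
    let ?c = "\<lambda>u x. conv u (moll (r n)) x"
    let ?d = "\<lambda>x. f x - h x"
    have dq: "sq_integrable lebesgue ?d" by (rule sq_integrable_diff[OF f hq])
    have hd: "sq_integrable lebesgue (\<lambda>x. ?c h x - h x)" by (rule sq_integrable_diff[OF cq[OF hq] hq])
    have eq: "?c f x - f x = (?c ?d x + (?c h x - h x)) + (-1) * ?d x" for x
      using conv_diff[OF f hq r(1)] by simp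
    have "(LINT x|lebesgue. (?c f x - f x)\<^sup>2) \<le>
        2 * (LINT x|lebesgue. (?c ?d x + (?c h x - h x))\<^sup>2) + 2 * (LINT x|lebesgue. ((-1) * ?d x)\<^sup>2)"
      unfolding eq
      by (intro integral_square_add_le sq_integrable_add sq_integrable_cmult cq dq hd)
    moreover have "(LINT x|lebesgue. (?c ?d x + (?c h x - h x))\<^sup>2) \<le>
        2 * (LINT x|lebesgue. (?c ?d x)\<^sup>2) + 2 * (LINT x|lebesgue. (?c h x - h x)\<^sup>2)"
      by (intro integral_square_add_le cq dq hd)
    moreover have "(LINT x|lebesgue. (?c ?d x)\<^sup>2) \<le> (LINT x|lebesgue. (?d x)\<^sup>2)"
      by (rule conv_moll_L2(2)[OF dq r(1)])
    moreover have "(LINT x|lebesgue. ((-1) * ?d x)\<^sup>2) = (LINT x|lebesgue. (?d x)\<^sup>2)"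
      by (simp add: power2_commute)
    ultimately have "(LINT x|lebesgue. (?c f x - f x)\<^sup>2) \<le>
        6 * (LINT x|lebesgue. (?d x)\<^sup>2) + 4 * (LINT x|lebesgue. (?c h x - h x)\<^sup>2)"
      by linarith
    also have "\<dots> < 6 * (e / 16) + 4 * (e / 16)" using h(3) n0[OF that] by linarith
    finally have "(LINT x|lebesgue. (?c f x - f x)\<^sup>2) < e" using \<open>0 < e\<close> by linarith
    then show ?thesis by simp
  qed
  then show "\<exists>n0. \<forall>n\<ge>n0. norm ((LINT x|lebesgue. (conv f (moll (r n)) x - f x)\<^sup>2) - 0) < e" by blast
qed

lemma conv_moll_AE_subseq:
  assumes f: "sq_integrable lebesgue f"
    and r: "\<And>n. 0 < r n" "r \<longlonglongrightarrow> 0"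
  obtains s :: "nat \<Rightarrow> nat" where "strict_mono s" "AE x in lebesgue. (\<lambda>n. conv f (moll (r (s n))) x) \<longlonglongrightarrow> f x"
proof -
  have "\<exists>s. strict_mono s \<and> (AE x in lebesgue. (\<lambda>n. (conv f (moll (r (s n))) x - f x)\<^sup>2) \<longlonglongrightarrow> 0)"
  proof (rule tendsto_L1_AE_subseq)
    show "integrable lebesgue (\<lambda>x. (conv f (moll (r n)) x - f x)\<^sup>2)" for n
      by (rule sq_integrableD(2)[OF sq_integrable_diff[OF conv_moll_L2(1)[OF f r(1)] f]])
    show "(\<lambda>n. LINT x|lebesgue. norm ((conv f (moll (r n)) x - f x)\<^sup>2)) \<longlonglongrightarrow> 0"
      using conv_moll_tendsto_L2[OF f r] by simp
  qed
  then obtain s where s: "strict_mono s"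
    "AE x in lebesgue. (\<lambda>n. (conv f (moll (r (s n))) x - f x)\<^sup>2) \<longlonglongrightarrow> 0" by blast
  have "AE x in lebesgue. (\<lambda>n. conv f (moll (r (s n))) x) \<longlonglongrightarrow> f x"
    using s(2)
  proof eventually_elim
    fix x assume "(\<lambda>n. (conv f (moll (r (s n))) x - f x)\<^sup>2) \<longlonglongrightarrow> 0"
    from tendsto_real_sqrt[OF this] have "(\<lambda>n. \<bar>conv f (moll (r (s n))) x - f x\<bar>) \<longlonglongrightarrow> 0" by simp
    then have "(\<lambda>n. conv f (moll (r (s n))) x - f x) \<longlonglongrightarrow> 0" by (rule tendsto_rabs_zero_cancel)
    then show "(\<lambda>n. conv f (moll (r (s n))) x) \<longlonglongrightarrow> f x" by (simp add: LIM_zero_iff)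
  qed
  with s(1) that show thesis by blast
qed

section \<open>Restriction to a domain and testing with smooth functions\<close>

lemma sq_integrable_lebesgue_on:
  assumes "\<Omega> \<in> sets lebesgue"
  shows "sq_integrable (lebesgue_on \<Omega>) g \<longleftrightarrow> sq_integrable lebesgue (\<lambda>x. indicator \<Omega> x * g x)"
proof -
  have "(\<lambda>x. indicator \<Omega> x * (g x)\<^sup>2) = (\<lambda>x. (indicator \<Omega> x * g x)\<^sup>2)"
    by (auto simp: indicator_def)
  then show ?thesis
    using assms
    by (simp add: sq_integrable_def borel_measurable_restrict_space_iff integrable_restrict_space)
qed

lemma integral_lebesgue_on:
  fixes f :: scalar_field
  assumes "\<Omega> \<in> sets lebesgue"
  shows "(LINT x|lebesgue_on \<Omega>. f x) = (LINT x|lebesgue. indicator \<Omega> x * f x)"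
  using assms by (simp add: integral_restrict_space)

lemma open_lebesgue: "open (\<Omega> :: (real^3) set) \<Longrightarrow> \<Omega> \<in> sets lebesgue"
  by simp

text \<open>For x in \<Omega> and small r the function moll r (x - y) of y is itself a test function
  on \<Omega>, so the mollifications at x of the extension by zero are eventually 0; along a
  subsequence they also converge to g almost everywhere.\<close>

lemma fundamental_lemma:
  assumes "open \<Omega>" and g: "sq_integrable (lebesgue_on \<Omega>) g"
    and orth: "\<And>\<phi>. \<phi> \<in> test_functions \<Omega> \<Longrightarrow> (LINT x|lebesgue_on \<Omega>. g x * \<phi> x) = 0"
  shows "AE x in lebesgue_on \<Omega>. g x = 0"
proof -
  have \<Omega>: "\<Omega> \<in> sets lebesgue" by (rule open_lebesgue) fact
  define G where "G x = indicator \<Omega> x * g x" for x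
  have G: "sq_integrable lebesgue G"
    unfolding G_def using g sq_integrable_lebesgue_on[OF \<Omega>] by blast
  define r where "r n = 1 / real (Suc n)" for n
  have r: "\<And>n. 0 < r n" "r \<longlonglongrightarrow> 0"
    using LIMSEQ_Suc[OF lim_1_over_n] by (auto simp: r_def[abs_def])
  obtain s where s: "strict_mono s" "AE x in lebesgue. (\<lambda>n. conv G (moll (r (s n))) x) \<longlonglongrightarrow> G x"
    using conv_moll_AE_subseq[OF G r] by blast
  have "AE x in lebesgue. x \<in> \<Omega> \<longrightarrow> g x = 0"
    using s(2)
  proof (eventually_elim, intro impI)
    fix x assume lim: "(\<lambda>n. conv G (moll (r (s n))) x) \<longlonglongrightarrow> G x" and x: "x \<in> \<Omega>"
    obtain d where d: "0 < d" "cball x d \<subseteq> \<Omega>" using \<open>open \<Omega>\<close> x open_contains_cball by blast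
    have "eventually (\<lambda>n. r (s n) < d) sequentially"
      using order_tendstoD(2)[OF LIMSEQ_subseq_LIMSEQ[OF r(2) s(1)] d(1)] by (simp add: o_def)
    then have "eventually (\<lambda>n. conv G (moll (r (s n))) x = 0) sequentially"
    proof eventually_elim
      fix n assume n: "r (s n) < d"
      have t: "(\<lambda>y. moll (r (s n)) (x - y)) \<in> test_functions \<Omega>"
        by (rule test_functions_reflect_shift[OF moll_test_function[OF r(1)] moll_support[OF r(1)]])
           (use d n in auto)
      from orth[OF t] show "conv G (moll (r (s n))) x = 0"
        by (simp add: integral_lebesgue_on[OF \<Omega>] conv_def G_def mult.assoc)
    qed
    then have "(\<lambda>n. conv G (moll (r (s n))) x) \<longlonglongrightarrow> 0" by (rule tendsto_eventually)
    with lim have "G x = 0" by (rule LIMSEQ_unique)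
    then show "g x = 0" using x by (simp add: G_def)
  qed
  then show ?thesis using \<Omega> by (simp add: AE_restrict_space_iff)
qed

lemma partial_moll_commute:
  "partial j (partial i (moll r)) = partial i (partial j (moll r))"
proof -
  let ?c = "1 / (r ^ 3 * bump_mass)"
  have d: "partial k (bump 2 r) differentiable (at x)" for k x
    using bump_algebra_differentiable[OF bump_in_algebra] bump_algebra_differentiable by blast
  have e: "partial k (moll r) = (\<lambda>x. ?c * partial k (bump 2 r) x)" for k
    unfolding moll_def[abs_def] by (intro ext partial_cmult bump_differentiable)
  have "partial k (partial l (moll r)) = (\<lambda>x. ?c * partial k (partial l (bump 2 r)) x)" for k l
    unfolding e by (intro ext partial_cmult d)
  moreover have "partial j (partial i (bump 2 r)) = partial i (partial j (bump 2 r))"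
    by (intro ext) (simp only: partial_partial_bump mult.commute eq_commute[of i j])
  ultimately show ?thesis by simp
qed

text \<open>For mollifiers the symmetry is read off the explicit formula. For general \<phi> both
  derivatives are moved to the mollifier under the convolution, exchanged there and moved back; then
  the radius tends to 0.\<close>

lemma partial_commute:
  assumes \<phi>: "\<phi> \<in> test_functions UNIV"
  shows "partial i (partial j \<phi>) = partial j (partial i \<phi>)"
proof
  fix x
  define r where "r n = 1 / real (Suc n)" for n
  have r: "\<And>n. 0 < r n" "r \<longlonglongrightarrow> 0"
    using LIMSEQ_Suc[OF lim_1_over_n] by (auto simp: r_def[abs_def])
  have t: "partial k (partial l \<phi>) \<in> test_functions UNIV" for k l
    by (intro test_functions_partial \<phi>)
  have lim: "(\<lambda>n. conv (partial k (partial l \<phi>)) (moll (r n)) x) \<longlonglongrightarrow> partial k (partial l \<phi>) x" for k l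
    by (intro conv_moll_tendsto_continuous r continuous_bounded_support_sq_integrable test_functionsD[OF t])
  have step: "conv (partial k \<psi>) \<eta> = conv \<psi> (partial k \<eta>)"
    if "\<psi> \<in> test_functions UNIV" "\<eta> \<in> test_functions UNIV" for k \<psi> \<eta>
    using conv_weak_partial[OF C1_is_weak_partial[OF test_functionsD(1)[OF that(1)]] that(2)] by simp
  have "conv (partial k (partial l \<phi>)) (moll (r n)) = conv \<phi> (partial l (partial k (moll (r n))))" for k l n
    by (simp add: step test_functions_partial \<phi> moll_test_function r(1))
  then have "conv (partial i (partial j \<phi>)) (moll (r n)) = conv (partial j (partial i \<phi>)) (moll (r n))" for n
    by (simp add: partial_moll_commute[of j i])
  with lim[of i j] have "(\<lambda>n. conv (partial j (partial i \<phi>)) (moll (r n)) x) \<longlonglongrightarrow> partial i (partial j \<phi>) x"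
    by simp
  from LIMSEQ_unique[OF this lim[of j i]]
  show "partial i (partial j \<phi>) x = partial j (partial i \<phi>) x" .
qed

text \<open>The functions built in \<open>truncated_orthogonality\<close> are only C^1, because the
  truncations are. Their mollifications are test functions on \<Omega> once the radius is small
  against the distance of the support from the complement of \<Omega>, and the gradients converge in
  L^2.\<close>

lemma C1_test_orthogonality:
  assumes "open \<Omega>" and c: "\<And>i. sq_integrable (lebesgue_on \<Omega>) (c i)"
    and orth: "\<And>\<psi>. \<psi> \<in> test_functions \<Omega> \<Longrightarrow> (\<Sum>i\<in>UNIV. LINT x|lebesgue_on \<Omega>. partial i \<psi> x * c i x) = 0"
    and \<phi>: "C_k (Suc 0) \<phi>" "bounded {x. \<phi> x \<noteq> 0}" "closure {x. \<phi> x \<noteq> 0} \<subseteq> \<Omega>"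
  shows "(\<Sum>i\<in>UNIV. LINT x|lebesgue_on \<Omega>. partial i \<phi> x * c i x) = 0"
proof -
  have \<Omega>: "\<Omega> \<in> sets lebesgue" by (rule open_lebesgue) fact
  define r where "r n = 1 / real (Suc n)" for n
  have r: "\<And>n. 0 < r n" "r \<longlonglongrightarrow> 0"
    using LIMSEQ_Suc[OF lim_1_over_n] by (auto simp: r_def[abs_def])
  let ?K = "closure {x. \<phi> x \<noteq> 0}"
  have K: "compact ?K" using \<phi>(2) by (simp add: compact_closure)
  obtain d where d: "0 < d" "(\<Union>x\<in>?K. cball x d) \<subseteq> \<Omega>"
    using compact_subset_open_imp_cball_epsilon_subset[OF K \<open>open \<Omega>\<close> \<phi>(3)] by blast
  have \<phi>q: "sq_integrable lebesgue \<phi>"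
    by (rule continuous_bounded_support_sq_integrable[OF C_k_1D(3)[OF \<phi>(1)] \<phi>(2)])
  have pq: "sq_integrable lebesgue (partial i \<phi>)" for i
    by (rule continuous_bounded_support_sq_integrable[OF C_k_1D(2)[OF \<phi>(1)]
          bounded_subset[OF bounded_closure[OF \<phi>(2)] partial_support]])
  let ?\<psi> = "\<lambda>n. conv \<phi> (moll (r n))"
  have pe: "partial i (?\<psi> n) = conv (partial i \<phi>) (moll (r n))" for i n
    using conv_partial(1)[OF \<phi>q test_functionsD(1,3)[OF moll_test_function[OF r(1)]]]
      conv_weak_partial[OF C1_is_weak_partial[OF \<phi>(1)] moll_test_function[OF r(1)]] by simp
  have t: "?\<psi> n \<in> test_functions \<Omega>" if n: "r n < d" for n
  proof -
    let ?S = "{x + y |x y. x \<in> ?K \<and> y \<in> cball 0 (r n)}"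
    have S: "compact ?S" by (rule compact_sums[OF K compact_cball])
    have "{x. ?\<psi> n x \<noteq> 0} \<subseteq> ?S"
    proof
      fix x assume "x \<in> {x. ?\<psi> n x \<noteq> 0}"
      then obtain y where "y \<in> ?K" "dist y x \<le> r n"
        using conv_support[OF closure_subset moll_support[OF r(1)[of n]]] by blast
      then have "x = y + (x - y) \<and> y \<in> ?K \<and> x - y \<in> cball 0 (r n)"
        by (simp add: dist_norm norm_minus_commute)
      then show "x \<in> ?S" by blast
    qed
    then have cl: "closure {x. ?\<psi> n x \<noteq> 0} \<subseteq> ?S"
      by (intro closure_minimal compact_imp_closed S)
    have "?S \<subseteq> \<Omega>"
    proof
      fix z assume "z \<in> ?S"
      then obtain x y where z: "z = x + y" "x \<in> ?K" "y \<in> cball 0 (r n)" by blast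
      then have "z \<in> cball x d" using n by (simp add: dist_norm)
      then show "z \<in> \<Omega>" using d(2) z(2) by blast
    qed
    with cl have "closure {x. ?\<psi> n x \<noteq> 0} \<subseteq> \<Omega>" by blast
    moreover have "compact (closure {x. ?\<psi> n x \<noteq> 0})"
      using bounded_subset[OF compact_imp_bounded[OF S] order_trans[OF closure_subset cl]]
      by (simp add: compact_closure)
    ultimately show ?thesis
      using conv_C_k[OF \<phi>q moll_test_function[OF r(1)]] by (simp add: test_functions_def)
  qed
  have lim: "(\<lambda>n. LINT x|lebesgue_on \<Omega>. partial i (?\<psi> n) x * c i x) \<longlonglongrightarrow> (LINT x|lebesgue_on \<Omega>. partial i \<phi> x * c i x)" for i
  proof -
    \<comment> \<open>The factor 1 brings the integral into the form of
      \<open>tendsto_integral_bounded_L2\<close>.\<close>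
    have "(\<lambda>n. LINT x|lebesgue. 1 * conv (partial i \<phi>) (moll (r n)) x * (indicator \<Omega> x * c i x))
      \<longlonglongrightarrow> (LINT x|lebesgue. 1 * partial i \<phi> x * (indicator \<Omega> x * c i x))"
    proof (rule tendsto_integral_bounded_L2[where C = 1])
      show "sq_integrable lebesgue (\<lambda>x. indicator \<Omega> x * c i x)"
        using c sq_integrable_lebesgue_on[OF \<Omega>] by blast
    qed (auto intro: conv_moll_L2 pq r conv_moll_tendsto_L2)
    then show ?thesis by (simp add: integral_lebesgue_on[OF \<Omega>] pe mult.left_commute)
  qed
  have "(\<lambda>n. \<Sum>i\<in>UNIV. LINT x|lebesgue_on \<Omega>. partial i (?\<psi> n) x * c i x)
    \<longlonglongrightarrow> (\<Sum>i\<in>UNIV. LINT x|lebesgue_on \<Omega>. partial i \<phi> x * c i x)"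
    by (rule tendsto_sum) (rule lim)
  moreover have "eventually (\<lambda>n. (\<Sum>i\<in>UNIV. LINT x|lebesgue_on \<Omega>. partial i (?\<psi> n) x * c i x) = 0) sequentially"
    using order_tendstoD(2)[OF r(2) d(1)] by eventually_elim (rule orth[OF t])
  then have "(\<lambda>n. \<Sum>i\<in>UNIV. LINT x|lebesgue_on \<Omega>. partial i (?\<psi> n) x * c i x) \<longlonglongrightarrow> 0"
    by (rule tendsto_eventually)
  ultimately show ?thesis by (rule LIMSEQ_unique)
qed

section \<open>Continuity of \<open>H\<^sup>2\<close> functions\<close>

lemma flat_exp_bounded: obtains B where "\<And>t. t \<le> 1 \<Longrightarrow> flat_exp m t \<le> B"
proof -
  have "isCont (flat_exp m) t" for t
    using flat_exp_has_derivative by (rule DERIV_isCont)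
  then have "continuous_on {0..1} (flat_exp m)"
    by (intro continuous_at_imp_continuous_on) auto
  then have "bounded (flat_exp m ` {0..1})"
    by (intro compact_imp_bounded compact_continuous_image) auto
  then obtain B where B: "0 < B" "\<And>t. t \<in> {0..1} \<Longrightarrow> \<bar>flat_exp m t\<bar> \<le> B"
    by (auto simp: bounded_pos)
  have "flat_exp m t \<le> B" if "t \<le> 1" for t
  proof (cases "0 \<le> t")
    case True
    then show ?thesis using B(2)[of t] that by (simp add: abs_le_iff)
  next
    case False
    then show ?thesis using B(1) by (simp add: flat_exp_def)
  qed
  then show thesis by (rule that)
qed

lemma bump_bounded: obtains B where "\<And>r x. bump m r x \<le> B"
proof -
  obtain B where "\<And>t. t \<le> 1 \<Longrightarrow> flat_exp m t \<le> B" using flat_exp_bounded by blast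
  then have "bump m r x \<le> B" for r x by (simp add: bump_def)
  then show thesis by (rule that)
qed

definition laplace_bump :: "real \<Rightarrow> scalar_field" where
  "laplace_bump r x = (\<Sum>i\<in>UNIV. partial i (partial i (bump 0 r)) x)"

lemma laplace_bump_eq:
  "laplace_bump r x = - 6 / r\<^sup>2 * bump 2 r x + 4 * (x \<bullet> x) / r ^ 4 * (bump 4 r x - 2 * bump 3 r x)"
proof -
  have "laplace_bump r x =
     (\<Sum>i\<in>(UNIV :: 3 set). bump 2 r x * (- 2 / r\<^sup>2) + (bump 4 r x - 2 * bump 3 r x) * 4 / r ^ 4 * (x $ i * x $ i))"
    unfolding laplace_bump_def by (intro sum.cong refl) (simp add: partial_partial_bump[of _ _ 0, unfolded add_0] algebra_simps)
  also have "\<dots> = 3 * (bump 2 r x * (- 2 / r\<^sup>2)) + (bump 4 r x - 2 * bump 3 r x) * 4 / r ^ 4 * (x \<bullet> x)"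
    by (simp only: sum.distrib sum_distrib_left[symmetric] inner_vec_def inner_real_def sum_constant) simp
  finally show ?thesis by simp
qed

text \<open>This is the identity \<open>\<partial>\<^sub>r \<eta>\<^sub>r = \<Delta> \<kappa>\<^sub>r\<close> with \<open>\<kappa>\<^sub>r\<close> a multiple of \<open>bump 0 r\<close>: it holds because the profile
  \<open>flat_exp 2\<close> of the mollifier is the derivative of \<open>flat_exp 0\<close>.\<close>

lemma moll_has_derivative:
  assumes r: "0 < r"
  shows "((\<lambda>r. moll r x) has_real_derivative (1 / (2 * r\<^sup>2 * bump_mass) * laplace_bump r x)) (at r)"
proof -
  let ?t = "1 - (x \<bullet> x) / r\<^sup>2" and ?M = bump_mass
  have M: "?M \<noteq> 0" using bump_mass_pos by simp
  have t: "((\<lambda>r. 1 - (x \<bullet> x) / r\<^sup>2) has_real_derivative 2 * (x \<bullet> x) / r ^ 3) (at r)"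
    using r by (auto intro!: derivative_eq_intros simp: power2_eq_square power3_eq_cube ac_simps)
  have b: "((\<lambda>r. bump 2 r x) has_real_derivative (bump 4 r x - 2 * bump 3 r x) * (2 * (x \<bullet> x) / r ^ 3)) (at r)"
    using DERIV_chain2[OF flat_exp_has_derivative[of 2] t] by (simp add: bump_def)
  have p: "((\<lambda>r. 1 / (r ^ 3 * ?M)) has_real_derivative - 3 / (r ^ 4 * ?M)) (at r)"
    using r M by (auto intro!: derivative_eq_intros simp: field_simps power2_eq_square power4_eq_xxxx power3_eq_cube)
  have "((\<lambda>r. moll r x) has_real_derivative
      (- 3 / (r ^ 4 * ?M) * bump 2 r x + (bump 4 r x - 2 * bump 3 r x) * (2 * (x \<bullet> x) / r ^ 3) * (1 / (r ^ 3 * ?M)))) (at r)"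
    unfolding moll_def using DERIV_mult[OF p b] by (simp add: mult.commute)
  moreover have "- 3 / (r ^ 4 * ?M) * bump 2 r x + (bump 4 r x - 2 * bump 3 r x) * (2 * (x \<bullet> x) / r ^ 3) * (1 / (r ^ 3 * ?M))
      = 1 / (2 * r\<^sup>2 * ?M) * laplace_bump r x"
  proof -
    define a b where "a = bump 2 r x" and "b = bump 4 r x - 2 * bump 3 r x"
    have "- 3 / (r ^ 4 * ?M) * a + b * (2 * (x \<bullet> x) / r ^ 3) * (1 / (r ^ 3 * ?M))
      = 1 / (2 * r\<^sup>2 * ?M) * (- 6 / r\<^sup>2 * a + 4 * (x \<bullet> x) / r ^ 4 * b)"
      using r M by (simp add: field_simps power2_eq_square power4_eq_xxxx power3_eq_cube)
    then show ?thesis by (simp add: laplace_bump_eq a_def b_def)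
  qed
  ultimately show ?thesis by simp
qed

text \<open>Off the ball of radius r all bumps vanish; on it x \<bullet> x \<le> r^2, so both terms
  of \<open>laplace_bump_eq\<close> are of order 1 / r^2.\<close>

lemma laplace_bump_bounded:
  obtains K where "0 < K" "\<And>r x. 0 < r \<Longrightarrow> \<bar>laplace_bump r x\<bar> \<le> K / r\<^sup>2"
proof -
  obtain B2 where B2: "\<And>r x. bump 2 r x \<le> B2" using bump_bounded by blast
  obtain B3 where B3: "\<And>r x. bump 3 r x \<le> B3" using bump_bounded by blast
  obtain B4 where B4: "\<And>r x. bump 4 r x \<le> B4" using bump_bounded by blast
  have B0: "0 \<le> B2" "0 \<le> B3" "0 \<le> B4"
    using order_trans[OF bump_nonneg B2] order_trans[OF bump_nonneg B3] order_trans[OF bump_nonneg B4] by auto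
  let ?K = "6 * B2 + 4 * (B4 + 2 * B3) + 1"
  have "\<bar>laplace_bump r x\<bar> \<le> ?K / r\<^sup>2" if r: "0 < r" for r x
  proof (cases "norm x \<le> r")
    case True
    have q: "(x \<bullet> x) / r ^ 4 \<le> 1 / r\<^sup>2"
      using power_mono[OF True, of 2] r by (simp add: dot_square_norm field_simps power2_eq_square power4_eq_xxxx)
    let ?b = "bump 4 r x - 2 * bump 3 r x"
    have b: "\<bar>?b\<bar> \<le> B4 + 2 * B3"
      using B4[of r x] B3[of r x] bump_nonneg[of 4 r x] bump_nonneg[of 3 r x] by linarith
    have "\<bar>4 * (x \<bullet> x) / r ^ 4 * ?b\<bar> = 4 * ((x \<bullet> x) / r ^ 4 * \<bar>?b\<bar>)"
      using r by (simp add: abs_mult)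
    also have "\<dots> \<le> 4 * (1 / r\<^sup>2 * (B4 + 2 * B3))"
      by (intro mult_left_mono mult_mono q b) auto
    finally have 1: "\<bar>4 * (x \<bullet> x) / r ^ 4 * ?b\<bar> \<le> 4 * (1 / r\<^sup>2 * (B4 + 2 * B3))" .
    have "\<bar>- 6 / r\<^sup>2 * bump 2 r x\<bar> = 6 / r\<^sup>2 * bump 2 r x"
      using bump_nonneg[of 2 r x] by (simp add: abs_mult)
    also have "\<dots> \<le> 6 / r\<^sup>2 * B2" by (intro mult_left_mono B2) simp
    finally have 2: "\<bar>- 6 / r\<^sup>2 * bump 2 r x\<bar> \<le> 6 / r\<^sup>2 * B2" .
    have "\<bar>laplace_bump r x\<bar> \<le> 6 / r\<^sup>2 * B2 + 4 * (1 / r\<^sup>2 * (B4 + 2 * B3))"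
      unfolding laplace_bump_eq using 1 2 by linarith
    also have "\<dots> \<le> ?K / r\<^sup>2" using r by (simp add: field_simps)
    finally show ?thesis .
  next
    case False
    then have "bump m r x = 0" for m using bump_support[OF r, of m] by fastforce
    then show ?thesis using B0 r by (simp add: laplace_bump_eq)
  qed
  moreover have "0 < ?K"
    by (rule add_nonneg_pos) (use B0 in auto)
  ultimately show thesis using that by blast
qed

lemma conv_moll_has_derivative_radius:
  assumes u: "sq_integrable lebesgue u" and r0: "0 < r0"
  shows "((\<lambda>r. conv u (moll r) x) has_real_derivative
    (1 / (2 * r0\<^sup>2 * bump_mass) * (\<Sum>i\<in>UNIV. conv u (partial i (partial i (bump 0 r0))) x))) (at r0)"
proof -
  let ?D = "\<lambda>r z. 1 / (2 * r\<^sup>2 * bump_mass) * laplace_bump r z"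
  obtain K where K: "0 < K" "\<And>r x. 0 < r \<Longrightarrow> \<bar>laplace_bump r x\<bar> \<le> K / r\<^sup>2"
    by (rule laplace_bump_bounded) blast
  \<comment> \<open>This is the bound on \<open>?D\<close> at radius r0/2, the worst case among the
    radii in \<open>ball r0 (r0/2)\<close>.\<close>
  define L where "L = 1 / (2 * (r0/2)\<^sup>2 * bump_mass) * (K / (r0/2)\<^sup>2)"
  have L0: "0 \<le> L" using K(1) bump_mass_pos by (simp add: L_def)
  have Db: "\<bar>?D r z\<bar> \<le> L" if "r \<in> ball r0 (r0/2)" for r z
  proof -
    have r: "r0 / 2 \<le> r" "0 < r" using that r0 by (auto simp: dist_real_def abs_if split: if_splits)
    have rr: "(r0/2)\<^sup>2 \<le> r\<^sup>2" using r r0 by (intro power_mono) auto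
    have "\<bar>?D r z\<bar> = 1 / (2 * r\<^sup>2 * bump_mass) * \<bar>laplace_bump r z\<bar>"
      using bump_mass_pos by (simp add: abs_mult)
    also have "\<dots> \<le> 1 / (2 * (r0/2)\<^sup>2 * bump_mass) * (K / (r0/2)\<^sup>2)"
    proof (intro mult_mono)
      show "1 / (2 * r\<^sup>2 * bump_mass) \<le> 1 / (2 * (r0/2)\<^sup>2 * bump_mass)"
        using rr r0 r(2) bump_mass_pos by (intro divide_left_mono mult_right_mono mult_pos_pos zero_less_power) auto
      have "K / r\<^sup>2 \<le> K / (r0/2)\<^sup>2" using rr r0 r(2) K(1) by (intro divide_left_mono mult_pos_pos zero_less_power) auto
      then show "\<bar>laplace_bump r z\<bar> \<le> K / (r0/2)\<^sup>2" using K(2)[OF r(2), of z] by linarith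
    qed (use bump_mass_pos in auto)
    finally show ?thesis by (simp add: L_def)
  qed
  have lip: "\<bar>moll r z - moll r0 z\<bar> \<le> L * norm (r - r0)" if r: "r \<in> ball r0 (r0/2)" for r z
  proof -
    have "norm (moll r z - moll r0 z) \<le> L * norm (r - r0)"
    proof (rule field_differentiable_bound[of "ball r0 (r0/2)" "\<lambda>r. moll r z" "\<lambda>r. ?D r z"])
      fix s assume s: "s \<in> ball r0 (r0/2)"
      then have "0 < s" using r0 by (auto simp: dist_real_def abs_if split: if_splits)
      then show "((\<lambda>r. moll r z) has_real_derivative ?D s z) (at s within ball r0 (r0/2))"
        by (rule has_field_derivative_at_within[OF moll_has_derivative])
      show "norm (?D s z) \<le> L" using Db[OF s] by simp
    qed (use r r0 in auto)
    then show ?thesis by simp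
  qed
  \<comment> \<open>The radii in \<open>ball r0 (r0/2)\<close> are below 2 * r0, so this ball
    contains the support of every integrand.\<close>
  let ?I = "indicator (cball x (2 * r0)) :: real^3 \<Rightarrow> real"
  have pos: "0 < r \<and> r < 2 * r0" if "r \<in> ball r0 (r0/2)" for r
    using that r0 by (auto simp: dist_real_def abs_if split: if_splits)
  have z: "bump m r (x - y) = 0" if "r \<in> ball r0 (r0/2)" "y \<notin> cball x (2 * r0)" for m r y
  proof -
    have "y \<notin> cball x r" using that pos[OF that(1)] by auto
    then show ?thesis using reflect_shift_support[OF bump_support[of r m], of x] pos[OF that(1)] by blast
  qed
  have self: "r0 \<in> ball r0 (r0/2)" using r0 by simp
  have lc: "continuous_on UNIV (laplace_bump r)" if "0 < r" for r
    unfolding laplace_bump_def[abs_def]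
    by (intro continuous_on_sum test_functionsD(2)[OF test_functions_partial[OF test_functions_partial[OF bump_test_function]]] that)
  have der: "((\<lambda>r. LINT y|lebesgue. u y * moll r (x - y)) has_derivative
      (\<lambda>h. LINT y|lebesgue. u y * (?D r0 (x - y) * h))) (at r0)"
  proof (rule has_derivative_lebesgue_integral[where d = "r0/2" and g = "\<lambda>y. L * \<bar>u y * ?I y\<bar>"])
    show "integrable lebesgue (\<lambda>y. u y * moll r (x - y))" if "r \<in> ball r0 (r0/2)" for r
      using conv_moll_integrable[OF u] pos[OF that] by blast
    show "((\<lambda>r. u y * moll r (x - y)) has_derivative (\<lambda>h. u y * (?D r0 (x - y) * h))) (at r0)" for y
      using moll_has_derivative[OF r0, of "x - y"] unfolding has_field_derivative_def
      by (rule has_derivative_mult_right)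
    show "\<bar>u y * moll r (x - y) - u y * moll r0 (x - y)\<bar> \<le> L * \<bar>u y * ?I y\<bar> * norm (r - r0)"
      if r: "r \<in> ball r0 (r0/2)" for r y
    proof (cases "y \<in> cball x (2 * r0)")
      case True
      have "\<bar>u y\<bar> * \<bar>moll r (x - y) - moll r0 (x - y)\<bar> \<le> \<bar>u y\<bar> * (L * norm (r - r0))"
        by (rule mult_left_mono[OF lip[OF r]]) simp
      then show ?thesis using True by (simp add: right_diff_distrib[symmetric] abs_mult ac_simps)
    next
      case False
      then show ?thesis using z[OF r False] z[OF self False] L0 by (simp add: moll_def)
    qed
    show "\<bar>u y * (?D r0 (x - y) * h)\<bar> \<le> L * \<bar>u y * ?I y\<bar> * norm h" for y h
    proof (cases "y \<in> cball x (2 * r0)")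
      case True
      have "\<bar>u y\<bar> * (\<bar>?D r0 (x - y)\<bar> * \<bar>h\<bar>) \<le> \<bar>u y\<bar> * (L * \<bar>h\<bar>)"
        by (intro mult_left_mono mult_right_mono Db self) auto
      then show ?thesis using True unfolding abs_mult by (simp add: mult_ac)
    next
      case False
      then show ?thesis using z[OF self False] L0 by (simp add: laplace_bump_eq)
    qed
    show "integrable lebesgue (\<lambda>y. L * \<bar>u y * ?I y\<bar>)"
      using sq_integrable_mult[OF u sq_integrable_indicator_cball] by simp
    show "(\<lambda>y. u y * (?D r0 (x - y) * h)) \<in> borel_measurable lebesgue" for h
      by (intro borel_measurable_times borel_measurable_const sq_integrableD(1)[OF u]
          continuous_lebesgue_measurable continuous_reflect_shift lc r0)
  qed (use r0 in simp)
  have eq: "(LINT y|lebesgue. u y * (?D r0 (x - y) * h)) =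
      1 / (2 * r0\<^sup>2 * bump_mass) * (\<Sum>i\<in>UNIV. conv u (partial i (partial i (bump 0 r0))) x) * h" for h
  proof -
    have t: "partial i (partial i (bump 0 r0)) \<in> test_functions UNIV" for i
      by (intro test_functions_partial bump_test_function r0)
    have "(LINT y|lebesgue. u y * (?D r0 (x - y) * h)) =
      (LINT y|lebesgue. (1 / (2 * r0\<^sup>2 * bump_mass) * h) * (\<Sum>i\<in>UNIV. u y * partial i (partial i (bump 0 r0)) (x - y)))"
      by (intro Bochner_Integration.integral_cong refl)
         (simp add: laplace_bump_def sum_distrib_left sum_divide_distrib mult_ac)
    also have "\<dots> = (1 / (2 * r0\<^sup>2 * bump_mass) * h) *
        (LINT y|lebesgue. (\<Sum>i\<in>UNIV. u y * partial i (partial i (bump 0 r0)) (x - y)))"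
      by (rule integral_mult_right_zero)
    also have "(LINT y|lebesgue. (\<Sum>i\<in>UNIV. u y * partial i (partial i (bump 0 r0)) (x - y))) =
      (\<Sum>i\<in>UNIV. conv u (partial i (partial i (bump 0 r0))) x)"
      unfolding conv_def
      by (rule Bochner_Integration.integral_sum) (intro conv_integrable u test_functionsD[OF t])
    finally show ?thesis by (simp only: mult_ac)
  qed
  from der[unfolded eq] show ?thesis
    unfolding has_field_derivative_def conv_def .
qed

text \<open>Cauchy-Schwarz; by scaling, the L^2 norm of \<open>bump 0 r\<close> is r powr (3/2)
  times that of \<open>bump 0 1\<close>.\<close>

lemma conv_bump_bound:
  assumes v: "sq_integrable lebesgue v" and r: "0 < r"
  shows "\<bar>conv v (bump 0 r) x\<bar> \<le>
    sqrt (LINT y|lebesgue. (v y)\<^sup>2) * (sqrt (r ^ 3) * sqrt (LINT y|lebesgue. (bump 0 1 y)\<^sup>2))"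
proof -
  note t = test_functionsD[OF bump_test_function[OF r, of 0]]
  have m: "(\<lambda>y. (bump 0 r y)\<^sup>2) \<in> borel_measurable borel"
    using t(5) by (rule borel_measurable_power)
  have "(LINT y|lebesgue. (bump 0 r (x - y))\<^sup>2) = r ^ 3 * (LINT y|lebesgue. (bump 0 r (r *\<^sub>R y))\<^sup>2)"
    using integral_reflection[OF m, of x] integral_scaling[OF m r] by simp
  also have "(\<lambda>y. (bump 0 r (r *\<^sub>R y))\<^sup>2) = (\<lambda>y. (bump 0 1 y)\<^sup>2)"
    using r by (auto simp: bump_def power2_eq_square)
  finally have "(LINT y|lebesgue. (bump 0 r (x - y))\<^sup>2) = r ^ 3 * (LINT y|lebesgue. (bump 0 1 y)\<^sup>2)" .
  then show ?thesis
    using sq_integrable_Cauchy_Schwarz[OF v sq_integrable_reflect_shift[OF t(2,3)], of x]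
    by (simp add: conv_def real_sqrt_mult)
qed

text \<open>The Laplacian in \<open>conv_moll_has_derivative_radius\<close> is moved to u, where it
  produces the pure second derivatives \<open>G i\<close>. The norm r powr (3/2) of the bump against
  the factor 1 / r^2 leaves a radial derivative of order 1 / sqrt r, which has the primitive 2 *
  sqrt r.\<close>

lemma conv_moll_radius_diff:
  assumes u: "sq_integrable lebesgue u" and g: "\<And>i. sq_integrable lebesgue (g i)" "\<And>i. sq_integrable lebesgue (G i)"
    and wp: "\<And>i. is_weak_partial UNIV i u (g i)" "\<And>i. is_weak_partial UNIV i (g i) (G i)"
  obtains C where "0 \<le> C" "\<And>r s x. 0 < s \<Longrightarrow> s \<le> r \<Longrightarrow>
    \<bar>conv u (moll r) x - conv u (moll s) x\<bar> \<le> C * (sqrt r - sqrt s)"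
proof -
  let ?N = "sqrt (LINT y|(lebesgue :: (real^3) measure). (bump 0 1 y)\<^sup>2)"
  define C where "C = 1 / (2 * bump_mass) * (\<Sum>i\<in>UNIV. sqrt (LINT y|lebesgue. (G i y)\<^sup>2) * ?N)"
  have C0: "0 \<le> C" using bump_mass_pos unfolding C_def by (intro mult_nonneg_nonneg sum_nonneg) auto
  define D where "D r x = 1 / (2 * r\<^sup>2 * bump_mass) * (\<Sum>i\<in>UNIV. conv u (partial i (partial i (bump 0 r))) x)" for r x
  have D: "\<bar>D r x\<bar> \<le> C / sqrt r" if r: "0 < r" for r x
  proof -
    have "conv u (partial i (partial i (bump 0 r))) = conv (G i) (bump 0 r)" for i
      using conv_weak_partial[OF wp(1) test_functions_partial[OF bump_test_function[OF r]]]
        conv_weak_partial[OF wp(2) bump_test_function[OF r]] by simp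
    then have "\<bar>D r x\<bar> = 1 / (2 * r\<^sup>2 * bump_mass) * \<bar>\<Sum>i\<in>UNIV. conv (G i) (bump 0 r) x\<bar>"
      using bump_mass_pos by (simp add: D_def abs_mult)
    also have "\<dots> \<le> 1 / (2 * r\<^sup>2 * bump_mass) * (\<Sum>i\<in>UNIV. sqrt (LINT y|lebesgue. (G i y)\<^sup>2) * (sqrt (r ^ 3) * ?N))"
      using bump_mass_pos
      by (intro mult_left_mono order_trans[OF sum_abs] sum_mono conv_bump_bound g r) auto
    also have "(\<Sum>i\<in>UNIV. sqrt (LINT y|lebesgue. (G i y)\<^sup>2) * (sqrt (r ^ 3) * ?N)) =
        sqrt (r ^ 3) * (\<Sum>i\<in>UNIV. sqrt (LINT y|lebesgue. (G i y)\<^sup>2) * ?N)"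
      by (simp only: sum_distrib_left mult.left_commute)
    also have "1 / (2 * r\<^sup>2 * bump_mass) * \<dots> = C * (sqrt (r ^ 3) / r\<^sup>2)" by (simp add: C_def mult_ac)
    also have "sqrt (r ^ 3) / r\<^sup>2 = 1 / sqrt r"
    proof -
      have "sqrt (r ^ 3) = r * sqrt r" using r by (simp add: power3_eq_cube real_sqrt_mult)
      moreover have "r = sqrt r * sqrt r" using r by simp
      ultimately show ?thesis using r
        by (simp add: power2_eq_square divide_eq_eq eq_divide_eq)
    qed
    finally show ?thesis by simp
  qed
  have der: "((\<lambda>r. conv u (moll r) x) has_real_derivative D r x) (at r)" if "0 < r" for r x
    unfolding D_def by (rule conv_moll_has_derivative_radius[OF u that])
  \<comment> \<open>The sign c covers both halves of the absolute value. Subtracting 2 * C * sqrt t,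
    a primitive of the bound C / sqrt t, leaves a nonincreasing function of the radius t.\<close>
  have le: "c * conv u (moll r) x - c * conv u (moll s) x \<le> 2 * C * (sqrt r - sqrt s)"
    if s: "0 < s" "s \<le> r" and c: "c = 1 \<or> c = -1" for r s x and c :: real
  proof -
    have "c * conv u (moll r) x - 2 * C * sqrt r \<le> c * conv u (moll s) x - 2 * C * sqrt s"
    proof (rule DERIV_nonpos_imp_nonincreasing[OF s(2)])
      fix t assume "s \<le> t" "t \<le> r"
      then have t: "0 < t" using s by simp
      have d1: "((\<lambda>t. c * conv u (moll t) x - 2 * C * sqrt t) has_real_derivative
          c * D t x - 2 * C * (inverse (sqrt t) / 2)) (at t)"
        using t by (intro DERIV_diff DERIV_cmult der DERIV_real_sqrt)
      have d2: "c * D t x - 2 * C * (inverse (sqrt t) / 2) \<le> 0"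
      proof -
        have "c * D t x \<le> \<bar>D t x\<bar>" using c by auto
        also have "\<dots> \<le> C / sqrt t" by (rule D[OF t])
        also have "\<dots> = 2 * C * (inverse (sqrt t) / 2)" by (simp add: inverse_eq_divide)
        finally show ?thesis by simp
      qed
      show "\<exists>y. ((\<lambda>t. c * conv u (moll t) x - 2 * C * sqrt t) has_real_derivative y) (at t) \<and> y \<le> 0"
        by (rule exI, rule conjI[OF d1 d2])
    qed
    then show ?thesis by (simp add: right_diff_distrib)
  qed
  have "\<bar>conv u (moll r) x - conv u (moll s) x\<bar> \<le> (2 * C) * (sqrt r - sqrt s)" if "0 < s" "s \<le> r" for r s x
    using le[OF that, of 1 x] le[OF that, of "-1" x] by simp
  then show thesis using that[of "2 * C"] C0 by simp
qed

text \<open>The radius estimate makes the mollifications uniformly Cauchy, so their limit V is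
  continuous. The distance of the mollifications from V is part of the conclusion because it
  controls them on the boundary of a domain, where an identity almost everywhere may say
  nothing.\<close>

lemma sobolev_embedding:
  assumes "u \<in> sobolev 2 UNIV"
  obtains V C where "continuous_on UNIV V" "AE x in lebesgue. u x = V x"
    "\<And>r x. 0 < r \<Longrightarrow> \<bar>conv u (moll r) x - V x\<bar> \<le> C * sqrt r"
proof -
  have two: "2 = Suc (Suc 0)" by simp
  have u: "sq_integrable lebesgue u" using assms by (simp add: two L2_UNIV_iff)
  have "\<forall>i. \<exists>g. \<exists>G. sq_integrable lebesgue g \<and> sq_integrable lebesgue G \<and>
      is_weak_partial UNIV i u g \<and> is_weak_partial UNIV i g G"
  proof
    fix i
    obtain g where g: "g \<in> sobolev (Suc 0) UNIV" "is_weak_partial UNIV i u g"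
      using assms unfolding two sobolev.simps(2)[of "Suc 0"] by blast
    moreover from g obtain G where "G \<in> L2 UNIV" "is_weak_partial UNIV i g G" by auto
    ultimately show "\<exists>g. \<exists>G. sq_integrable lebesgue g \<and> sq_integrable lebesgue G \<and>
        is_weak_partial UNIV i u g \<and> is_weak_partial UNIV i g G"
      by (auto simp: L2_UNIV_iff)
  qed
  then obtain g G where g: "\<And>i. sq_integrable lebesgue (g i)" "\<And>i. sq_integrable lebesgue (G i)"
    "\<And>i. is_weak_partial UNIV i u (g i)" "\<And>i. is_weak_partial UNIV i (g i) (G i)"
    unfolding choice_iff by blast
  obtain C where C: "0 \<le> C" "\<And>r s x. 0 < s \<Longrightarrow> s \<le> r \<Longrightarrow>
    \<bar>conv u (moll r) x - conv u (moll s) x\<bar> \<le> C * (sqrt r - sqrt s)"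
    using conv_moll_radius_diff[OF u g] by blast
  define r where "r n = 1 / real (Suc n)" for n
  have r: "\<And>n. 0 < r n" "r \<longlonglongrightarrow> 0"
    using LIMSEQ_Suc[OF lim_1_over_n] by (auto simp: r_def[abs_def])
  have rmono: "r m \<le> r n" if "n \<le> m" for m n using that by (simp add: r_def frac_le)
  have C': "\<bar>conv u (moll t) x - conv u (moll s) x\<bar> \<le> C * sqrt t" if "0 < s" "s \<le> t" for s t x
  proof -
    have "C * (sqrt t - sqrt s) \<le> C * sqrt t" using C(1) that by (intro mult_left_mono) auto
    with C(2)[OF that, of x] show ?thesis by linarith
  qed
  have sr: "(\<lambda>n. C * sqrt (r n)) \<longlonglongrightarrow> 0"
    using tendsto_mult_right_zero[OF tendsto_real_sqrt[OF r(2), unfolded real_sqrt_zero]] .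
  have "Cauchy (\<lambda>n. conv u (moll (r n)) x)" for x
  proof (rule metric_CauchyI)
    fix e :: real assume "0 < e"
    then obtain N where N: "C * sqrt (r N) < e / 2"
      using order_tendstoD(2)[OF sr, of "e/2"] by (auto simp: eventually_sequentially)
    have d: "\<bar>conv u (moll (r N)) x - conv u (moll (r n)) x\<bar> < e / 2" if "N \<le> n" for n
      using C'[OF r(1)[of n] rmono[OF that], of x] N by linarith
    have "dist (conv u (moll (r m)) x) (conv u (moll (r n)) x) < e" if "N \<le> m" "N \<le> n" for m n
      using d[OF that(1)] d[OF that(2)] unfolding dist_real_def by linarith
    then show "\<exists>M. \<forall>m\<ge>M. \<forall>n\<ge>M. dist (conv u (moll (r m)) x) (conv u (moll (r n)) x) < e" by blast
  qed
  then have "\<exists>l. (\<lambda>n. conv u (moll (r n)) x) \<longlonglongrightarrow> l" for x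
    using real_Cauchy_convergent convergent_def by blast
  then obtain V where V: "\<And>x. (\<lambda>n. conv u (moll (r n)) x) \<longlonglongrightarrow> V x" by metis
  have VC: "\<bar>conv u (moll t) x - V x\<bar> \<le> C * sqrt t" if t: "0 < t" for t x
  proof -
    obtain N where N: "r N < t" using order_tendstoD(2)[OF r(2) t] by (auto simp: eventually_sequentially)
    show ?thesis
    proof (rule Lim_bounded)
      show "(\<lambda>n. \<bar>conv u (moll t) x - conv u (moll (r n)) x\<bar>) \<longlonglongrightarrow> \<bar>conv u (moll t) x - V x\<bar>"
        by (intro tendsto_intros V)
      show "\<forall>n\<ge>N. \<bar>conv u (moll t) x - conv u (moll (r n)) x\<bar> \<le> C * sqrt t"
      proof (intro allI impI)
        fix n assume "N \<le> n"
        then have "r n \<le> t" using rmono[of N n] N by simp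
        then show "\<bar>conv u (moll t) x - conv u (moll (r n)) x\<bar> \<le> C * sqrt t" by (rule C'[OF r(1)])
      qed
    qed
  qed
  have "uniform_limit UNIV (\<lambda>n x. conv u (moll (r n)) x) V sequentially"
    unfolding uniform_limit_iff
  proof (intro allI impI)
    fix e :: real assume "0 < e"
    from order_tendstoD(2)[OF sr this]
    show "\<forall>\<^sub>F n in sequentially. \<forall>x\<in>UNIV. dist (conv u (moll (r n)) x) (V x) < e"
    proof eventually_elim
      fix n assume "C * sqrt (r n) < e"
      then show "\<forall>x\<in>UNIV. dist (conv u (moll (r n)) x) (V x) < e"
        unfolding dist_real_def using le_less_trans[OF VC[OF r(1)]] by blast
    qed
  qed
  then have Vc: "continuous_on UNIV V"
  proof (rule uniform_limit_theorem[rotated])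
    have "continuous_on UNIV (conv u (moll (r n)))" for n
      using conv_C_k[OF u moll_test_function[OF r(1)], of 0] by simp
    then show "\<forall>\<^sub>F n in sequentially. continuous_on UNIV (\<lambda>x. conv u (moll (r n)) x)" by simp
  qed simp
  obtain s where s: "strict_mono s" "AE x in lebesgue. (\<lambda>n. conv u (moll (r (s n))) x) \<longlonglongrightarrow> u x"
    using conv_moll_AE_subseq[OF u r] by blast
  have "AE x in lebesgue. u x = V x"
    using s(2)
  proof eventually_elim
    fix x assume "(\<lambda>n. conv u (moll (r (s n))) x) \<longlonglongrightarrow> u x"
    moreover have "(\<lambda>n. conv u (moll (r (s n))) x) \<longlonglongrightarrow> V x"
      using LIMSEQ_subseq_LIMSEQ[OF V[of x] s(1)] by (simp add: o_def)
    ultimately show "u x = V x" by (rule LIMSEQ_unique)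
  qed
  with Vc VC that show thesis by blast
qed

section \<open>Chain rules\<close>

text \<open>The rule is classical for the mollifications \<open>U n\<close> of u. In the limit, F (U
  n) is dominated through its bound K because \<phi> has bounded support, and the product of F' (U
  n) with the mollified g is covered by \<open>tendsto_integral_bounded_L2\<close>.\<close>

lemma weak_chain_rule:
  assumes u: "sq_integrable lebesgue u" and g: "sq_integrable lebesgue g" and wp: "is_weak_partial UNIV i u g"
    and F: "\<And>s. (F has_real_derivative F' s) (at s)" and F'c: "continuous_on UNIV F'"
    and Fb: "\<And>s. \<bar>F s\<bar> \<le> K" and F'b: "\<And>s. \<bar>F' s\<bar> \<le> K'"
  shows "is_weak_partial UNIV i (\<lambda>x. F (u x)) (\<lambda>x. F' (u x) * g x)"
  unfolding is_weak_partial_def lebesgue_on_UNIV_eq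
proof
  fix \<phi> assume \<phi>: "\<phi> \<in> test_functions UNIV"
  note p\<phi> = test_functions_partial[OF \<phi>, of i]
  have Fc: "continuous_on UNIV F"
    by (intro continuous_at_imp_continuous_on ballI DERIV_isCont[OF F])
  define r where "r n = 1 / real (Suc n)" for n
  have r: "\<And>n. 0 < r n" "r \<longlonglongrightarrow> 0"
    using LIMSEQ_Suc[OF lim_1_over_n] by (auto simp: r_def[abs_def])
  obtain s where s: "strict_mono s" "AE x in lebesgue. (\<lambda>n. conv u (moll (r (s n))) x) \<longlonglongrightarrow> u x"
    using conv_moll_AE_subseq[OF u r] by blast
  have r': "0 < r (s n)" "(\<lambda>n. r (s n)) \<longlonglongrightarrow> 0" for n
    using r LIMSEQ_subseq_LIMSEQ[OF r(2) s(1)] by (simp_all add: o_def)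
  define U where "U n = conv u (moll (r (s n)))" for n
  have U1: "C_k (Suc 0) (U n)" for n
    unfolding U_def by (rule conv_C_k[OF u moll_test_function[OF r'(1)]])
  have Up: "partial j (U n) = conv u (partial j (moll (r (s n))))" for n j
    unfolding U_def
    by (rule conv_partial[OF u test_functionsD(1,3)[OF moll_test_function[OF r'(1)]]])
  have Upi: "partial i (U n) = conv g (moll (r (s n)))" for n
    unfolding Up by (rule conv_weak_partial[OF wp moll_test_function[OF r'(1)]])
  have d: "((\<lambda>x. F (U n x)) has_derivative (\<lambda>h. (\<Sum>j\<in>UNIV. h $ j * partial j (U n) x) * F' (U n x))) (at x)" for n x
    using DERIV_compose_FDERIV[OF F has_derivative_partial[OF C_k_1D(1)[OF U1]]] .
  have pF: "partial j (\<lambda>x. F (U n x)) = (\<lambda>x. partial j (U n) x * F' (U n x))" for j n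
    by (rule ext, subst partial_eq[OF d])
       (simp add: axis_def if_distrib [of "\<lambda>z. z * _"] cong: if_cong)
  have F1: "C_k (Suc 0) (\<lambda>x. F (U n x))" for n
  proof -
    have "continuous_on UNIV (\<lambda>x. partial j (U n) x * F' (U n x))" for j
      by (intro continuous_on_mult C_k_1D(2)[OF U1] continuous_on_compose2[OF F'c C_k_1D(3)[OF U1]]) auto
    moreover have "(\<lambda>x. F (U n x)) differentiable (at x)" for x by (rule differentiableI[OF d])
    ultimately show ?thesis by (simp add: pF)
  qed
  have eq: "(LINT x|lebesgue. F (U n x) * partial i \<phi> x) =
      - (LINT x|lebesgue. F' (U n x) * conv g (moll (r (s n))) x * \<phi> x)" for n
    using C1_is_weak_partial[OF F1, of i n] \<phi>
    unfolding is_weak_partial_def lebesgue_on_UNIV_eq pF Upi by (simp add: mult_ac)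
  have Um: "U n \<in> borel_measurable lebesgue" for n
    by (rule continuous_lebesgue_measurable[OF C_k_1D(3)[OF U1]])
  have cm: "(\<lambda>x. H (v x)) \<in> borel_measurable lebesgue"
    if "continuous_on UNIV H" "v \<in> borel_measurable lebesgue" for H :: "real \<Rightarrow> real" and v :: scalar_field
    using measurable_compose[OF that(2) borel_measurable_continuous_onI[OF that(1)]] by simp
  have Ulim: "AE x in lebesgue. (\<lambda>n. U n x) \<longlonglongrightarrow> u x" using s(2) by (simp add: U_def)
  have Hlim: "AE x in lebesgue. (\<lambda>n. H (U n x)) \<longlonglongrightarrow> H (u x)" if "continuous_on UNIV H" for H :: "real \<Rightarrow> real"
    using Ulim by eventually_elim (rule continuous_on_tendsto_compose[OF that], auto)
  have l1: "(\<lambda>n. LINT x|lebesgue. F (U n x) * partial i \<phi> x) \<longlonglongrightarrow> (LINT x|lebesgue. F (u x) * partial i \<phi> x)"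
  proof (rule integral_dominated_convergence[where w = "\<lambda>x. K * \<bar>partial i \<phi> x\<bar>"])
    show "(\<lambda>x. F (u x) * partial i \<phi> x) \<in> borel_measurable lebesgue"
      by (rule borel_measurable_times[OF cm[OF Fc sq_integrableD(1)[OF u]]
          continuous_lebesgue_measurable[OF test_functionsD(2)[OF p\<phi>]]])
    show "(\<lambda>x. F (U n x) * partial i \<phi> x) \<in> borel_measurable lebesgue" for n
      by (rule borel_measurable_times[OF cm[OF Fc Um]
          continuous_lebesgue_measurable[OF test_functionsD(2)[OF p\<phi>]]])
    show "integrable lebesgue (\<lambda>x. K * \<bar>partial i \<phi> x\<bar>)"
      by (intro integrable_mult_right integrable_abs continuous_bounded_support_integrable test_functionsD[OF p\<phi>])
    show "AE x in lebesgue. (\<lambda>n. F (U n x) * partial i \<phi> x) \<longlonglongrightarrow> F (u x) * partial i \<phi> x"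
      using Hlim[OF Fc] by eventually_elim (rule tendsto_mult_right)
    show "AE x in lebesgue. norm (F (U n x) * partial i \<phi> x) \<le> K * \<bar>partial i \<phi> x\<bar>" for n
      using Fb by (intro AE_I2) (simp add: abs_mult mult_right_mono)
  qed
  have l2: "(\<lambda>n. LINT x|lebesgue. F' (U n x) * conv g (moll (r (s n))) x * \<phi> x) \<longlonglongrightarrow> (LINT x|lebesgue. F' (u x) * g x * \<phi> x)"
  proof (rule tendsto_integral_bounded_L2[OF _ g])
    show "sq_integrable lebesgue (conv g (moll (r (s n))))" for n by (rule conv_moll_L2(1)[OF g r'(1)])
    show "(\<lambda>n. LINT x|lebesgue. (conv g (moll (r (s n))) x - g x)\<^sup>2) \<longlonglongrightarrow> 0"
      by (rule conv_moll_tendsto_L2[OF g r'])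
    show "(\<lambda>x. F' (U n x)) \<in> borel_measurable lebesgue" for n by (rule cm[OF F'c Um])
    show "(\<lambda>x. F' (u x)) \<in> borel_measurable lebesgue" by (rule cm[OF F'c sq_integrableD(1)[OF u]])
    show "\<bar>F' (U n x)\<bar> \<le> K'" for n x by (rule F'b)
    show "AE x in lebesgue. (\<lambda>n. F' (U n x)) \<longlonglongrightarrow> F' (u x)" by (rule Hlim[OF F'c])
    show "sq_integrable lebesgue \<phi>"
      by (rule continuous_bounded_support_sq_integrable[OF test_functionsD(2,3)[OF \<phi>]])
  qed
  from LIMSEQ_unique[OF l1[unfolded eq] tendsto_minus[OF l2]]
  show "(LINT x|lebesgue. F (u x) * partial i \<phi> x) = - (LINT x|lebesgue. F' (u x) * g x * \<phi> x)" .
qed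

lemma sq_integrable_compose_bounded_mult:
  assumes "u \<in> borel_measurable lebesgue" "continuous_on UNIV (H :: real \<Rightarrow> real)" "\<And>s. \<bar>H s\<bar> \<le> K"
    "sq_integrable lebesgue (g :: scalar_field)"
  shows "sq_integrable lebesgue (\<lambda>x. H (u x) * g x)"
  by (rule sq_integrable_bounded_mult[OF assms(4) _ assms(3)])
     (use measurable_compose[OF assms(1) borel_measurable_continuous_onI[OF assms(2)]] in simp)

section \<open>One-variable truncations and cut-offs\<close>

definition pos_part_integral :: "real \<Rightarrow> real" where "pos_part_integral t = (max 0 t)\<^sup>2 / 2"

lemma pos_part_square_has_derivative:
  "((\<lambda>t::real. (max 0 t)\<^sup>2) has_real_derivative 2 * max 0 t) (at t)"
proof (cases t "0::real" rule: linorder_cases)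
  case less
  have "((\<lambda>_. 0) has_real_derivative 0) (at t)" by simp
  then have "((\<lambda>t::real. (max 0 t)\<^sup>2) has_real_derivative 0) (at t)"
    by (rule has_field_derivative_transform_within_open[where S = "{..<0}"]) (use less in auto)
  then show ?thesis using less by simp
next
  case equal
  have "((\<lambda>y::real. ((max 0 y)\<^sup>2 - (max 0 0)\<^sup>2) / (y - 0)) \<longlongrightarrow> 0) (at 0)"
  proof (rule Lim_null_comparison)
    show "\<forall>\<^sub>F y::real in at 0. norm (((max 0 y)\<^sup>2 - (max 0 0)\<^sup>2) / (y - 0)) \<le> \<bar>y\<bar>"
      by (intro always_eventually allI) (auto simp: max_def power2_eq_square)
    show "((\<lambda>y::real. \<bar>y\<bar>) \<longlongrightarrow> 0) (at 0)" by (intro tendsto_rabs_zero tendsto_ident_at)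
  qed
  then show ?thesis using equal by (simp add: has_field_derivative_iff)
next
  case greater
  have "((\<lambda>t::real. t\<^sup>2) has_real_derivative 2 * t) (at t)"
    by (auto intro!: derivative_eq_intros)
  then have "((\<lambda>t::real. (max 0 t)\<^sup>2) has_real_derivative 2 * t) (at t)"
    by (rule has_field_derivative_transform_within_open[where S = "{0<..}"]) (use greater in auto)
  then show ?thesis using greater by simp
qed

lemma pos_part_integral_has_derivative:
  "(pos_part_integral has_real_derivative max 0 t) (at t)"
  unfolding pos_part_integral_def[abs_def]
  using DERIV_cdivide[OF pos_part_square_has_derivative[of t], of 2] by simp

text \<open>A \<open>C\<^sup>1\<close> substitute for the truncation \<open>sgn s * max 0 (\<bar>s\<bar> - 1)\<close>: the chain rule is only available for
  continuously differentiable outer functions.\<close>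

definition soft_threshold :: "real \<Rightarrow> real" where
  "soft_threshold s = pos_part_integral (s - 1) - pos_part_integral (s - 2)
     - pos_part_integral (- s - 1) + pos_part_integral (- s - 2)"

text \<open>The piecewise linear derivative of \<open>soft_threshold\<close>: 0 for |s| \<le> 1,
  rising to 1 at |s| = 2, and 1 beyond.\<close>

definition threshold_slope :: "real \<Rightarrow> real" where
  "threshold_slope s = max 0 (s - 1) - max 0 (s - 2) + max 0 (- s - 1) - max 0 (- s - 2)"

lemma soft_threshold_has_derivative:
  "(soft_threshold has_real_derivative threshold_slope s) (at s)"
proof -
  have d: "((\<lambda>s. pos_part_integral (c * s - a)) has_real_derivative max 0 (c * s - a) * c) (at s)" for a c
    by (rule DERIV_chain2[OF pos_part_integral_has_derivative]) (auto intro!: derivative_eq_intros)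
  have "((\<lambda>s. pos_part_integral (1 * s - 1) - pos_part_integral (1 * s - 2)
     - pos_part_integral ((-1) * s - 1) + pos_part_integral ((-1) * s - 2)) has_real_derivative
     max 0 (1 * s - 1) * 1 - max 0 (1 * s - 2) * 1 - max 0 ((-1) * s - 1) * (-1) + max 0 ((-1) * s - 2) * (-1)) (at s)"
    by (intro DERIV_add DERIV_diff d)
  then show ?thesis by (simp add: soft_threshold_def[abs_def] threshold_slope_def)
qed

lemma threshold_slope_bounds: "0 \<le> threshold_slope s" "threshold_slope s \<le> 1" "\<bar>threshold_slope s\<bar> \<le> 1"
  by (auto simp: threshold_slope_def max_def)

lemma threshold_slope_eq_1: "2 \<le> \<bar>s\<bar> \<Longrightarrow> threshold_slope s = 1"
  by (auto simp: threshold_slope_def max_def abs_if split: if_splits)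

lemma threshold_slope_0 [simp]: "threshold_slope 0 = 0"
  by (simp add: threshold_slope_def)

lemma soft_threshold_eq_0: "\<bar>s\<bar> \<le> 1 \<Longrightarrow> soft_threshold s = 0"
  by (simp add: soft_threshold_def pos_part_integral_def)

lemma soft_threshold_near: "\<bar>s - soft_threshold s\<bar> \<le> 2"
proof -
  have q: "pos_part_integral a = (if a \<le> 0 then 0 else a\<^sup>2 / 2)" for a
    by (simp add: pos_part_integral_def)
  consider "\<bar>s\<bar> \<le> 1" | "1 < s" "s \<le> 2" | "2 < s" | "s < -1" "-2 \<le> s" | "s < -2" by linarith
  then show ?thesis
  proof cases
    case 2
    have "0 \<le> (s - 1)\<^sup>2" "(s - 1)\<^sup>2 \<le> 1" using 2 by (auto intro: power_le_one)
    then have "\<bar>s - (s - 1)\<^sup>2 / 2\<bar> \<le> 2" using 2 by linarith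
    then show ?thesis using 2 by (simp add: soft_threshold_def q)
  next
    case 3
    have "soft_threshold s = s - 3/2" using 3
      by (simp add: soft_threshold_def q power2_eq_square field_simps)
    then show ?thesis by simp
  next
    case 4
    have "0 \<le> (- s - 1)\<^sup>2" "(- s - 1)\<^sup>2 \<le> 1" using 4 by (auto intro: power_le_one)
    then have "\<bar>s + (- s - 1)\<^sup>2 / 2\<bar> \<le> 2" using 4 by linarith
    then show ?thesis using 4 by (simp add: soft_threshold_def q)
  next
    case 5
    have "soft_threshold s = s + 3/2" using 5
      by (simp add: soft_threshold_def q power2_eq_square field_simps)
    then show ?thesis by simp
  qed (simp add: soft_threshold_eq_0)
qed

lemma threshold_slope_continuous: "continuous_on UNIV threshold_slope"
  unfolding threshold_slope_def[abs_def] by (intro continuous_intros)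

lemma soft_threshold_continuous: "continuous_on UNIV soft_threshold"
  by (intro continuous_at_imp_continuous_on ballI DERIV_isCont[OF soft_threshold_has_derivative])

lemma scaled_threshold_has_derivative:
  assumes "0 < d"
  shows "((\<lambda>s. d * soft_threshold (s / d)) has_real_derivative threshold_slope (s / d)) (at s)"
proof -
  have "((\<lambda>s. s / d) has_real_derivative 1 / d) (at s)"
    using assms by (auto intro!: derivative_eq_intros)
  from DERIV_cmult[OF DERIV_chain2[OF soft_threshold_has_derivative this], of d]
  show ?thesis using assms by simp
qed

lemma threshold_slope_tendsto:
  "(\<lambda>n. threshold_slope (s / (1 / real (Suc n)))) \<longlonglongrightarrow> (if s = 0 then 0 else 1)"
proof (cases "s = 0")
  case False
  obtain N where N: "2 / \<bar>s\<bar> \<le> real N" using real_arch_simple by blast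
  have "\<forall>\<^sub>F n in sequentially. threshold_slope (s / (1 / real (Suc n))) = 1"
    using eventually_ge_at_top[of N]
  proof eventually_elim
    fix n assume "N \<le> n"
    then have "2 / \<bar>s\<bar> \<le> real (Suc n)" using N by linarith
    then have "2 \<le> real (Suc n) * \<bar>s\<bar>" using False by (simp add: divide_le_eq)
    then show "threshold_slope (s / (1 / real (Suc n))) = 1"
      by (intro threshold_slope_eq_1) (simp add: abs_mult mult.commute)
  qed
  then show ?thesis using False by (simp add: tendsto_eventually)
qed simp

text \<open>As d tends to 0, the functions s - d * soft_threshold (s / d) tend to 0 uniformly while
  their derivatives tend to the indicator of {0}. In the chain rule one side therefore tends to 0
  and the other to the integral of g \<phi> over the set W = 0, so the fundamental lemma
  applies.\<close>

lemma weak_partial_vanishes_on_zero_set: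
  assumes W: "sq_integrable lebesgue W" and g: "sq_integrable lebesgue g" and wp: "is_weak_partial UNIV i W g"
  shows "AE x in lebesgue. W x = 0 \<longrightarrow> g x = 0"
proof -
  let ?I = "\<lambda>x. if W x = 0 then 1 else 0 :: real"
  have Im: "?I \<in> borel_measurable lebesgue"
    using sq_integrableD(1)[OF W] by measurable
  have gI: "sq_integrable lebesgue (\<lambda>x. ?I x * g x)"
    by (rule sq_integrable_bounded_mult[OF g Im, where C = 1]) simp
  define d where "d n = 1 / real (Suc n)" for n
  have d: "\<And>n. 0 < d n" "d \<longlonglongrightarrow> 0"
    using LIMSEQ_Suc[OF lim_1_over_n] by (auto simp: d_def[abs_def])
  let ?F = "\<lambda>n s. s - d n * soft_threshold (s / d n)"
  let ?F' = "\<lambda>n s. 1 - threshold_slope (s / d n)"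
  have F: "(?F n has_real_derivative ?F' n s) (at s)" for n s
    by (intro DERIV_diff DERIV_ident scaled_threshold_has_derivative d)
  have F'c: "continuous_on UNIV (?F' n)" for n
    by (intro continuous_intros continuous_on_compose2[OF threshold_slope_continuous]) (use d(1)[of n] in auto)
  have Fb: "\<bar>?F n s\<bar> \<le> 2 * d n" for n s
  proof -
    have "?F n s = d n * (s / d n - soft_threshold (s / d n))"
      using d(1)[of n] by (simp add: right_diff_distrib)
    then have "\<bar>?F n s\<bar> = d n * \<bar>s / d n - soft_threshold (s / d n)\<bar>"
      using d(1)[of n] by (simp add: abs_mult)
    also have "\<dots> \<le> d n * 2" using d(1)[of n] by (intro mult_left_mono soft_threshold_near) simp
    finally show ?thesis by simp
  qed
  have F'b: "\<bar>?F' n s\<bar> \<le> 1" for n s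
    using threshold_slope_bounds[of "s / d n"] by (simp add: abs_le_iff)
  have "(LINT x|lebesgue_on UNIV. (?I x * g x) * \<phi> x) = 0" if \<phi>: "\<phi> \<in> test_functions UNIV" for \<phi>
  proof -
    note p\<phi> = test_functions_partial[OF \<phi>, of i]
    have \<phi>q: "sq_integrable lebesgue \<phi>"
      by (rule continuous_bounded_support_sq_integrable[OF test_functionsD(2,3)[OF \<phi>]])
    have ip: "integrable lebesgue (partial i \<phi>)"
      by (rule continuous_bounded_support_integrable[OF test_functionsD(2,3)[OF p\<phi>]])
    have eq: "(LINT x|lebesgue. ?F n (W x) * partial i \<phi> x) = - (LINT x|lebesgue. ?F' n (W x) * g x * \<phi> x)" for n
      using weak_chain_rule[OF W g wp F F'c Fb F'b] \<phi>
      unfolding is_weak_partial_def lebesgue_on_UNIV_eq by blast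
    have b: "norm (LINT x|lebesgue. ?F n (W x) * partial i \<phi> x) \<le> 2 * d n * (LINT x|lebesgue. \<bar>partial i \<phi> x\<bar>)" for n
    proof -
      have "norm (LINT x|lebesgue. ?F n (W x) * partial i \<phi> x) \<le> (LINT x|lebesgue. norm (?F n (W x) * partial i \<phi> x))"
        by (rule integral_norm_bound)
      also have "\<dots> \<le> (LINT x|lebesgue. 2 * d n * \<bar>partial i \<phi> x\<bar>)"
      proof (rule integral_mono')
        show "integrable lebesgue (\<lambda>x. 2 * d n * \<bar>partial i \<phi> x\<bar>)"
          using ip by (intro integrable_mult_right integrable_abs)
        show "norm (?F n (W x) * partial i \<phi> x) \<le> 2 * d n * \<bar>partial i \<phi> x\<bar>" for x
          unfolding real_norm_def abs_mult by (intro mult_right_mono Fb abs_ge_zero)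
        show "0 \<le> 2 * d n * \<bar>partial i \<phi> x\<bar>" for x using d(1)[of n] by simp
      qed
      finally show ?thesis by simp
    qed
    have "(\<lambda>n. 2 * d n * (LINT x|lebesgue. \<bar>partial i \<phi> x\<bar>)) \<longlonglongrightarrow> 0"
      by (rule tendsto_mult_left_zero[OF tendsto_mult_right_zero[OF d(2)]])
    with always_eventually[OF allI[OF b]]
    have "(\<lambda>n. LINT x|lebesgue. ?F n (W x) * partial i \<phi> x) \<longlonglongrightarrow> 0"
      by (rule Lim_null_comparison)
    from tendsto_minus[OF this] have l1: "(\<lambda>n. LINT x|lebesgue. ?F' n (W x) * g x * \<phi> x) \<longlonglongrightarrow> 0"
      unfolding eq by simp
    have l2: "(\<lambda>n. LINT x|lebesgue. ?F' n (W x) * g x * \<phi> x) \<longlonglongrightarrow> (LINT x|lebesgue. ?I x * g x * \<phi> x)"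
    proof (rule tendsto_integral_bounded_L2[OF g g])
      show "(\<lambda>n. LINT x|lebesgue. (g x - g x)\<^sup>2) \<longlonglongrightarrow> 0" by simp
      show "(\<lambda>x. ?F' n (W x)) \<in> borel_measurable lebesgue" for n
        using measurable_compose[OF sq_integrableD(1)[OF W] borel_measurable_continuous_onI[OF F'c[of n]]] by simp
      show "\<bar>?F' n (W x)\<bar> \<le> 1" for n x by (rule F'b)
      have "(\<lambda>n. ?F' n (W x)) \<longlonglongrightarrow> ?I x" for x
      proof -
        have "(\<lambda>n. ?F' n (W x)) \<longlonglongrightarrow> 1 - (if W x = 0 then 0 else 1)"
          unfolding d_def by (intro tendsto_intros threshold_slope_tendsto)
        moreover have "1 - (if W x = 0 then 0 else 1) = ?I x" by simp
        ultimately show ?thesis by (simp only:)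
      qed
      then show "AE x in lebesgue. (\<lambda>n. ?F' n (W x)) \<longlonglongrightarrow> ?I x" by (intro AE_I2)
    qed (fact Im \<phi>q)+
    from LIMSEQ_unique[OF l2 l1] show ?thesis by (simp only: lebesgue_on_UNIV_eq)
  qed
  then have "AE x in lebesgue_on UNIV. ?I x * g x = 0"
    using gI by (intro fundamental_lemma) (auto simp: lebesgue_on_UNIV_eq)
  then show ?thesis unfolding lebesgue_on_UNIV_eq by eventually_elim (auto split: if_splits)
qed

text \<open>A C^1 counterpart of min 1 |s|: it is 0 at 0, equals 1 for |s| \<ge> 1 and is at most 2
  |s|, so that composition with it preserves L^2.\<close>

definition plateau :: "real \<Rightarrow> real" where "plateau s = 1 - (max 0 (1 - s\<^sup>2))\<^sup>2"
definition plateau' :: "real \<Rightarrow> real" where "plateau' s = 4 * s * max 0 (1 - s\<^sup>2)"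

lemma plateau_has_derivative: "(plateau has_real_derivative plateau' s) (at s)"
proof -
  have "((\<lambda>s. 1 - s\<^sup>2) has_real_derivative - (2 * s)) (at s)"
    by (auto intro!: derivative_eq_intros)
  from DERIV_diff[OF DERIV_const DERIV_chain2[OF pos_part_square_has_derivative this], of 1]
  show ?thesis by (simp add: plateau_def[abs_def] plateau'_def mult_ac)
qed

lemma plateau'_continuous: "continuous_on UNIV plateau'"
  unfolding plateau'_def[abs_def] by (intro continuous_intros)

lemma plateau_continuous: "continuous_on UNIV plateau"
  unfolding plateau_def[abs_def] by (intro continuous_intros)

lemma plateau_bounds: "0 \<le> plateau s" "plateau s \<le> 1" "\<bar>plateau s\<bar> \<le> 1" "\<bar>plateau s\<bar> \<le> 2 * \<bar>s\<bar>"
proof -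
  let ?q = "max 0 (1 - s\<^sup>2)"
  have q: "0 \<le> ?q" "?q \<le> 1" by auto
  have "?q\<^sup>2 \<le> 1" using q by (intro power_le_one) auto
  then show p: "0 \<le> plateau s" "plateau s \<le> 1" "\<bar>plateau s\<bar> \<le> 1" by (auto simp: plateau_def)
  show "\<bar>plateau s\<bar> \<le> 2 * \<bar>s\<bar>"
  proof (cases "\<bar>s\<bar> \<le> 1")
    case True
    have s1: "s\<^sup>2 \<le> 1" using True by (simp add: abs_square_le_1)
    have "s\<^sup>2 \<le> \<bar>s\<bar>" using mult_left_mono[OF True abs_ge_zero[of s]] by (simp add: power2_eq_square)
    moreover have "plateau s = 2 * s\<^sup>2 - (s\<^sup>2)\<^sup>2" using s1 by (simp add: plateau_def power2_diff)
    ultimately show ?thesis using p(1) zero_le_power2[of "s\<^sup>2"] by linarith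
  next
    case False
    then show ?thesis using p(3) by linarith
  qed
qed

lemma plateau'_bound: "\<bar>plateau' s\<bar> \<le> 4"
proof (cases "\<bar>s\<bar> \<le> 1")
  case True
  have "\<bar>plateau' s\<bar> = 4 * (\<bar>s\<bar> * max 0 (1 - s\<^sup>2))" by (simp add: plateau'_def abs_mult)
  also have "\<dots> \<le> 4 * (1 * 1)" using True by (intro mult_left_mono mult_mono) auto
  finally show ?thesis by simp
next
  case False
  then have "1 \<le> \<bar>s\<bar>\<^sup>2" by (intro one_le_power) simp
  then show ?thesis by (simp add: plateau'_def)
qed

lemma plateau_eq_1: "1 \<le> s \<Longrightarrow> plateau s = 1"
  by (simp add: plateau_def one_le_power)

lemma plateau'_0 [simp]: "plateau' 0 = 0"
  by (simp add: plateau'_def)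

section \<open>Sets of capacity zero\<close>

lemma sobolev_subset_L2: "sobolev k \<Omega> \<subseteq> L2 \<Omega>"
  by (cases k) auto

lemma weak_partialD:
  assumes "u \<in> sobolev (Suc k) \<Omega>"
  shows "weak_partial \<Omega> i u \<in> L2 \<Omega>" "is_weak_partial \<Omega> i u (weak_partial \<Omega> i u)"
proof -
  have "\<exists>g. g \<in> L2 \<Omega> \<and> is_weak_partial \<Omega> i u g"
    using assms sobolev_subset_L2[of k \<Omega>] by fastforce
  from someI_ex[OF this]
  show "weak_partial \<Omega> i u \<in> L2 \<Omega>" "is_weak_partial \<Omega> i u (weak_partial \<Omega> i u)"
    by (simp_all add: weak_partial_def)
qed

lemma sq_integrable_restrict:
  assumes "sq_integrable lebesgue (f :: scalar_field)" "\<Omega> \<in> sets lebesgue"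
  shows "sq_integrable (lebesgue_on \<Omega>) f"
  unfolding sq_integrable_lebesgue_on[OF assms(2)]
  by (rule sq_integrable_bounded_mult[OF assms(1), where C = 1]) (use assms(2) in auto)

lemma test_function_sq_integrable:
  assumes "\<phi> \<in> test_functions \<Omega>" "open \<Omega>"
  shows "sq_integrable (lebesgue_on \<Omega>) \<phi>"
  by (intro sq_integrable_restrict continuous_bounded_support_sq_integrable
      test_functionsD[OF assms(1)] open_lebesgue assms(2))

lemma weak_partial_unique:
  assumes "open \<Omega>" "g \<in> L2 \<Omega>" "h \<in> L2 \<Omega>" "is_weak_partial \<Omega> i u g" "is_weak_partial \<Omega> i u h"
  shows "AE x in lebesgue_on \<Omega>. g x = h x"
proof -
  note q = assms(2,3)[unfolded L2_iff]
  have "AE x in lebesgue_on \<Omega>. g x - h x = 0"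
  proof (rule fundamental_lemma[OF assms(1) sq_integrable_diff[OF q]])
    fix \<phi> assume \<phi>: "\<phi> \<in> test_functions \<Omega>"
    note \<phi>q = test_function_sq_integrable[OF \<phi> assms(1)]
    have "(LINT x|lebesgue_on \<Omega>. (g x - h x) * \<phi> x) =
      (LINT x|lebesgue_on \<Omega>. g x * \<phi> x) - (LINT x|lebesgue_on \<Omega>. h x * \<phi> x)"
      unfolding left_diff_distrib
      by (intro Bochner_Integration.integral_diff sq_integrable_mult q \<phi>q)
    also have "\<dots> = 0"
      using assms(4,5) \<phi> by (simp add: is_weak_partial_def)
    finally show "(LINT x|lebesgue_on \<Omega>. (g x - h x) * \<phi> x) = 0" .
  qed
  then show ?thesis by eventually_elim simp
qed

lemma is_weak_partial_add:
  assumes "open \<Omega>" "u \<in> L2 \<Omega>" "v \<in> L2 \<Omega>" "g \<in> L2 \<Omega>" "h \<in> L2 \<Omega>"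
    "is_weak_partial \<Omega> i u g" "is_weak_partial \<Omega> i v h"
  shows "is_weak_partial \<Omega> i (\<lambda>x. u x + v x) (\<lambda>x. g x + h x)"
  unfolding is_weak_partial_def
proof
  fix \<phi> assume \<phi>: "\<phi> \<in> test_functions \<Omega>"
  note q = assms(2-5)[unfolded L2_iff] test_function_sq_integrable[OF \<phi> assms(1)]
    test_function_sq_integrable[OF test_functions_partial[OF \<phi>] assms(1)]
  have "(LINT x|lebesgue_on \<Omega>. (u x + v x) * partial i \<phi> x) =
      (LINT x|lebesgue_on \<Omega>. u x * partial i \<phi> x) + (LINT x|lebesgue_on \<Omega>. v x * partial i \<phi> x)"
    unfolding distrib_right by (intro Bochner_Integration.integral_add sq_integrable_mult q)
  moreover have "(LINT x|lebesgue_on \<Omega>. (g x + h x) * \<phi> x) =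
      (LINT x|lebesgue_on \<Omega>. g x * \<phi> x) + (LINT x|lebesgue_on \<Omega>. h x * \<phi> x)"
    unfolding distrib_right by (intro Bochner_Integration.integral_add sq_integrable_mult q)
  ultimately show "(LINT x|lebesgue_on \<Omega>. (u x + v x) * partial i \<phi> x) =
      - (LINT x|lebesgue_on \<Omega>. (g x + h x) * \<phi> x)"
    using assms(6,7) \<phi> by (simp add: is_weak_partial_def)
qed

lemma is_weak_partial_cmult:
  assumes "is_weak_partial \<Omega> i u g"
  shows "is_weak_partial \<Omega> i (\<lambda>x. c * u x) (\<lambda>x. c * g x)"
  using assms by (simp add: is_weak_partial_def mult.assoc)

text \<open>The norm is defined through the chosen derivatives \<open>weak_partial\<close>; by
  uniqueness any other weak derivatives may take their place.\<close>

lemma sobolev_norm_1_eq: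
  assumes u: "u \<in> sobolev 1 UNIV" and g: "\<And>i. sq_integrable lebesgue (g i)" "\<And>i. is_weak_partial UNIV i u (g i)"
  shows "(sobolev_norm 1 UNIV u)\<^sup>2 = (LINT x|lebesgue. (u x)\<^sup>2) + (\<Sum>i\<in>UNIV. LINT x|lebesgue. (g i x)\<^sup>2)"
proof -
  have u': "u \<in> sobolev (Suc 0) UNIV" using u by simp
  have "(LINT x|lebesgue. (weak_partial UNIV i u x)\<^sup>2) = (LINT x|lebesgue. (g i x)\<^sup>2)" for i
  proof (rule integral_cong_AE)
    have "AE x in lebesgue_on UNIV. weak_partial UNIV i u x = g i x"
      using weak_partial_unique[OF open_UNIV weak_partialD(1)[OF u'] _ weak_partialD(2)[OF u'] g(2)] g(1)
      by (simp add: L2_UNIV_iff)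
    then show "AE x in lebesgue. (weak_partial UNIV i u x)\<^sup>2 = (g i x)\<^sup>2"
      unfolding lebesgue_on_UNIV_eq by eventually_elim simp
    show "(\<lambda>x. (weak_partial UNIV i u x)\<^sup>2) \<in> borel_measurable lebesgue"
      using weak_partialD(1)[OF u', of i] by (intro borel_measurable_power) (simp add: L2_UNIV_iff sq_integrable_def)
    show "(\<lambda>x. (g i x)\<^sup>2) \<in> borel_measurable lebesgue"
      by (intro borel_measurable_power sq_integrableD(1)[OF g(1)])
  qed
  then have "sobolev_inner 1 UNIV u u = (LINT x|lebesgue. (u x)\<^sup>2) + (\<Sum>i\<in>UNIV. LINT x|lebesgue. (g i x)\<^sup>2)"
    by (simp add: lebesgue_on_UNIV_eq power2_eq_square)
  moreover have "0 \<le> (LINT x|lebesgue. (u x)\<^sup>2) + (\<Sum>i\<in>UNIV. LINT x|lebesgue. (g i x)\<^sup>2)"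
    by (intro add_nonneg_nonneg sum_nonneg) auto
  ultimately show ?thesis by (simp add: sobolev_norm_def)
qed

text \<open>A competitor showing that the capacity of A is below e. It carries its weak gradient g
  along, so that no reference to the representatives chosen by \<open>weak_partial\<close>
  remains.\<close>

definition capacity_witness ::
  "(real^3) set \<Rightarrow> real \<Rightarrow> scalar_field \<Rightarrow> (3 \<Rightarrow> scalar_field) \<Rightarrow> (real^3) set \<Rightarrow> bool" where
  "capacity_witness A e u g U \<longleftrightarrow> sq_integrable lebesgue u \<and> (\<forall>i. sq_integrable lebesgue (g i)) \<and>
     (\<forall>i. is_weak_partial UNIV i u (g i)) \<and> open U \<and> A \<subseteq> U \<and> (AE x in lebesgue. x \<in> U \<longrightarrow> 1 \<le> u x) \<and>
     (LINT x|lebesgue. (u x)\<^sup>2) + (\<Sum>i\<in>UNIV. LINT x|lebesgue. (g i x)\<^sup>2) < e"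

lemma capacity_witnessI:
  assumes "capacity A = 0" "0 < e"
  obtains u g U where "capacity_witness A e u g U"
proof -
  have "capacity A < ennreal e" using assms by simp
  then obtain u U where u: "u \<in> sobolev 1 UNIV" "open U" "A \<subseteq> U" "AE x in lebesgue. x \<in> U \<longrightarrow> 1 \<le> u x"
    "ennreal ((sobolev_norm 1 UNIV u)\<^sup>2) < ennreal e"
    unfolding capacity_def INF_less_iff by blast
  have u': "u \<in> sobolev (Suc 0) UNIV" using u(1) by simp
  have w: "sq_integrable lebesgue (weak_partial UNIV i u)" "is_weak_partial UNIV i u (weak_partial UNIV i u)" for i
    using weak_partialD[OF u', of i] by (simp_all add: L2_UNIV_iff)
  have "(sobolev_norm 1 UNIV u)\<^sup>2 < e" using u(5) by (simp add: ennreal_less_iff)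
  then have "capacity_witness A e u (\<lambda>i. weak_partial UNIV i u) U"
    using u u' w sobolev_norm_1_eq[OF u(1) w] by (auto simp: capacity_witness_def L2_UNIV_iff)
  then show thesis by (rule that)
qed

lemma capacity_null_if_witness:
  assumes "\<And>e. 0 < e \<Longrightarrow> \<exists>u g U. capacity_witness A e u g U"
  shows "capacity A = 0"
proof -
  have "capacity A \<le> 0"
  proof (rule ennreal_le_epsilon)
    fix e :: real assume "0 < e"
    then obtain u g U where w: "capacity_witness A e u g U" using assms by blast
    then have u: "u \<in> sobolev 1 UNIV" by (auto simp: capacity_witness_def L2_UNIV_iff)
    have "(sobolev_norm 1 UNIV u)\<^sup>2 \<le> e"
      using w sobolev_norm_1_eq[OF u, of g] by (simp add: capacity_witness_def)
    then have "ennreal ((sobolev_norm 1 UNIV u)\<^sup>2) \<le> ennreal e" by (rule ennreal_leI)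
    moreover have "capacity A \<le> ennreal ((sobolev_norm 1 UNIV u)\<^sup>2)"
      unfolding capacity_def using w u by (intro INF_lower) (auto simp: capacity_witness_def)
    ultimately show "capacity A \<le> 0 + ennreal e" by simp
  qed
  then show ?thesis by simp
qed

lemma capacity_null_subset:
  assumes "capacity B = 0" "A \<subseteq> B"
  shows "capacity A = 0"
proof (rule capacity_null_if_witness)
  fix e :: real assume "0 < e"
  with assms(1) obtain u g U where "capacity_witness B e u g U" by (rule capacity_witnessI)
  with assms(2) show "\<exists>u g U. capacity_witness A e u g U" unfolding capacity_witness_def by blast
qed

text \<open>The constants 4 and 16 are the squares of the factors in |plateau s| \<le> 2 |s| and
  |plateau' s| \<le> 4.\<close>

lemma plateau_compose:
  assumes "capacity_witness A e u g U"
  defines "w \<equiv> \<lambda>x. plateau (u x)" and "h \<equiv> \<lambda>i x. plateau' (u x) * g i x"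
  shows "sq_integrable lebesgue w" "\<And>i. sq_integrable lebesgue (h i)" "\<And>i. is_weak_partial UNIV i w (h i)"
    "(LINT x|lebesgue. (w x)\<^sup>2) \<le> 4 * (LINT x|lebesgue. (u x)\<^sup>2)"
    "\<And>i. (LINT x|lebesgue. (h i x)\<^sup>2) \<le> 16 * (LINT x|lebesgue. (g i x)\<^sup>2)"
proof -
  have u: "sq_integrable lebesgue u" and g: "sq_integrable lebesgue (g i)"
    and wp: "is_weak_partial UNIV i u (g i)" for i
    using assms(1) by (auto simp: capacity_witness_def)
  have wm: "w \<in> borel_measurable lebesgue"
    unfolding w_def
    using measurable_compose[OF sq_integrableD(1)[OF u] borel_measurable_continuous_onI[OF plateau_continuous]] by simp
  have le: "(w x)\<^sup>2 \<le> 4 * (u x)\<^sup>2" for x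
    using square_le_if_abs_le[OF plateau_bounds(4)[of "u x"]] by (simp add: w_def power_mult_distrib)
  have i4: "integrable lebesgue (\<lambda>x. 4 * (u x)\<^sup>2)" using sq_integrableD(2)[OF u] by simp
  have wi: "integrable lebesgue (\<lambda>x. (w x)\<^sup>2)"
    by (rule Bochner_Integration.integrable_bound[OF i4 borel_measurable_power[OF wm]])
       (use le in auto)
  then show "sq_integrable lebesgue w" using wm by (simp add: sq_integrable_def)
  show hq: "sq_integrable lebesgue (h i)" for i
    unfolding h_def
    by (rule sq_integrable_compose_bounded_mult[OF sq_integrableD(1)[OF u] plateau'_continuous plateau'_bound g])
  show "is_weak_partial UNIV i w (h i)" for i
    unfolding w_def h_def
    by (rule weak_chain_rule[OF u g wp plateau_has_derivative plateau'_continuous plateau_bounds(3) plateau'_bound])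
  have "(LINT x|lebesgue. (w x)\<^sup>2) \<le> (LINT x|lebesgue. 4 * (u x)\<^sup>2)"
    by (rule integral_mono[OF wi i4 le])
  then show "(LINT x|lebesgue. (w x)\<^sup>2) \<le> 4 * (LINT x|lebesgue. (u x)\<^sup>2)" by simp
  have hle: "(h i x)\<^sup>2 \<le> 16 * (g i x)\<^sup>2" for i x
  proof -
    have "(plateau' (u x))\<^sup>2 \<le> 4\<^sup>2" by (rule square_le_if_abs_le[OF plateau'_bound])
    then have "(plateau' (u x))\<^sup>2 * (g i x)\<^sup>2 \<le> 4\<^sup>2 * (g i x)\<^sup>2" by (rule mult_right_mono) simp
    then show ?thesis by (simp add: h_def power_mult_distrib)
  qed
  have i16: "integrable lebesgue (\<lambda>x. 16 * (g i x)\<^sup>2)" for i using sq_integrableD(2)[OF g] by simp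
  have "(LINT x|lebesgue. (h i x)\<^sup>2) \<le> (LINT x|lebesgue. 16 * (g i x)\<^sup>2)" for i
    by (rule integral_mono[OF sq_integrableD(2)[OF hq] i16 hle])
  then show "(LINT x|lebesgue. (h i x)\<^sup>2) \<le> 16 * (LINT x|lebesgue. (g i x)\<^sup>2)" for i by simp
qed

text \<open>Composing with \<open>plateau\<close> makes the two competitors nonnegative, so that their sum competes for the union.\<close>

lemma capacity_null_Un:
  assumes "capacity A = 0" "capacity B = 0"
  shows "capacity (A \<union> B) = 0"
proof (rule capacity_null_if_witness)
  fix e :: real assume "0 < e"
  \<comment> \<open>Squaring a sum costs a factor 2 and composing with \<open>plateau\<close> at
    most 16, which makes 32 for each of the two competitors.\<close>
  then have e: "0 < e / 64" by simp
  obtain u g U where w1: "capacity_witness A (e / 64) u g U" by (rule capacity_witnessI[OF assms(1) e])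
  obtain v h V where w2: "capacity_witness B (e / 64) v h V" by (rule capacity_witnessI[OF assms(2) e])
  note p = plateau_compose[OF w1] and q = plateau_compose[OF w2]
  let ?u = "\<lambda>x. plateau (u x)" and ?v = "\<lambda>x. plateau (v x)"
  let ?g = "\<lambda>i x. plateau' (u x) * g i x" and ?h = "\<lambda>i x. plateau' (v x) * h i x"
  have "capacity_witness (A \<union> B) e (\<lambda>x. ?u x + ?v x) (\<lambda>i x. ?g i x + ?h i x) (U \<union> V)"
    unfolding capacity_witness_def
  proof (intro conjI allI)
    show "sq_integrable lebesgue (\<lambda>x. ?u x + ?v x)" by (rule sq_integrable_add[OF p(1) q(1)])
    show "sq_integrable lebesgue (\<lambda>x. ?g i x + ?h i x)" for i by (rule sq_integrable_add[OF p(2) q(2)])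
    show "is_weak_partial UNIV i (\<lambda>x. ?u x + ?v x) (\<lambda>x. ?g i x + ?h i x)" for i
      by (rule is_weak_partial_add[OF open_UNIV _ _ _ _ p(3) q(3)]) (unfold L2_UNIV_iff, (rule p q)+)
    show "open (U \<union> V)" "A \<union> B \<subseteq> U \<union> V" using w1 w2 by (auto simp: capacity_witness_def)
    have ae: "AE x in lebesgue. x \<in> U \<longrightarrow> 1 \<le> u x" "AE x in lebesgue. x \<in> V \<longrightarrow> 1 \<le> v x"
      using w1 w2 by (auto simp: capacity_witness_def)
    show "AE x in lebesgue. x \<in> U \<union> V \<longrightarrow> 1 \<le> ?u x + ?v x"
      using ae
    proof eventually_elim
      fix x assume x: "x \<in> U \<longrightarrow> 1 \<le> u x" "x \<in> V \<longrightarrow> 1 \<le> v x"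
      show "x \<in> U \<union> V \<longrightarrow> 1 \<le> ?u x + ?v x"
        using x plateau_eq_1[of "u x"] plateau_eq_1[of "v x"] plateau_bounds(1)[of "u x"] plateau_bounds(1)[of "v x"]
        by auto
    qed
    have "(LINT x|lebesgue. (?u x + ?v x)\<^sup>2) + (\<Sum>i\<in>UNIV. LINT x|lebesgue. (?g i x + ?h i x)\<^sup>2)
      \<le> (2 * (4 * (LINT x|lebesgue. (u x)\<^sup>2)) + 2 * (4 * (LINT x|lebesgue. (v x)\<^sup>2)))
        + (\<Sum>i\<in>UNIV. 2 * (16 * (LINT x|lebesgue. (g i x)\<^sup>2)) + 2 * (16 * (LINT x|lebesgue. (h i x)\<^sup>2)))"
    proof (intro add_mono sum_mono)
      show "(LINT x|lebesgue. (?u x + ?v x)\<^sup>2) \<le>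
          2 * (4 * (LINT x|lebesgue. (u x)\<^sup>2)) + 2 * (4 * (LINT x|lebesgue. (v x)\<^sup>2))"
        using integral_square_add_le[OF p(1) q(1)] p(4) q(4) by linarith
      show "(LINT x|lebesgue. (?g i x + ?h i x)\<^sup>2) \<le>
          2 * (16 * (LINT x|lebesgue. (g i x)\<^sup>2)) + 2 * (16 * (LINT x|lebesgue. (h i x)\<^sup>2))" for i
        using integral_square_add_le[OF p(2)[of i] q(2)[of i]] p(5)[of i] q(5)[of i] by linarith
    qed
    also have "\<dots> = 8 * (LINT x|lebesgue. (u x)\<^sup>2) + 8 * (LINT x|lebesgue. (v x)\<^sup>2) +
        32 * (\<Sum>i\<in>UNIV. LINT x|lebesgue. (g i x)\<^sup>2) + 32 * (\<Sum>i\<in>UNIV. LINT x|lebesgue. (h i x)\<^sup>2)"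
      by (simp add: sum.distrib sum_distrib_left)
    also have "\<dots> < e"
    proof -
      have "0 \<le> (LINT x|lebesgue. (u x)\<^sup>2)" "0 \<le> (LINT x|lebesgue. (v x)\<^sup>2)"
        "(LINT x|lebesgue. (u x)\<^sup>2) + (\<Sum>i\<in>UNIV. LINT x|lebesgue. (g i x)\<^sup>2) < e / 64"
        "(LINT x|lebesgue. (v x)\<^sup>2) + (\<Sum>i\<in>UNIV. LINT x|lebesgue. (h i x)\<^sup>2) < e / 64"
        using w1 w2 by (auto simp: capacity_witness_def)
      then show ?thesis by linarith
    qed
    finally show "(LINT x|lebesgue. (?u x + ?v x)\<^sup>2) + (\<Sum>i\<in>UNIV. LINT x|lebesgue. (?g i x + ?h i x)\<^sup>2) < e" .
  qed
  then show "\<exists>u g W. capacity_witness (A \<union> B) e u g W" by blast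
qed

text \<open>The open sets \<Omega> and Q \<union> - closure \<Omega> cover the space; on the first
  one \<phi> is f, on the second it is 0. So setting f to 0 outside \<Omega> produces no break at
  the boundary.\<close>

lemma C1_cut_off:
  assumes f: "C_k (Suc 0) f" and \<Omega>: "open \<Omega>" and Q: "open Q" "frontier \<Omega> \<subseteq> Q" "\<And>x. x \<in> Q \<Longrightarrow> f x = 0"
  defines "\<phi> \<equiv> \<lambda>x. if x \<in> \<Omega> then f x else 0"
  shows "C_k (Suc 0) \<phi>" "closure {x. \<phi> x \<noteq> 0} \<subseteq> \<Omega>" "\<And>x i. x \<in> \<Omega> \<Longrightarrow> partial i \<phi> x = partial i f x"
proof -
  let ?S = "Q \<union> - closure \<Omega>"
  have S: "open ?S" using Q(1) by auto
  have cov: "\<Omega> \<union> ?S = UNIV"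
    using Q(2) interior_open[OF \<Omega>] by (auto simp: frontier_def)
  have z: "\<phi> x = 0" if "x \<in> ?S" for x
    using that Q(3) closure_subset[of \<Omega>] by (auto simp: \<phi>_def)
  have d1: "(\<phi> has_derivative (\<lambda>h. \<Sum>i\<in>UNIV. h $ i * partial i f x)) (at x)" if "x \<in> \<Omega>" for x
    by (rule has_derivative_transform_within_open[OF has_derivative_partial[OF C_k_1D(1)[OF f]] \<Omega> that])
       (simp add: \<phi>_def)
  have d2: "(\<phi> has_derivative (\<lambda>h. 0)) (at x)" if "x \<in> ?S" for x
    by (rule has_derivative_transform_within_open[OF has_derivative_const S that]) (simp add: z)
  have p2: "partial i \<phi> x = 0" if "x \<in> ?S" for i x
    using partial_eq[OF d2[OF that]] .
  show p1: "partial i \<phi> x = partial i f x" if "x \<in> \<Omega>" for i x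
    by (subst partial_eq[OF d1[OF that]])
       (simp add: axis_def if_distrib [of "\<lambda>z. z * _"] cong: if_cong)
  have "continuous_on \<Omega> (partial i \<phi>)" for i
    using continuous_on_subset[OF C_k_1D(2)[OF f], of \<Omega> i] by (simp add: p1 cong: continuous_on_cong)
  moreover have "continuous_on ?S (partial i \<phi>)" for i
  proof -
    have "continuous_on ?S (\<lambda>_. 0 :: real)" by (rule continuous_on_const)
    then show ?thesis by (rule continuous_on_eq) (simp only: p2)
  qed
  ultimately have "continuous_on (\<Omega> \<union> ?S) (partial i \<phi>)" for i
    by (rule continuous_on_open_Un[OF \<Omega> S])
  moreover have "\<phi> differentiable (at x)" for x
    using cov differentiableI[OF d1, of x] differentiableI[OF d2, of x] by blast
  ultimately show "C_k (Suc 0) \<phi>" by (simp add: cov)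
  have "{x. \<phi> x \<noteq> 0} \<subseteq> - ?S" using z by blast
  then have "closure {x. \<phi> x \<noteq> 0} \<subseteq> - ?S" by (intro closure_minimal) (use S in \<open>simp_all add: open_closed\<close>)
  also have "\<dots> \<subseteq> \<Omega>" using cov by blast
  finally show "closure {x. \<phi> x \<noteq> 0} \<subseteq> \<Omega>" .
qed

lemma L2_tendsto_restrict:
  assumes \<Omega>: "\<Omega> \<in> sets lebesgue"
    and f: "\<And>n. sq_integrable lebesgue (f n)" "sq_integrable lebesgue (f' :: scalar_field)"
    and lim: "(\<lambda>n. LINT x|lebesgue. (f n x - f' x)\<^sup>2) \<longlonglongrightarrow> 0"
  shows "(\<lambda>n. LINT x|lebesgue_on \<Omega>. (f n x - f' x)\<^sup>2) \<longlonglongrightarrow> 0"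
proof (rule tendsto_sandwich[OF _ _ tendsto_const lim])
  show "\<forall>\<^sub>F n in sequentially. 0 \<le> (LINT x|lebesgue_on \<Omega>. (f n x - f' x)\<^sup>2)" by simp
  have "(LINT x|lebesgue_on \<Omega>. (f n x - f' x)\<^sup>2) \<le> (LINT x|lebesgue. (f n x - f' x)\<^sup>2)" for n
    unfolding integral_lebesgue_on[OF \<Omega>]
  proof (rule integral_mono')
    show "integrable lebesgue (\<lambda>x. (f n x - f' x)\<^sup>2)"
      by (rule sq_integrableD(2)[OF sq_integrable_diff[OF f]])
  qed (auto simp: indicator_def)
  then show "\<forall>\<^sub>F n in sequentially. (LINT x|lebesgue_on \<Omega>. (f n x - f' x)\<^sup>2) \<le> (LINT x|lebesgue. (f n x - f' x)\<^sup>2)"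
    by simp
qed

section \<open>Gradients of functions with vanishing trace\<close>

text \<open>In the application \<open>W\<close> is the difference of two H^2 extensions,
  \<open>G\<close> its weak gradient, \<open>V\<close> its continuous representative and
  \<open>c\<close> the curl of an H^1 field. The assumption \<open>orth\<close> says that
  \<open>c\<close> is divergence-free in the weak sense.\<close>

locale gradient_orthogonality =
  fixes \<Omega> :: "(real^3) set" and c :: "3 \<Rightarrow> scalar_field"
    and W V :: scalar_field and G :: "3 \<Rightarrow> scalar_field" and C :: real
  assumes \<Omega>: "open \<Omega>" "bounded \<Omega>"
    and c: "\<And>i. sq_integrable (lebesgue_on \<Omega>) (c i)"
    and orth: "\<And>\<psi>. \<psi> \<in> test_functions \<Omega> \<Longrightarrow> (\<Sum>i\<in>UNIV. LINT x|lebesgue_on \<Omega>. partial i \<psi> x * c i x) = 0"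
    and W: "sq_integrable lebesgue W" and G: "\<And>i. sq_integrable lebesgue (G i)"
    and wp: "\<And>i. is_weak_partial UNIV i W (G i)"
    and V: "continuous_on UNIV V" "AE x in lebesgue. W x = V x"
    and VC: "\<And>r x. 0 < r \<Longrightarrow> \<bar>conv W (moll r) x - V x\<bar> \<le> C * sqrt r"
begin

lemma \<Omega>_lebesgue: "\<Omega> \<in> sets lebesgue"
  by (rule open_lebesgue[OF \<Omega>(1)])

lemma restrict_measurable: "f \<in> borel_measurable lebesgue \<Longrightarrow> f \<in> borel_measurable (lebesgue_on \<Omega>)"
  for f :: scalar_field
  by (rule measurable_restrict_space1)

lemma restrict_AE:
  assumes "AE x in lebesgue. P x"
  shows "AE x in lebesgue_on \<Omega>. P x"
proof -
  have "AE x in lebesgue. x \<in> \<Omega> \<longrightarrow> P x" using assms by eventually_elim simp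
  then show ?thesis using \<Omega>_lebesgue by (simp add: AE_restrict_space_iff)
qed

lemma compose_measurable:
  "continuous_on UNIV (H :: real \<Rightarrow> real) \<Longrightarrow> v \<in> borel_measurable lebesgue \<Longrightarrow> (\<lambda>x. H (v x)) \<in> borel_measurable (lebesgue_on \<Omega>)"
  for v :: scalar_field
  by (rule restrict_measurable)
     (use measurable_compose[of v lebesgue borel H borel] borel_measurable_continuous_onI[of H] in simp)

lemma V_measurable: "V \<in> borel_measurable lebesgue"
  by (rule continuous_lebesgue_measurable[OF V(1)])

lemma V_bounded: obtains B where "0 \<le> B" "\<And>x. x \<in> \<Omega> \<Longrightarrow> \<bar>V x\<bar> \<le> B"
proof -
  have "compact (V ` closure \<Omega>)"
    using \<Omega>(2) by (intro compact_continuous_image continuous_on_subset[OF V(1)]) (simp_all add: compact_closure)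
  then have "bounded (V ` closure \<Omega>)" by (rule compact_imp_bounded)
  then obtain B where B: "0 < B" "\<And>x. x \<in> closure \<Omega> \<Longrightarrow> \<bar>V x\<bar> \<le> B"
    by (auto simp: bounded_pos)
  show thesis
  proof (rule that)
    show "0 \<le> B" using B(1) by simp
    show "\<bar>V x\<bar> \<le> B" if "x \<in> \<Omega>" for x by (rule B(2)) (use closure_subset that in blast)
  qed
qed

lemma scaled_threshold_bound:
  assumes "0 < d"
  shows "\<bar>d * soft_threshold (s / d)\<bar> \<le> \<bar>s\<bar> + 2 * d"
proof -
  have "\<bar>d * soft_threshold (s / d)\<bar> = d * \<bar>soft_threshold (s / d)\<bar>" using assms by (simp add: abs_mult)
  also have "\<dots> \<le> d * (\<bar>s / d\<bar> + 2)"
    using soft_threshold_near[of "s / d"] assms by (intro mult_left_mono) linarith+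
  also have "\<dots> = \<bar>s\<bar> + 2 * d" using assms by (simp add: distrib_left)
  finally show ?thesis .
qed

lemma slope_scaled_continuous: "0 < d \<Longrightarrow> continuous_on UNIV (\<lambda>s. threshold_slope (s / d))"
  by (rule continuous_on_compose2[OF threshold_slope_continuous]) (auto intro!: continuous_intros)

lemma soft_scaled_continuous: "0 < d \<Longrightarrow> continuous_on UNIV (\<lambda>s. d * soft_threshold (s / d))"
  by (intro continuous_on_mult_left continuous_on_compose2[OF soft_threshold_continuous])
     (auto intro!: continuous_intros)

lemma one_minus_plateau_continuous: "continuous_on UNIV (\<lambda>s. 1 - plateau s)"
  by (intro continuous_intros plateau_continuous)

lemma slope_mult_bound: "\<bar>threshold_slope s * (1 - plateau t)\<bar> \<le> 1"
proof -
  have "\<bar>threshold_slope s\<bar> * \<bar>1 - plateau t\<bar> \<le> 1 * 1"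
    using threshold_slope_bounds(3)[of s] plateau_bounds(1,2)[of t] by (intro mult_mono) auto
  then show ?thesis by (simp add: abs_mult)
qed

lemma soft_mult_bound:
  assumes "0 < d" "\<bar>s\<bar> \<le> B"
  shows "\<bar>d * soft_threshold (s / d) * plateau' t\<bar> \<le> (B + 2 * d) * 4"
  unfolding abs_mult[of "d * soft_threshold (s / d)"]
  using scaled_threshold_bound[OF assms(1), of s] plateau'_bound[of t] assms by (intro mult_mono) auto

text \<open>The test function is the truncation of the mollified \<open>W\<close> times \<open>1 - plateau\<close> of the mollified \<open>u\<close>:
  the first factor vanishes near the boundary points where \<open>V\<close> is small, the second one near the others.\<close>

lemma truncated_orthogonality:
  assumes d: "0 < d"
    and u: "capacity_witness {x \<in> frontier \<Omega>. V x \<noteq> 0} e u g U"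
  shows "(\<Sum>i\<in>UNIV. (LINT x|lebesgue_on \<Omega>. (threshold_slope (V x / d) * (1 - plateau (u x))) * G i x * c i x)
      - (LINT x|lebesgue_on \<Omega>. (d * soft_threshold (V x / d) * plateau' (u x)) * g i x * c i x)) = 0"
proof -
  have uq: "sq_integrable lebesgue u" and g: "\<And>i. sq_integrable lebesgue (g i)"
    and wpu: "\<And>i. is_weak_partial UNIV i u (g i)" and U: "open U" "{x \<in> frontier \<Omega>. V x \<noteq> 0} \<subseteq> U"
    and uU: "AE x in lebesgue. x \<in> U \<longrightarrow> 1 \<le> u x"
    using u by (auto simp: capacity_witness_def)
  define q where "q n = 1 / real (Suc n)" for n
  have q: "\<And>n. 0 < q n" "q \<longlonglongrightarrow> 0"
    using LIMSEQ_Suc[OF lim_1_over_n] by (auto simp: q_def[abs_def])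
  \<comment> \<open>Along this subsequence the mollified u converges almost everywhere; for W the
    bound \<open>VC\<close> gives convergence at every point.\<close>
  obtain s where s: "strict_mono s" "AE x in lebesgue. (\<lambda>n. conv u (moll (q (s n))) x) \<longlonglongrightarrow> u x"
    using conv_moll_AE_subseq[OF uq q] by blast
  define r where "r n = q (s n)" for n
  have r: "0 < r n" "r \<longlonglongrightarrow> 0" for n
    using q LIMSEQ_subseq_LIMSEQ[OF q(2) s(1)] by (simp_all add: r_def[abs_def] o_def)
  have r1: "r n \<le> 1" for n by (simp add: r_def q_def)
  define A where "A n = conv W (moll (r n))" for n
  define B where "B n = conv u (moll (r n))" for n
  have Blim: "AE x in lebesgue. (\<lambda>n. B n x) \<longlonglongrightarrow> u x" using s(2) by (simp add: B_def r_def)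
  have Ar: "\<bar>A n x - V x\<bar> \<le> C * sqrt (r n)" for n x unfolding A_def by (rule VC[OF r(1)])
  have Cr: "(\<lambda>n. C * sqrt (r n)) \<longlonglongrightarrow> 0"
    by (rule tendsto_mult_right_zero[OF tendsto_real_sqrt[OF r(2), unfolded real_sqrt_zero]])
  have Alim: "(\<lambda>n. A n x) \<longlonglongrightarrow> V x" for x
  proof -
    have "(\<lambda>n. A n x - V x) \<longlonglongrightarrow> 0"
      by (rule Lim_null_comparison[OF _ Cr]) (simp add: Ar)
    then show ?thesis by (simp add: LIM_zero_iff)
  qed
  have A1: "C_k (Suc 0) (A n)" and B1: "C_k (Suc 0) (B n)" for n
    unfolding A_def B_def by (rule conv_C_k[OF _ moll_test_function[OF r(1)]], fact W uq)+
  have Ap: "partial i (A n) = conv (G i) (moll (r n))" for i n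
    unfolding A_def conv_partial(1)[OF W test_functionsD(1,3)[OF moll_test_function[OF r(1)]]]
    by (rule conv_weak_partial[OF wp moll_test_function[OF r(1)]])
  have Bp: "partial i (B n) = conv (g i) (moll (r n))" for i n
    unfolding B_def conv_partial(1)[OF uq test_functionsD(1,3)[OF moll_test_function[OF r(1)]]]
    by (rule conv_weak_partial[OF wpu moll_test_function[OF r(1)]])
  have Am: "A n \<in> borel_measurable lebesgue" and Bm: "B n \<in> borel_measurable lebesgue" for n
    by (rule continuous_lebesgue_measurable[OF C_k_1D(3)], fact A1 B1)+
  let ?T = "\<lambda>s. d * soft_threshold (s / d)" and ?T' = "\<lambda>s. threshold_slope (s / d)"
  let ?a = "\<lambda>n x. ?T' (A n x) * (1 - plateau (B n x))"
  let ?b = "\<lambda>n x. ?T (A n x) * plateau' (B n x)"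
  define f where "f n x = ?T (A n x) * (1 - plateau (B n x))" for n x
  have dT: "((\<lambda>x. ?T (A n x)) has_derivative (\<lambda>h. (\<Sum>j\<in>UNIV. h $ j * partial j (A n) x) * ?T' (A n x))) (at x)" for n x
    by (rule DERIV_compose_FDERIV[OF scaled_threshold_has_derivative[OF d] has_derivative_partial[OF C_k_1D(1)[OF A1]]])
  have dP: "((\<lambda>x. 1 - plateau (B n x)) has_derivative (\<lambda>h. - ((\<Sum>j\<in>UNIV. h $ j * partial j (B n) x) * plateau' (B n x)))) (at x)" for n x
    using has_derivative_diff[OF has_derivative_const[of 1]
        DERIV_compose_FDERIV[OF plateau_has_derivative has_derivative_partial[OF C_k_1D(1)[OF B1]]], of n x] by simp
  have fp: "partial i (f n) = (\<lambda>x. ?a n x * partial i (A n) x - ?b n x * partial i (B n) x)" for i n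
  proof
    fix x
    have "partial i (f n) x = ?T (A n x) * partial i (\<lambda>x. 1 - plateau (B n x)) x
        + partial i (\<lambda>x. ?T (A n x)) x * (1 - plateau (B n x))"
      unfolding f_def by (rule partial_mult[OF differentiableI[OF dT] differentiableI[OF dP]])
    also have "partial i (\<lambda>x. 1 - plateau (B n x)) x = - (partial i (B n) x * plateau' (B n x))"
      by (subst partial_eq[OF dP]) (simp add: axis_def if_distrib [of "\<lambda>z. z * _"] cong: if_cong)
    also have "partial i (\<lambda>x. ?T (A n x)) x = partial i (A n) x * ?T' (A n x)"
      by (subst partial_eq[OF dT]) (simp add: axis_def if_distrib [of "\<lambda>z. z * _"] cong: if_cong)
    finally show "partial i (f n) x = ?a n x * partial i (A n) x - ?b n x * partial i (B n) x"
      by (simp add: mult_ac)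
  qed
  have cc: "continuous_on UNIV (\<lambda>x. H (v x))" if "continuous_on UNIV H" "continuous_on UNIV v"
    for H :: "real \<Rightarrow> real" and v :: scalar_field
    by (rule continuous_on_compose2[OF that]) simp
  have f1: "C_k (Suc 0) (f n)" for n
  proof -
    have "continuous_on UNIV (partial i (f n))" for i
      unfolding fp
      by (intro continuous_on_diff continuous_on_mult
          cc[OF slope_scaled_continuous[OF d] C_k_1D(3)[OF A1]] cc[OF soft_scaled_continuous[OF d] C_k_1D(3)[OF A1]]
          cc[OF one_minus_plateau_continuous C_k_1D(3)[OF B1]] cc[OF plateau'_continuous C_k_1D(3)[OF B1]]
          C_k_1D(2)[OF A1] C_k_1D(2)[OF B1])
    moreover have "f n differentiable (at x)" for x
      unfolding f_def by (rule differentiableI[OF has_derivative_mult[OF dT dP]])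
    ultimately show ?thesis by simp
  qed
  let ?K = "{x \<in> frontier \<Omega>. d / 2 \<le> \<bar>V x\<bar>}"
  have "closed {x. d / 2 \<le> \<bar>V x\<bar>}"
    by (intro closed_Collect_le continuous_intros V(1))
  then have K: "compact ?K"
    using compact_Int_closed[OF compact_frontier_bounded[OF \<Omega>(2)]] by (simp add: Collect_conj_eq)
  have "?K \<subseteq> U" using U(2) d by auto
  then obtain \<rho> where \<rho>: "0 < \<rho>" "(\<Union>x\<in>?K. cball x \<rho>) \<subseteq> U"
    using compact_subset_open_imp_cball_epsilon_subset[OF K U(1)] by blast
  have ev: "\<forall>\<^sub>F n in sequentially. (\<Sum>i\<in>UNIV. (LINT x|lebesgue_on \<Omega>. ?a n x * partial i (A n) x * c i x)
      - (LINT x|lebesgue_on \<Omega>. ?b n x * partial i (B n) x * c i x)) = 0"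
  proof -
    have "\<forall>\<^sub>F n in sequentially. C * sqrt (r n) < d / 2 \<and> r n < \<rho> / 2"
      using order_tendstoD(2)[OF Cr, of "d / 2"] order_tendstoD(2)[OF r(2), of "\<rho> / 2"] d \<rho>(1)
      by (auto intro: eventually_conj)
    then show ?thesis
    proof eventually_elim
      fix n assume n: "C * sqrt (r n) < d / 2 \<and> r n < \<rho> / 2"
      \<comment> \<open>\<open>f n\<close> vanishes on both parts of this neighbourhood of the
        boundary: by truncation on the first, and on the second because the mollified u is at least
        1 there. Distance \<rho> / 2 plus a mollification radius below \<rho> / 2 stays within
        \<rho>, hence in U.\<close>
      let ?Q = "{x. \<bar>A n x\<bar> < d} \<union> (\<Union>z\<in>?K. ball z (\<rho> / 2))"
      have Qo: "open ?Q"
        by (intro open_Un open_UN ballI open_ball open_Collect_less continuous_intros C_k_1D(3)[OF A1])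
      have Qf: "frontier \<Omega> \<subseteq> ?Q"
      proof
        fix z assume z: "z \<in> frontier \<Omega>"
        show "z \<in> ?Q"
        proof (cases "d / 2 \<le> \<bar>V z\<bar>")
          case True
          then have "z \<in> ?K" "z \<in> ball z (\<rho> / 2)" using z \<rho>(1) by auto
          then show ?thesis by blast
        next
          case False
          then have "\<bar>A n z\<bar> < d" using Ar[of n z] n by linarith
          then show ?thesis by simp
        qed
      qed
      have Q0: "f n x = 0" if x: "x \<in> ?Q" for x
      proof (cases "\<bar>A n x\<bar> < d")
        case True
        then have "\<bar>A n x / d\<bar> \<le> 1" using d by simp
        then show ?thesis by (simp add: f_def soft_threshold_eq_0)
      next
        case False
        then obtain z where z: "z \<in> ?K" "x \<in> ball z (\<rho> / 2)" using x by blast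
        have "cball x (r n) \<subseteq> cball z \<rho>"
        proof
          fix y assume "y \<in> cball x (r n)"
          then show "y \<in> cball z \<rho>" using z(2) n dist_triangle[of z y x] by simp
        qed
        then have sub: "cball x (r n) \<subseteq> U" using \<rho>(2) z(1) by blast
        have "AE y in lebesgue. y \<in> cball x (r n) \<longrightarrow> 1 \<le> u y"
          using uU by eventually_elim (use sub in blast)
        then have "1 \<le> B n x" unfolding B_def by (rule conv_moll_ge[OF uq r(1)])
        then show ?thesis by (simp add: f_def plateau_eq_1)
      qed
      let ?\<phi> = "\<lambda>x. if x \<in> \<Omega> then f n x else 0"
      have cut: "C_k (Suc 0) ?\<phi>" "closure {x. ?\<phi> x \<noteq> 0} \<subseteq> \<Omega>"
        "x \<in> \<Omega> \<Longrightarrow> partial i ?\<phi> x = partial i (f n) x" for x i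
        by (rule C1_cut_off[OF f1 \<Omega>(1) Qo Qf]; (rule Q0)?; assumption)+
      have b: "bounded {x. ?\<phi> x \<noteq> 0}" by (rule bounded_subset[OF \<Omega>(2)]) auto
      have zero: "(\<Sum>i\<in>UNIV. LINT x|lebesgue_on \<Omega>. partial i ?\<phi> x * c i x) = 0"
        by (rule C1_test_orthogonality[where c = c and \<phi> = ?\<phi>, OF \<Omega>(1) c orth cut(1) b cut(2)])
      have split: "(LINT x|lebesgue_on \<Omega>. partial i ?\<phi> x * c i x) =
         (LINT x|lebesgue_on \<Omega>. ?a n x * partial i (A n) x * c i x)
         - (LINT x|lebesgue_on \<Omega>. ?b n x * partial i (B n) x * c i x)" for i
      proof -
        obtain M where M: "0 \<le> M" "\<And>x. x \<in> \<Omega> \<Longrightarrow> \<bar>V x\<bar> \<le> M" using V_bounded by blast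
        have bA: "\<bar>?a n x\<bar> \<le> 1" for x by (rule slope_mult_bound)
        have bB: "\<bar>?b n x\<bar> \<le> (M + d / 2 + 2 * d) * 4" if "x \<in> space (lebesgue_on \<Omega>)" for x
        proof (rule soft_mult_bound[OF d])
          have "x \<in> \<Omega>" using that by simp
          then show "\<bar>A n x\<bar> \<le> M + d / 2" using M(2)[of x] Ar[of n x] n by linarith
        qed
        have am: "?a n \<in> borel_measurable (lebesgue_on \<Omega>)"
          by (rule borel_measurable_times[OF compose_measurable[OF slope_scaled_continuous[OF d] Am]
                compose_measurable[OF one_minus_plateau_continuous Bm]])
        have bm: "?b n \<in> borel_measurable (lebesgue_on \<Omega>)"
          by (rule borel_measurable_times[OF compose_measurable[OF soft_scaled_continuous[OF d] Am]
                compose_measurable[OF plateau'_continuous Bm]])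
        have pA: "sq_integrable (lebesgue_on \<Omega>) (partial i (A n))"
          unfolding Ap by (rule sq_integrable_restrict[OF conv_moll_L2(1)[OF G r(1)] \<Omega>_lebesgue])
        have pB: "sq_integrable (lebesgue_on \<Omega>) (partial i (B n))"
          unfolding Bp by (rule sq_integrable_restrict[OF conv_moll_L2(1)[OF g r(1)] \<Omega>_lebesgue])
        have qa: "sq_integrable (lebesgue_on \<Omega>) (\<lambda>x. ?a n x * partial i (A n) x)"
          by (rule sq_integrable_bounded_mult[OF pA am]) (rule bA)
        have qb: "sq_integrable (lebesgue_on \<Omega>) (\<lambda>x. ?b n x * partial i (B n) x)"
          by (rule sq_integrable_bounded_mult[OF pB bm]) (rule bB)
        have "(LINT x|lebesgue_on \<Omega>. partial i ?\<phi> x * c i x) =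
          (LINT x|lebesgue_on \<Omega>. ?a n x * partial i (A n) x * c i x - ?b n x * partial i (B n) x * c i x)"
        proof (rule Bochner_Integration.integral_cong[OF refl])
          fix x assume "x \<in> space (lebesgue_on \<Omega>)"
          then have "x \<in> \<Omega>" by simp
          have "partial i ?\<phi> x = ?a n x * partial i (A n) x - ?b n x * partial i (B n) x"
            unfolding cut(3)[OF \<open>x \<in> \<Omega>\<close>] fp by (rule refl)
          then show "partial i ?\<phi> x * c i x = ?a n x * partial i (A n) x * c i x - ?b n x * partial i (B n) x * c i x"
            by (simp only: left_diff_distrib)
        qed
        also have "\<dots> = (LINT x|lebesgue_on \<Omega>. ?a n x * partial i (A n) x * c i x)
         - (LINT x|lebesgue_on \<Omega>. ?b n x * partial i (B n) x * c i x)"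
          by (rule Bochner_Integration.integral_diff[OF sq_integrable_mult[OF qa c] sq_integrable_mult[OF qb c]])
        finally show ?thesis .
      qed
      from zero show "(\<Sum>i\<in>UNIV. (LINT x|lebesgue_on \<Omega>. ?a n x * partial i (A n) x * c i x)
        - (LINT x|lebesgue_on \<Omega>. ?b n x * partial i (B n) x * c i x)) = 0" unfolding split .
    qed
  qed
  have Hlim: "(\<lambda>n. H (v n)) \<longlonglongrightarrow> H l" if "continuous_on UNIV H" "v \<longlonglongrightarrow> l" for H :: "real \<Rightarrow> real" and v l
    using continuous_on_tendsto_compose[OF that] by simp
  have lA: "(\<lambda>n. LINT x|lebesgue_on \<Omega>. ?a n x * partial i (A n) x * c i x)
      \<longlonglongrightarrow> (LINT x|lebesgue_on \<Omega>. (?T' (V x) * (1 - plateau (u x))) * G i x * c i x)" for i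
    unfolding Ap
  proof (rule tendsto_integral_bounded_L2[where C = 1, OF _ _ _ _ _ _ _ c])
    show "sq_integrable (lebesgue_on \<Omega>) (conv (G i) (moll (r n)))" for n
      by (rule sq_integrable_restrict[OF conv_moll_L2(1)[OF G r(1)] \<Omega>_lebesgue])
    show "sq_integrable (lebesgue_on \<Omega>) (G i)" by (rule sq_integrable_restrict[OF G \<Omega>_lebesgue])
    show "(\<lambda>n. LINT x|lebesgue_on \<Omega>. (conv (G i) (moll (r n)) x - G i x)\<^sup>2) \<longlonglongrightarrow> 0"
      by (rule L2_tendsto_restrict[OF \<Omega>_lebesgue conv_moll_L2(1)[OF G r(1)] G conv_moll_tendsto_L2[OF G r]])
    show "?a n \<in> borel_measurable (lebesgue_on \<Omega>)" for n
      by (rule borel_measurable_times[OF compose_measurable[OF slope_scaled_continuous[OF d] Am]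
            compose_measurable[OF one_minus_plateau_continuous Bm]])
    show "(\<lambda>x. ?T' (V x) * (1 - plateau (u x))) \<in> borel_measurable (lebesgue_on \<Omega>)"
      by (rule borel_measurable_times[OF compose_measurable[OF slope_scaled_continuous[OF d] V_measurable]
            compose_measurable[OF one_minus_plateau_continuous sq_integrableD(1)[OF uq]]])
    show "\<bar>?a n x\<bar> \<le> 1" for n x by (rule slope_mult_bound)
    show "AE x in lebesgue_on \<Omega>. (\<lambda>n. ?a n x) \<longlonglongrightarrow> ?T' (V x) * (1 - plateau (u x))"
      using restrict_AE[OF Blim]
      by eventually_elim
         (rule tendsto_mult[OF Hlim[OF slope_scaled_continuous[OF d] Alim] Hlim[OF one_minus_plateau_continuous]])
  qed
  have lB: "(\<lambda>n. LINT x|lebesgue_on \<Omega>. ?b n x * partial i (B n) x * c i x)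
      \<longlonglongrightarrow> (LINT x|lebesgue_on \<Omega>. (?T (V x) * plateau' (u x)) * g i x * c i x)" for i
    unfolding Bp
  proof -
    obtain M where M: "0 \<le> M" "\<And>x. x \<in> \<Omega> \<Longrightarrow> \<bar>V x\<bar> \<le> M" using V_bounded by blast
    show "(\<lambda>n. LINT x|lebesgue_on \<Omega>. ?b n x * conv (g i) (moll (r n)) x * c i x)
      \<longlonglongrightarrow> (LINT x|lebesgue_on \<Omega>. (?T (V x) * plateau' (u x)) * g i x * c i x)"
    \<comment> \<open>The bound must not depend on n: all radii are at most 1, so the mollified W
      differs from V by at most |C|.\<close>
    proof (rule tendsto_integral_bounded_L2[where C = "(M + \<bar>C\<bar> + 2 * d) * 4", OF _ _ _ _ _ _ _ c])
      show "sq_integrable (lebesgue_on \<Omega>) (conv (g i) (moll (r n)))" for n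
        by (rule sq_integrable_restrict[OF conv_moll_L2(1)[OF g r(1)] \<Omega>_lebesgue])
      show "sq_integrable (lebesgue_on \<Omega>) (g i)" by (rule sq_integrable_restrict[OF g \<Omega>_lebesgue])
      show "(\<lambda>n. LINT x|lebesgue_on \<Omega>. (conv (g i) (moll (r n)) x - g i x)\<^sup>2) \<longlonglongrightarrow> 0"
        by (rule L2_tendsto_restrict[OF \<Omega>_lebesgue conv_moll_L2(1)[OF g r(1)] g conv_moll_tendsto_L2[OF g r]])
      show "?b n \<in> borel_measurable (lebesgue_on \<Omega>)" for n
        by (rule borel_measurable_times[OF compose_measurable[OF soft_scaled_continuous[OF d] Am]
              compose_measurable[OF plateau'_continuous Bm]])
      show "(\<lambda>x. ?T (V x) * plateau' (u x)) \<in> borel_measurable (lebesgue_on \<Omega>)"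
        by (rule borel_measurable_times[OF compose_measurable[OF soft_scaled_continuous[OF d] V_measurable]
              compose_measurable[OF plateau'_continuous sq_integrableD(1)[OF uq]]])
      show "\<bar>?b n x\<bar> \<le> (M + \<bar>C\<bar> + 2 * d) * 4" if "x \<in> space (lebesgue_on \<Omega>)" for n x
      proof (rule soft_mult_bound[OF d])
        have "x \<in> \<Omega>" using that by simp
        moreover have "C * sqrt (r n) \<le> \<bar>C\<bar> * 1"
          using r(1)[of n] r1[of n] by (intro mult_mono) auto
        ultimately show "\<bar>A n x\<bar> \<le> M + \<bar>C\<bar>" using M(2)[of x] Ar[of n x] by linarith
      qed
      show "AE x in lebesgue_on \<Omega>. (\<lambda>n. ?b n x) \<longlonglongrightarrow> ?T (V x) * plateau' (u x)"
        using restrict_AE[OF Blim]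
        by eventually_elim
           (rule tendsto_mult[OF Hlim[OF soft_scaled_continuous[OF d] Alim] Hlim[OF plateau'_continuous]])
    qed
  qed
  have "(\<lambda>n. \<Sum>i\<in>UNIV. (LINT x|lebesgue_on \<Omega>. ?a n x * partial i (A n) x * c i x)
      - (LINT x|lebesgue_on \<Omega>. ?b n x * partial i (B n) x * c i x)) \<longlonglongrightarrow>
    (\<Sum>i\<in>UNIV. (LINT x|lebesgue_on \<Omega>. (?T' (V x) * (1 - plateau (u x))) * G i x * c i x)
      - (LINT x|lebesgue_on \<Omega>. (?T (V x) * plateau' (u x)) * g i x * c i x))"
    by (intro tendsto_sum tendsto_diff lA lB)
  from LIMSEQ_unique[OF this tendsto_eventually[OF ev]] show ?thesis .
qed

text \<open>Competitors for the exceptional set with H^1 norm tending to 0 are inserted in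
  \<open>truncated_orthogonality\<close>. Along a subsequence they tend to 0 almost everywhere, so
  \<open>1 - plateau\<close> tends to 1 in the first integrals; the second ones tend to 0 because
  \<open>plateau'\<close> is 0 at 0 and the gradients of the competitors tend to 0 in L^2.\<close>

lemma threshold_orthogonality:
  assumes cap: "capacity {x \<in> frontier \<Omega>. V x \<noteq> 0} = 0" and d: "0 < d"
  shows "(\<Sum>i\<in>UNIV. LINT x|lebesgue_on \<Omega>. threshold_slope (V x / d) * G i x * c i x) = 0"
proof -
  let ?N = "{x \<in> frontier \<Omega>. V x \<noteq> 0}"
  define e where "e n = 1 / real (Suc n)" for n
  have e: "\<And>n. 0 < e n" "e \<longlonglongrightarrow> 0"
    using LIMSEQ_Suc[OF lim_1_over_n] by (auto simp: e_def[abs_def])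
  have "\<forall>n. \<exists>u g U. capacity_witness ?N (e n) u g U"
    using capacity_witnessI[OF cap e(1)] by metis
  then obtain u0 g0 U0 where w0: "\<And>n. capacity_witness ?N (e n) (u0 n) (g0 n) (U0 n)"
    unfolding choice_iff by blast
  have sum_le: "(LINT x|lebesgue. (u0 n x)\<^sup>2) \<le> e n" "(LINT x|lebesgue. (g0 n i x)\<^sup>2) \<le> e n" for n i
  proof -
    have t: "(LINT x|lebesgue. (u0 n x)\<^sup>2) + (\<Sum>i\<in>UNIV. LINT x|lebesgue. (g0 n i x)\<^sup>2) < e n"
      using w0[of n] by (simp add: capacity_witness_def)
    have s: "0 \<le> (\<Sum>i\<in>UNIV. LINT x|lebesgue. (g0 n i x)\<^sup>2)" by (intro sum_nonneg) simp
    have m: "(LINT x|lebesgue. (g0 n i x)\<^sup>2) \<le> (\<Sum>i\<in>UNIV. LINT x|lebesgue. (g0 n i x)\<^sup>2)"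
      by (rule member_le_sum) auto
    have z: "0 \<le> (LINT x|lebesgue. (u0 n x)\<^sup>2)" by simp
    show "(LINT x|lebesgue. (u0 n x)\<^sup>2) \<le> e n" "(LINT x|lebesgue. (g0 n i x)\<^sup>2) \<le> e n"
      using t s m z by linarith+
  qed
  have u0: "sq_integrable lebesgue (u0 n)" "sq_integrable lebesgue (g0 n i)" for n i
    using w0[of n] by (auto simp: capacity_witness_def)
  have lim0: "(\<lambda>n. LINT x|lebesgue. (u0 n x)\<^sup>2) \<longlonglongrightarrow> 0" "(\<lambda>n. LINT x|lebesgue. (g0 n i x)\<^sup>2) \<longlonglongrightarrow> 0" for i
    by (rule Lim_null_comparison[OF _ e(2)], simp add: sum_le)+
  have "\<exists>s. strict_mono s \<and> (AE x in lebesgue. (\<lambda>n. (u0 (s n) x)\<^sup>2) \<longlonglongrightarrow> 0)"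
    by (rule tendsto_L1_AE_subseq[OF sq_integrableD(2)[OF u0(1)]]) (simp add: lim0)
  then obtain s where s: "strict_mono s" "AE x in lebesgue. (\<lambda>n. (u0 (s n) x)\<^sup>2) \<longlonglongrightarrow> 0" by blast
  define u where "u n = u0 (s n)" for n
  define g where "g n = g0 (s n)" for n
  have ulim: "AE x in lebesgue. (\<lambda>n. u n x) \<longlonglongrightarrow> 0"
    using s(2)
  proof eventually_elim
    fix x assume "(\<lambda>n. (u0 (s n) x)\<^sup>2) \<longlonglongrightarrow> 0"
    from tendsto_real_sqrt[OF this] show "(\<lambda>n. u n x) \<longlonglongrightarrow> 0"
      by (simp add: u_def tendsto_rabs_zero_iff)
  qed
  have glim: "(\<lambda>n. LINT x|lebesgue. (g n i x - 0)\<^sup>2) \<longlonglongrightarrow> 0" for i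
    using LIMSEQ_subseq_LIMSEQ[OF lim0(2)[of i] s(1)] by (simp add: g_def o_def)
  have um: "u n \<in> borel_measurable lebesgue" for n unfolding u_def by (rule sq_integrableD(1)[OF u0(1)])
  have gq: "sq_integrable lebesgue (g n i)" for n i unfolding g_def by (rule u0(2))
  have zero: "(\<Sum>i\<in>UNIV. (LINT x|lebesgue_on \<Omega>. (threshold_slope (V x / d) * (1 - plateau (u n x))) * G i x * c i x)
      - (LINT x|lebesgue_on \<Omega>. (d * soft_threshold (V x / d) * plateau' (u n x)) * g n i x * c i x)) = 0" for n
    unfolding u_def g_def by (rule truncated_orthogonality[OF d w0])
  have Hlim: "(\<lambda>n. H (v n)) \<longlonglongrightarrow> H l" if "continuous_on UNIV H" "v \<longlonglongrightarrow> l" for H :: "real \<Rightarrow> real" and v l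
    using continuous_on_tendsto_compose[OF that] by simp
  have p0: "plateau 0 = 0" by (simp add: plateau_def)
  have lA: "(\<lambda>n. LINT x|lebesgue_on \<Omega>. (threshold_slope (V x / d) * (1 - plateau (u n x))) * G i x * c i x)
      \<longlonglongrightarrow> (LINT x|lebesgue_on \<Omega>. threshold_slope (V x / d) * G i x * c i x)" for i
  proof (rule tendsto_integral_bounded_L2[where C = 1, OF _ _ _ _ _ _ _ c])
    show "sq_integrable (lebesgue_on \<Omega>) (G i)" "sq_integrable (lebesgue_on \<Omega>) (G i)"
      by (rule sq_integrable_restrict[OF G \<Omega>_lebesgue])+
    show "(\<lambda>n. LINT x|lebesgue_on \<Omega>. (G i x - G i x)\<^sup>2) \<longlonglongrightarrow> 0" by simp
    show "(\<lambda>x. threshold_slope (V x / d) * (1 - plateau (u n x))) \<in> borel_measurable (lebesgue_on \<Omega>)" for n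
      by (rule borel_measurable_times[OF compose_measurable[OF slope_scaled_continuous[OF d] V_measurable]
            compose_measurable[OF one_minus_plateau_continuous um]])
    show "(\<lambda>x. threshold_slope (V x / d)) \<in> borel_measurable (lebesgue_on \<Omega>)"
      by (rule compose_measurable[OF slope_scaled_continuous[OF d] V_measurable])
    show "\<bar>threshold_slope (V x / d) * (1 - plateau (u n x))\<bar> \<le> 1" for n x by (rule slope_mult_bound)
    show "AE x in lebesgue_on \<Omega>. (\<lambda>n. threshold_slope (V x / d) * (1 - plateau (u n x))) \<longlonglongrightarrow> threshold_slope (V x / d)"
      using restrict_AE[OF ulim]
    proof eventually_elim
      fix x assume "(\<lambda>n. u n x) \<longlonglongrightarrow> 0"
      from tendsto_mult[OF tendsto_const Hlim[OF one_minus_plateau_continuous this]]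
      have "(\<lambda>n. threshold_slope (V x / d) * (1 - plateau (u n x))) \<longlonglongrightarrow> threshold_slope (V x / d) * (1 - plateau 0)" .
      then show "(\<lambda>n. threshold_slope (V x / d) * (1 - plateau (u n x))) \<longlonglongrightarrow> threshold_slope (V x / d)"
        by (simp add: p0)
    qed
  qed
  \<comment> \<open>The limit is written as 0 * 0 * c to match the shape a' * f' * c of
    \<open>tendsto_integral_bounded_L2\<close>.\<close>
  have lB: "(\<lambda>n. LINT x|lebesgue_on \<Omega>. (d * soft_threshold (V x / d) * plateau' (u n x)) * g n i x * c i x)
      \<longlonglongrightarrow> (LINT x|lebesgue_on \<Omega>. 0 * 0 * c i x)" for i
  proof -
    obtain M where M: "0 \<le> M" "\<And>x. x \<in> \<Omega> \<Longrightarrow> \<bar>V x\<bar> \<le> M" using V_bounded by blast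
    show ?thesis
    proof (rule tendsto_integral_bounded_L2[where C = "(M + 2 * d) * 4", OF _ _ _ _ _ _ _ c])
      show "sq_integrable (lebesgue_on \<Omega>) (g n i)" for n by (rule sq_integrable_restrict[OF gq \<Omega>_lebesgue])
      show "sq_integrable (lebesgue_on \<Omega>) (\<lambda>x. 0)" by simp
      show "(\<lambda>n. LINT x|lebesgue_on \<Omega>. (g n i x - 0)\<^sup>2) \<longlonglongrightarrow> 0"
        by (rule L2_tendsto_restrict[OF \<Omega>_lebesgue gq sq_integrable_zero glim])
      show "(\<lambda>x. d * soft_threshold (V x / d) * plateau' (u n x)) \<in> borel_measurable (lebesgue_on \<Omega>)" for n
        by (rule borel_measurable_times[OF compose_measurable[OF soft_scaled_continuous[OF d] V_measurable]
              compose_measurable[OF plateau'_continuous um]])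
      show "(\<lambda>x. 0) \<in> borel_measurable (lebesgue_on \<Omega>)" by simp
      show "\<bar>d * soft_threshold (V x / d) * plateau' (u n x)\<bar> \<le> (M + 2 * d) * 4" if "x \<in> space (lebesgue_on \<Omega>)" for n x
        by (rule soft_mult_bound[OF d M(2)]) (use that in simp)
      show "AE x in lebesgue_on \<Omega>. (\<lambda>n. d * soft_threshold (V x / d) * plateau' (u n x)) \<longlonglongrightarrow> 0"
        using restrict_AE[OF ulim]
      proof eventually_elim
        fix x assume "(\<lambda>n. u n x) \<longlonglongrightarrow> 0"
        from tendsto_mult[OF tendsto_const Hlim[OF plateau'_continuous this]]
        have "(\<lambda>n. d * soft_threshold (V x / d) * plateau' (u n x)) \<longlonglongrightarrow> d * soft_threshold (V x / d) * plateau' 0" .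
        then show "(\<lambda>n. d * soft_threshold (V x / d) * plateau' (u n x)) \<longlonglongrightarrow> 0" by simp
      qed
    qed
  qed
  have "(\<lambda>n. \<Sum>i\<in>UNIV. (LINT x|lebesgue_on \<Omega>. (threshold_slope (V x / d) * (1 - plateau (u n x))) * G i x * c i x)
      - (LINT x|lebesgue_on \<Omega>. (d * soft_threshold (V x / d) * plateau' (u n x)) * g n i x * c i x)) \<longlonglongrightarrow>
    (\<Sum>i\<in>UNIV. (LINT x|lebesgue_on \<Omega>. threshold_slope (V x / d) * G i x * c i x) - (LINT x|lebesgue_on \<Omega>. 0 * 0 * c i x))"
    by (intro tendsto_sum tendsto_diff lA lB)
  from LIMSEQ_unique[OF this[unfolded zero] tendsto_const]
  show ?thesis by simp
qed

text \<open>Letting d tend to 0 restricts the integrals to V \<noteq> 0, which changes nothing by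
  \<open>weak_partial_vanishes_on_zero_set\<close>.\<close>

lemma gradient_orthogonal:
  assumes cap: "capacity {x \<in> frontier \<Omega>. V x \<noteq> 0} = 0"
  shows "(\<Sum>i\<in>UNIV. LINT x|lebesgue_on \<Omega>. G i x * c i x) = 0"
proof -
  let ?d = "\<lambda>n. 1 / real (Suc n)"
  let ?I = "\<lambda>x. if V x = 0 then 0 else 1 :: real"
  have Im: "?I \<in> borel_measurable (lebesgue_on \<Omega>)"
    by (rule restrict_measurable) (use V_measurable in measurable)
  have l: "(\<lambda>n. LINT x|lebesgue_on \<Omega>. threshold_slope (V x / ?d n) * G i x * c i x)
      \<longlonglongrightarrow> (LINT x|lebesgue_on \<Omega>. ?I x * G i x * c i x)" for i
  proof (rule tendsto_integral_bounded_L2[where C = 1, OF _ _ _ _ Im _ _ c])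
    show "sq_integrable (lebesgue_on \<Omega>) (G i)" "sq_integrable (lebesgue_on \<Omega>) (G i)"
      by (rule sq_integrable_restrict[OF G \<Omega>_lebesgue])+
    show "(\<lambda>n. LINT x|lebesgue_on \<Omega>. (G i x - G i x)\<^sup>2) \<longlonglongrightarrow> 0" by simp
    show "(\<lambda>x. threshold_slope (V x / ?d n)) \<in> borel_measurable (lebesgue_on \<Omega>)" for n
      by (rule compose_measurable[OF slope_scaled_continuous V_measurable]) simp
    show "\<bar>threshold_slope (V x / ?d n)\<bar> \<le> 1" for n x by (rule threshold_slope_bounds)
    show "AE x in lebesgue_on \<Omega>. (\<lambda>n. threshold_slope (V x / ?d n)) \<longlonglongrightarrow> ?I x"
      by (intro AE_I2 threshold_slope_tendsto)
  qed
  have z: "(\<Sum>i\<in>UNIV. LINT x|lebesgue_on \<Omega>. threshold_slope (V x / ?d n) * G i x * c i x) = 0" for n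
    by (rule threshold_orthogonality[OF cap]) simp
  have "(\<lambda>n. \<Sum>i\<in>UNIV. LINT x|lebesgue_on \<Omega>. threshold_slope (V x / ?d n) * G i x * c i x)
    \<longlonglongrightarrow> (\<Sum>i\<in>UNIV. LINT x|lebesgue_on \<Omega>. ?I x * G i x * c i x)"
    by (intro tendsto_sum l)
  from LIMSEQ_unique[OF this[unfolded z] tendsto_const]
  have "(\<Sum>i\<in>UNIV. LINT x|lebesgue_on \<Omega>. ?I x * G i x * c i x) = 0" .
  moreover have "(LINT x|lebesgue_on \<Omega>. ?I x * G i x * c i x) = (LINT x|lebesgue_on \<Omega>. G i x * c i x)" for i
  proof (rule integral_cong_AE)
    have Gm: "G i \<in> borel_measurable (lebesgue_on \<Omega>)"
      by (rule restrict_measurable[OF sq_integrableD(1)[OF G]])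
    show "(\<lambda>x. ?I x * G i x * c i x) \<in> borel_measurable (lebesgue_on \<Omega>)"
      by (intro borel_measurable_times Im Gm sq_integrableD(1)[OF c])
    show "(\<lambda>x. G i x * c i x) \<in> borel_measurable (lebesgue_on \<Omega>)"
      by (intro borel_measurable_times Gm sq_integrableD(1)[OF c])
    have "AE x in lebesgue. V x = 0 \<longrightarrow> G i x = 0"
      using V(2) weak_partial_vanishes_on_zero_set[OF W G wp, of i] by eventually_elim auto
    from restrict_AE[OF this]
    show "AE x in lebesgue_on \<Omega>. ?I x * G i x * c i x = G i x * c i x"
      by eventually_elim auto
  qed
  ultimately show ?thesis by simp
qed

end

section \<open>The tangential gradient\<close>

text \<open>Averages do not see null sets, so v may be replaced by V, which is continuous at x. They
  are quotients by a positive number because x is a boundary point of the open \<Omega>: every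
  intersection with a ball around x is open and nonempty.\<close>

lemma average_tendsto:
  fixes V v :: scalar_field
  assumes \<Omega>: "open \<Omega>" and V: "continuous_on UNIV V"
    and v: "v \<in> borel_measurable (lebesgue_on \<Omega>)" "AE y in lebesgue_on \<Omega>. v y = V y"
    and x: "x \<in> frontier \<Omega>"
  shows "((\<lambda>r. (LINT y|lebesgue_on (\<Omega> \<inter> ball x r). v y) / measure lebesgue (\<Omega> \<inter> ball x r))
    \<longlongrightarrow> V x) (at_right 0)"
proof (rule tendstoI)
  fix e :: real assume "0 < e"
  then have e: "0 < e / 2" by simp
  have "isCont V x" using V by (simp add: continuous_on_eq_continuous_at)
  then obtain d where d: "0 < d" "\<And>y. dist y x < d \<Longrightarrow> dist (V y) (V x) < e / 2"
    using e unfolding continuous_at_eps_delta by blast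
  have main: "dist ((LINT y|lebesgue_on (\<Omega> \<inter> ball x r). v y) / measure lebesgue (\<Omega> \<inter> ball x r)) (V x) < e"
    if r: "0 < r" "r < d" for r
  proof -
    let ?S = "\<Omega> \<inter> ball x r" and ?m = "measure lebesgue (\<Omega> \<inter> ball x r)"
    have So: "open ?S" using \<Omega> by auto
    have Sl: "?S \<in> lmeasurable" by (rule lmeasurable_open[OF _ So]) (simp add: bounded_Int)
    have Ss: "?S \<in> sets lebesgue" using Sl by blast
    have ne: "?S \<noteq> {}"
      using x r(1) frontier_straddle[of x \<Omega>] by (force simp: dist_commute)
    have "\<not> negligible ?S" by (rule open_not_negligible[OF So ne])
    then have m0: "0 < ?m" using Sl negligible_iff_measure0 measure_nonneg[of lebesgue ?S]
      by (metis less_eq_real_def)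
    have Vb: "V x - e / 2 \<le> V y" "V y \<le> V x + e / 2" if "y \<in> ?S" for y
    proof -
      have "dist y x < d" using that r(2) by (simp add: dist_commute)
      then have "\<bar>V y - V x\<bar> < e / 2" using d(2) by (simp add: dist_real_def[symmetric])
      then show "V x - e / 2 \<le> V y" "V y \<le> V x + e / 2" by linarith+
    qed
    have fin: "finite_measure (lebesgue_on ?S)"
      using Sl by (rule finite_measure_lebesgue_on)
    have Vm: "V \<in> borel_measurable (lebesgue_on ?S)"
      by (rule measurable_restrict_space1[OF continuous_lebesgue_measurable[OF V]])
    have Vi: "integrable (lebesgue_on ?S) V"
    proof (rule finite_measure.integrable_const_bound[OF fin _ Vm, where B = "\<bar>V x\<bar> + e / 2"])
      have "\<bar>V y\<bar> \<le> \<bar>V x\<bar> + e / 2" if "y \<in> ?S" for y using Vb[OF that] by linarith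
      then show "AE y in lebesgue_on ?S. norm (V y) \<le> \<bar>V x\<bar> + e / 2"
        using Ss by (intro AE_I2) simp
    qed
    have ci: "integrable (lebesgue_on ?S) (\<lambda>y. a)" for a :: real
      by (rule finite_measure.integrable_const[OF fin])
    have cm: "(LINT y|lebesgue_on ?S. a) = ?m * a" for a :: real
      using Ss by (simp add: measure_restrict_space)
    have "AE y in lebesgue. y \<in> \<Omega> \<longrightarrow> v y = V y"
      using v(2) open_lebesgue[OF \<Omega>] by (simp add: AE_restrict_space_iff)
    then have "AE y in lebesgue. y \<in> ?S \<longrightarrow> v y = V y" by eventually_elim simp
    then have ae: "AE y in lebesgue_on ?S. v y = V y" using Ss by (simp add: AE_restrict_space_iff)
    have vm: "v \<in> borel_measurable (lebesgue_on ?S)"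
      by (rule measurable_restrict_mono[OF v(1)]) simp
    have eq: "(LINT y|lebesgue_on ?S. v y) = (LINT y|lebesgue_on ?S. V y)"
      by (rule integral_cong_AE[OF vm Vm ae])
    have "?m * (V x - e / 2) \<le> (LINT y|lebesgue_on ?S. V y)"
      unfolding cm[symmetric] using Vb by (intro integral_mono ci Vi) simp
    moreover have "(LINT y|lebesgue_on ?S. V y) \<le> ?m * (V x + e / 2)"
      unfolding cm[symmetric] using Vb by (intro integral_mono ci Vi) simp
    ultimately have "V x - e / 2 \<le> (LINT y|lebesgue_on ?S. v y) / ?m"
      "(LINT y|lebesgue_on ?S. v y) / ?m \<le> V x + e / 2"
      using m0 by (simp_all add: eq pos_le_divide_eq pos_divide_le_eq mult.commute)
    then have "\<bar>(LINT y|lebesgue_on ?S. v y) / ?m - V x\<bar> < e" using \<open>0 < e\<close> by linarith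
    then show ?thesis by (simp only: dist_real_def)
  qed
  show "\<forall>\<^sub>F r in at_right 0. dist ((LINT y|lebesgue_on (\<Omega> \<inter> ball x r). v y) / measure lebesgue (\<Omega> \<inter> ball x r)) (V x) < e"
    unfolding eventually_at_right_field using d(1) main by blast
qed

text \<open>The averages converge to V at every boundary point, so by uniqueness of limits the
  exceptional set of a trace f is exactly the set where f differs from V.\<close>

lemma has_trace_iff:
  assumes "open \<Omega>" "continuous_on UNIV V"
    "v \<in> borel_measurable (lebesgue_on \<Omega>)" "AE y in lebesgue_on \<Omega>. v y = V y"
  shows "has_trace \<Omega> v f \<longleftrightarrow> capacity {x \<in> frontier \<Omega>. f x \<noteq> V x} = 0"
proof -
  let ?L = "\<lambda>x r. (LINT y|lebesgue_on (\<Omega> \<inter> ball x r). v y) / measure lebesgue (\<Omega> \<inter> ball x r)"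
  have "(?L x \<longlongrightarrow> f x) (at_right 0) \<longleftrightarrow> f x = V x" if "x \<in> frontier \<Omega>" for x
  proof
    assume "(?L x \<longlongrightarrow> f x) (at_right 0)"
    from tendsto_unique[OF trivial_limit_at_right_real this average_tendsto[OF assms that]]
    show "f x = V x" .
  next
    assume "f x = V x"
    then show "(?L x \<longlongrightarrow> f x) (at_right 0)" using average_tendsto[OF assms that] by (simp only:)
  qed
  then have "{x \<in> frontier \<Omega>. \<not> (?L x \<longlongrightarrow> f x) (at_right 0)} = {x \<in> frontier \<Omega>. f x \<noteq> V x}" by auto
  then show ?thesis by (simp add: has_trace_def qe_on_def)
qed

section \<open>Sobolev spaces on an open set\<close>

lemma is_weak_partial_AE_cong:
  assumes "open \<Omega>" "u \<in> borel_measurable (lebesgue_on \<Omega>)" "v \<in> borel_measurable (lebesgue_on \<Omega>)"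
    "AE x in lebesgue_on \<Omega>. u x = v x" "is_weak_partial \<Omega> i u g"
  shows "is_weak_partial \<Omega> i v g"
  unfolding is_weak_partial_def
proof
  fix \<phi> assume \<phi>: "\<phi> \<in> test_functions \<Omega>"
  have m: "partial i \<phi> \<in> borel_measurable (lebesgue_on \<Omega>)"
    by (rule sq_integrableD(1)[OF test_function_sq_integrable[OF test_functions_partial[OF \<phi>] assms(1)]])
  have "(LINT x|lebesgue_on \<Omega>. v x * partial i \<phi> x) = (LINT x|lebesgue_on \<Omega>. u x * partial i \<phi> x)"
  proof (rule integral_cong_AE)
    show "AE x in lebesgue_on \<Omega>. v x * partial i \<phi> x = u x * partial i \<phi> x"
      using assms(4) by eventually_elim simp
  qed (intro borel_measurable_times assms m)+
  then show "(LINT x|lebesgue_on \<Omega>. v x * partial i \<phi> x) = - (LINT x|lebesgue_on \<Omega>. g x * \<phi> x)"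
    using assms(5) \<phi> by (simp add: is_weak_partial_def)
qed

lemma sobolev_AE_cong:
  assumes "open \<Omega>" "u \<in> sobolev k \<Omega>" "v \<in> borel_measurable (lebesgue_on \<Omega>)"
    "AE x in lebesgue_on \<Omega>. u x = v x"
  shows "v \<in> sobolev k \<Omega>"
proof -
  have u: "sq_integrable (lebesgue_on \<Omega>) u" using subsetD[OF sobolev_subset_L2 assms(2)] by (simp add: L2_iff)
  have v: "v \<in> L2 \<Omega>" unfolding L2_iff by (rule sq_integrable_AE_cong[OF u assms(3,4)])
  show ?thesis
  proof (cases k)
    case 0
    then show ?thesis using v by simp
  next
    case (Suc l)
    have "\<exists>g\<in>sobolev l \<Omega>. is_weak_partial \<Omega> i v g" for i
    proof -
      obtain g where "g \<in> sobolev l \<Omega>" "is_weak_partial \<Omega> i u g" using assms(2) by (auto simp: Suc)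
      with is_weak_partial_AE_cong[OF assms(1) sq_integrableD(1)[OF u] assms(3,4)] show ?thesis by blast
    qed
    then show ?thesis using v by (simp add: Suc)
  qed
qed

text \<open>The choice in \<open>weak_partial\<close> only asks for L^2, whereas membership in
  \<open>sobolev (Suc k) \<Omega>\<close> provides some weak derivative in
  \<open>sobolev k \<Omega>\<close>; the two agree almost everywhere.\<close>

lemma weak_partial_in_sobolev:
  assumes "open \<Omega>" "u \<in> sobolev (Suc k) \<Omega>"
  shows "weak_partial \<Omega> i u \<in> sobolev k \<Omega>"
proof -
  obtain g where g: "g \<in> sobolev k \<Omega>" "is_weak_partial \<Omega> i u g" using assms(2) by auto
  note w = weak_partialD[OF assms(2), of i]
  have "weak_partial \<Omega> i u \<in> borel_measurable (lebesgue_on \<Omega>)" using w(1) by (simp add: L2_def)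
  moreover have "AE x in lebesgue_on \<Omega>. g x = weak_partial \<Omega> i u x"
    by (rule weak_partial_unique[OF assms(1) subsetD[OF sobolev_subset_L2 g(1)] w(1) g(2) w(2)])
  ultimately show ?thesis by (rule sobolev_AE_cong[OF assms(1) g(1)])
qed

lemma sobolev_add:
  assumes "open \<Omega>" "u \<in> sobolev k \<Omega>" "v \<in> sobolev k \<Omega>"
  shows "(\<lambda>x. u x + v x) \<in> sobolev k \<Omega>"
  using assms(2,3)
proof (induction k arbitrary: u v)
  case 0
  then show ?case by (simp add: L2_iff sq_integrable_add)
next
  case (Suc k)
  have "\<exists>g\<in>sobolev k \<Omega>. is_weak_partial \<Omega> i (\<lambda>x. u x + v x) g" for i
  proof -
    obtain g where g: "g \<in> sobolev k \<Omega>" "is_weak_partial \<Omega> i u g" using Suc.prems(1) by auto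
    obtain h where h: "h \<in> sobolev k \<Omega>" "is_weak_partial \<Omega> i v h" using Suc.prems(2) by auto
    have "is_weak_partial \<Omega> i (\<lambda>x. u x + v x) (\<lambda>x. g x + h x)"
      by (rule is_weak_partial_add[OF assms(1) subsetD[OF sobolev_subset_L2 Suc.prems(1)]
            subsetD[OF sobolev_subset_L2 Suc.prems(2)] subsetD[OF sobolev_subset_L2 g(1)]
            subsetD[OF sobolev_subset_L2 h(1)] g(2) h(2)])
    with Suc.IH[OF g(1) h(1)] show ?thesis by blast
  qed
  moreover have "(\<lambda>x. u x + v x) \<in> L2 \<Omega>" using Suc.prems by (simp add: L2_iff sq_integrable_add)
  ultimately show ?case by simp
qed

lemma sobolev_cmult:
  assumes "u \<in> sobolev k \<Omega>"
  shows "(\<lambda>x. c * u x) \<in> sobolev k \<Omega>"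
  using assms
proof (induction k arbitrary: u)
  case 0
  then show ?case by (simp add: L2_iff sq_integrable_cmult)
next
  case (Suc k)
  have "\<exists>g\<in>sobolev k \<Omega>. is_weak_partial \<Omega> i (\<lambda>x. c * u x) g" for i
  proof -
    obtain g where g: "g \<in> sobolev k \<Omega>" "is_weak_partial \<Omega> i u g" using Suc.prems by auto
    from Suc.IH[OF g(1)] is_weak_partial_cmult[OF g(2)] show ?thesis by blast
  qed
  moreover have "(\<lambda>x. c * u x) \<in> L2 \<Omega>" using Suc.prems by (simp add: L2_iff sq_integrable_cmult)
  ultimately show ?case by simp
qed

lemma zero_in_sobolev: "(\<lambda>x. 0) \<in> sobolev k \<Omega>"
proof (induction k)
  case 0
  then show ?case by (simp add: L2_iff)
next
  case (Suc k)
  have "is_weak_partial \<Omega> i (\<lambda>x. 0) (\<lambda>x. 0)" for i by (simp add: is_weak_partial_def)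
  with Suc show ?case by (auto simp: L2_iff)
qed

lemma sobolev_inner_nonneg: "0 \<le> sobolev_inner k \<Omega> u u"
  by (induction k arbitrary: u) (auto intro!: add_nonneg_nonneg sum_nonneg)

lemma vsobolev_norm_nonneg: "0 \<le> vsobolev_norm k \<Omega> u"
  unfolding vsobolev_norm_def vsobolev_inner_def
  by (intro real_sqrt_ge_zero sum_nonneg sobolev_inner_nonneg)

lemma weak_grad_in_vsobolev:
  assumes "open \<Omega>" "v \<in> sobolev 2 \<Omega>"
  shows "weak_grad \<Omega> v \<in> vsobolev 1 \<Omega>"
  using weak_partial_in_sobolev[of \<Omega> v 1] assms by (simp add: vsobolev_def weak_grad_def numeral_2_eq_2)

text \<open>\<open>sobolev_inner\<close> recurses through \<open>weak_partial\<close>, so the same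
  representatives occur on both sides and the squared norms differ by the integral of v^2.\<close>

lemma vsobolev_norm_weak_grad_le: "vsobolev_norm 1 \<Omega> (weak_grad \<Omega> v) \<le> sobolev_norm 2 \<Omega> v"
proof -
  have "sobolev_inner 2 \<Omega> v v = (LINT x|lebesgue_on \<Omega>. v x * v x) + vsobolev_inner 1 \<Omega> (weak_grad \<Omega> v) (weak_grad \<Omega> v)"
    by (simp add: vsobolev_inner_def weak_grad_def numeral_2_eq_2)
  moreover have "0 \<le> (LINT x|lebesgue_on \<Omega>. v x * v x)" by simp
  ultimately show ?thesis
    unfolding vsobolev_norm_def sobolev_norm_def by (intro real_sqrt_le_mono) linarith
qed

text \<open>Test functions on \<Omega> vanish outside \<Omega>, so their integrals over \<Omega> and
  over the whole space coincide.\<close>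

lemma is_weak_partial_restrict:
  assumes \<Omega>: "open \<Omega>" and "is_weak_partial UNIV i w g" "sq_integrable lebesgue w"
    and v: "v \<in> borel_measurable (lebesgue_on \<Omega>)" "AE x in lebesgue_on \<Omega>. w x = v x"
  shows "is_weak_partial \<Omega> i v g"
proof (rule is_weak_partial_AE_cong[OF \<Omega> _ v])
  have s: "\<Omega> \<in> sets lebesgue" by (rule open_lebesgue[OF \<Omega>])
  show "w \<in> borel_measurable (lebesgue_on \<Omega>)"
    by (rule sq_integrableD(1)[OF sq_integrable_restrict[OF assms(3) s]])
  have z: "indicator \<Omega> x * (f x * \<phi> x) = f x * \<phi> x" if "\<phi> \<in> test_functions \<Omega>" for f \<phi> :: scalar_field and x
  proof (cases "x \<in> \<Omega>")
    case False
    then have "\<phi> x = 0" using that closure_subset[of "{x. \<phi> x \<noteq> 0}"] by (auto simp: test_functions_def)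
    then show ?thesis by simp
  qed simp
  show "is_weak_partial \<Omega> i w g"
    unfolding is_weak_partial_def integral_lebesgue_on[OF s]
  proof
    fix \<phi> assume \<phi>: "\<phi> \<in> test_functions \<Omega>"
    then have "\<phi> \<in> test_functions UNIV" using test_functions_mono[of \<Omega> UNIV] by blast
    with assms(2) show "(LINT x|lebesgue. indicator \<Omega> x * (w x * partial i \<phi> x)) =
        - (LINT x|lebesgue. indicator \<Omega> x * (g x * \<phi> x))"
      unfolding z[OF \<phi>] z[OF test_functions_partial[OF \<phi>]]
      by (simp add: is_weak_partial_def lebesgue_on_UNIV_eq)
  qed
qed

text \<open>The data that stand for v at the boundary: an extension w, its weak gradient G, its
  continuous representative V and the constant C of the uniform bound. The extension is kept beside
  V because mollification near the boundary uses values outside \<Omega>.\<close>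

definition H2_representative ::
  "(real^3) set \<Rightarrow> scalar_field \<Rightarrow> scalar_field \<Rightarrow> scalar_field \<Rightarrow> (3 \<Rightarrow> scalar_field) \<Rightarrow> real \<Rightarrow> bool" where
  "H2_representative \<Omega> v w V G C \<longleftrightarrow> sq_integrable lebesgue w \<and> (\<forall>i. sq_integrable lebesgue (G i)) \<and>
     (\<forall>i. is_weak_partial UNIV i w (G i)) \<and> continuous_on UNIV V \<and> (AE x in lebesgue. w x = V x) \<and>
     (\<forall>r x. 0 < r \<longrightarrow> \<bar>conv w (moll r) x - V x\<bar> \<le> C * sqrt r) \<and>
     (AE x in lebesgue_on \<Omega>. v x = V x) \<and> (\<forall>i. AE x in lebesgue_on \<Omega>. weak_partial \<Omega> i v x = G i x)"

lemma H2_representative_exists: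
  assumes ext: "sobolev_extension_domain 2 \<Omega>" and v: "v \<in> sobolev 2 \<Omega>"
  obtains w V G C where "H2_representative \<Omega> v w V G C"
proof -
  have \<Omega>: "open \<Omega>" using ext by (simp add: sobolev_extension_domain_def bounded_domain_def)
  have s: "\<Omega> \<in> sets lebesgue" by (rule open_lebesgue[OF \<Omega>])
  obtain w where w: "w \<in> sobolev 2 UNIV" "AE x in lebesgue_on \<Omega>. w x = v x"
    using ext v unfolding sobolev_extension_domain_def bounded_linear_between_def by blast
  obtain V C where V: "continuous_on UNIV V" "AE x in lebesgue. w x = V x"
    "\<And>r x. 0 < r \<Longrightarrow> \<bar>conv w (moll r) x - V x\<bar> \<le> C * sqrt r"
    using sobolev_embedding[OF w(1)] by blast
  have w': "w \<in> sobolev (Suc (Suc 0)) UNIV" and v': "v \<in> sobolev (Suc (Suc 0)) \<Omega>"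
    using w(1) v by (simp_all add: numeral_2_eq_2)
  have wq: "sq_integrable lebesgue w" using w' by (simp add: L2_UNIV_iff)
  let ?G = "\<lambda>i. weak_partial UNIV i w"
  have G: "sq_integrable lebesgue (?G i)" "is_weak_partial UNIV i w (?G i)" for i
    using weak_partialD[OF w', of i] by (simp_all add: L2_UNIV_iff)
  have vm: "v \<in> borel_measurable (lebesgue_on \<Omega>)" using v' by (simp add: L2_def)
  have "AE x in lebesgue_on \<Omega>. w x = V x"
  proof -
    have "AE x in lebesgue. x \<in> \<Omega> \<longrightarrow> w x = V x" using V(2) by eventually_elim simp
    then show ?thesis using s by (simp add: AE_restrict_space_iff)
  qed
  with w(2) have vV: "AE x in lebesgue_on \<Omega>. v x = V x" by eventually_elim simp
  have "AE x in lebesgue_on \<Omega>. weak_partial \<Omega> i v x = ?G i x" for i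
    using weak_partial_unique[OF \<Omega> weak_partialD(1)[OF v'] _ weak_partialD(2)[OF v']
        is_weak_partial_restrict[OF \<Omega> G(2) wq vm w(2)]] sq_integrable_restrict[OF G(1) s] by (simp add: L2_iff)
  then have "H2_representative \<Omega> v w V ?G C"
    using wq G V vV by (simp add: H2_representative_def)
  then show thesis by (rule that)
qed

section \<open>Curl and the Stokes form\<close>

definition curl_comp :: "(real^3) set \<Rightarrow> vector_field \<Rightarrow> 3 \<Rightarrow> scalar_field" where
  "curl_comp \<Omega> u i x = weak_curl \<Omega> u x $ i"

lemma curl_comp_eq:
  "curl_comp \<Omega> u 1 = (\<lambda>x. weak_partial \<Omega> 2 (\<lambda>y. u y $ 3) x - weak_partial \<Omega> 3 (\<lambda>y. u y $ 2) x)"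
  "curl_comp \<Omega> u 2 = (\<lambda>x. weak_partial \<Omega> 3 (\<lambda>y. u y $ 1) x - weak_partial \<Omega> 1 (\<lambda>y. u y $ 3) x)"
  "curl_comp \<Omega> u 3 = (\<lambda>x. weak_partial \<Omega> 1 (\<lambda>y. u y $ 2) x - weak_partial \<Omega> 2 (\<lambda>y. u y $ 1) x)"
  by (simp_all add: curl_comp_def[abs_def] weak_curl_def Let_def)

lemma vsobolev_1_partial:
  assumes "u \<in> vsobolev 1 \<Omega>"
  shows "sq_integrable (lebesgue_on \<Omega>) (\<lambda>x. u x $ j)"
    "sq_integrable (lebesgue_on \<Omega>) (weak_partial \<Omega> i (\<lambda>x. u x $ j))"
    "is_weak_partial \<Omega> i (\<lambda>x. u x $ j) (weak_partial \<Omega> i (\<lambda>x. u x $ j))"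
proof -
  have s: "(\<lambda>x. u x $ j) \<in> sobolev (Suc 0) \<Omega>" using assms by (simp add: vsobolev_def)
  then show "sq_integrable (lebesgue_on \<Omega>) (\<lambda>x. u x $ j)" by (simp add: L2_iff)
  show "sq_integrable (lebesgue_on \<Omega>) (weak_partial \<Omega> i (\<lambda>x. u x $ j))"
    "is_weak_partial \<Omega> i (\<lambda>x. u x $ j) (weak_partial \<Omega> i (\<lambda>x. u x $ j))"
    using weak_partialD[OF s, of i] by (simp_all add: L2_iff)
qed

lemma curl_comp_sq_integrable:
  assumes "u \<in> vsobolev 1 \<Omega>"
  shows "sq_integrable (lebesgue_on \<Omega>) (curl_comp \<Omega> u i)"
  using exhaust_3[of i] by (auto simp: curl_comp_eq intro!: sq_integrable_diff vsobolev_1_partial[OF assms])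

text \<open>The weak form of div curl u = 0: after the derivatives of u are moved to the gradient of
  \<psi>, the six terms cancel in pairs by symmetry of second derivatives.\<close>

lemma curl_orthogonal_test_gradient:
  assumes \<Omega>: "open \<Omega>" and u: "u \<in> vsobolev 1 \<Omega>" and \<psi>: "\<psi> \<in> test_functions \<Omega>"
  shows "(\<Sum>i\<in>UNIV. LINT x|lebesgue_on \<Omega>. partial i \<psi> x * curl_comp \<Omega> u i x) = 0"
proof -
  define P where "P k i j = (LINT x|lebesgue_on \<Omega>. u x $ k * partial i (partial j \<psi>) x)" for k i j
  have "\<psi> \<in> test_functions UNIV" using \<psi> test_functions_mono[of \<Omega> UNIV] by blast
  then have sym: "P k i j = P k j i" for k i j by (simp add: P_def partial_commute[of \<psi> i j])
  let ?d = "\<lambda>i j. weak_partial \<Omega> i (\<lambda>x. u x $ j)"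
  have q: "sq_integrable (lebesgue_on \<Omega>) (partial l \<psi>)" for l
    by (rule test_function_sq_integrable[OF test_functions_partial[OF \<psi>] \<Omega>])
  have d: "(LINT x|lebesgue_on \<Omega>. partial l \<psi> x * ?d i j x) = - P j i l" for l i j
  proof -
    have "P j i l = - (LINT x|lebesgue_on \<Omega>. ?d i j x * partial l \<psi> x)"
      using vsobolev_1_partial(3)[OF u, of i j] test_functions_partial[OF \<psi>, of l]
      by (simp add: is_weak_partial_def P_def)
    then show ?thesis by (simp add: mult.commute)
  qed
  have dd: "(LINT x|lebesgue_on \<Omega>. partial l \<psi> x * (?d i j x - ?d i' j' x)) = - P j i l + P j' i' l" for l i j i' j'
    unfolding right_diff_distrib
    by (subst Bochner_Integration.integral_diff[OF sq_integrable_mult[OF q vsobolev_1_partial(2)[OF u]]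
          sq_integrable_mult[OF q vsobolev_1_partial(2)[OF u]]]) (simp add: d)
  show ?thesis
    unfolding sum_3 curl_comp_eq dd
    using sym[of 3 2 1] sym[of 2 3 1] sym[of 1 3 2] by simp
qed

text \<open>Mixed weak derivatives inherit their symmetry from test functions: two integrations by
  parts move both derivatives to \<phi>, where they commute.\<close>

lemma curl_comp_weak_grad:
  assumes \<Omega>: "open \<Omega>" and v: "v \<in> sobolev 2 \<Omega>"
  shows "AE x in lebesgue_on \<Omega>. curl_comp \<Omega> (weak_grad \<Omega> v) i x = 0"
proof -
  have v': "v \<in> sobolev (Suc (Suc 0)) \<Omega>" using v by (simp add: numeral_2_eq_2)
  let ?w = "\<lambda>i. weak_partial \<Omega> i v"
  have w: "?w i \<in> sobolev (Suc 0) \<Omega>" for i by (rule weak_partial_in_sobolev[OF \<Omega> v'])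
  have mixed: "AE x in lebesgue_on \<Omega>. weak_partial \<Omega> i (?w j) x = weak_partial \<Omega> j (?w i) x" for i j
  proof -
    have e: "(LINT x|lebesgue_on \<Omega>. weak_partial \<Omega> k (?w l) x * \<phi> x) =
        (LINT x|lebesgue_on \<Omega>. v x * partial l (partial k \<phi>) x)"
      if \<phi>: "\<phi> \<in> test_functions \<Omega>" for k l \<phi>
      using weak_partialD(2)[OF w, of k l] weak_partialD(2)[OF v', of l] \<phi> test_functions_partial[OF \<phi>, of k]
      by (simp add: is_weak_partial_def)
    have "is_weak_partial \<Omega> i (?w j) (weak_partial \<Omega> j (?w i))"
      unfolding is_weak_partial_def
    proof
      fix \<phi> assume \<phi>: "\<phi> \<in> test_functions \<Omega>"
      then have "\<phi> \<in> test_functions UNIV" using test_functions_mono[of \<Omega> UNIV] by blast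
      then have "(LINT x|lebesgue_on \<Omega>. weak_partial \<Omega> i (?w j) x * \<phi> x) =
          (LINT x|lebesgue_on \<Omega>. weak_partial \<Omega> j (?w i) x * \<phi> x)"
        by (simp add: e[OF \<phi>] partial_commute[of \<phi> j i])
      then show "(LINT x|lebesgue_on \<Omega>. ?w j x * partial i \<phi> x) = - (LINT x|lebesgue_on \<Omega>. weak_partial \<Omega> j (?w i) x * \<phi> x)"
        using weak_partialD(2)[OF w, of i j] \<phi> by (simp add: is_weak_partial_def)
    qed
    then show ?thesis
      by (rule weak_partial_unique[OF \<Omega> weak_partialD(1)[OF w] weak_partialD(1)[OF w] weak_partialD(2)[OF w]])
  qed
  have g: "(\<lambda>y. weak_grad \<Omega> v y $ j) = ?w j" for j by (simp add: weak_grad_def)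
  have "AE x in lebesgue_on \<Omega>. weak_partial \<Omega> k (?w l) x - weak_partial \<Omega> l (?w k) x = 0" for k l
    using mixed[of k l] by eventually_elim simp
  then show ?thesis using exhaust_3[of i] unfolding g[symmetric] by (auto simp: curl_comp_eq)
qed

lemma stokes_form_weak_grad:
  assumes \<Omega>: "open \<Omega>" and v: "v \<in> sobolev 2 \<Omega>" and u: "u \<in> vsobolev 1 \<Omega>"
  shows "stokes_form \<Omega> (weak_grad \<Omega> v) u = (\<Sum>i\<in>UNIV. LINT x|lebesgue_on \<Omega>. weak_partial \<Omega> i v x * curl_comp \<Omega> u i x)"
proof -
  have v': "v \<in> sobolev (Suc (Suc 0)) \<Omega>" using v by (simp add: numeral_2_eq_2)
  have wq: "sq_integrable (lebesgue_on \<Omega>) (weak_partial \<Omega> i v)" for i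
    using weak_partialD(1)[OF v', of i] by (simp add: L2_iff)
  note gu = weak_grad_in_vsobolev[OF \<Omega> v]
  have i: "integrable (lebesgue_on \<Omega>) (\<lambda>x. weak_partial \<Omega> i v x * curl_comp \<Omega> u i x)" for i
    by (rule sq_integrable_mult[OF wq curl_comp_sq_integrable[OF u]])
  have eq: "weak_grad \<Omega> v x \<bullet> weak_curl \<Omega> u x - u x \<bullet> weak_curl \<Omega> (weak_grad \<Omega> v) x =
     (\<Sum>i\<in>UNIV. weak_partial \<Omega> i v x * curl_comp \<Omega> u i x) - (\<Sum>i\<in>UNIV. u x $ i * curl_comp \<Omega> (weak_grad \<Omega> v) i x)" for x
    by (simp add: inner_vec_def curl_comp_def weak_grad_def)
  have "stokes_form \<Omega> (weak_grad \<Omega> v) u = (LINT x|lebesgue_on \<Omega>. (\<Sum>i\<in>UNIV. weak_partial \<Omega> i v x * curl_comp \<Omega> u i x))"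
    unfolding stokes_form_def eq
  proof (rule integral_cong_AE)
    have m1: "(\<lambda>x. \<Sum>i\<in>UNIV. weak_partial \<Omega> i v x * curl_comp \<Omega> u i x) \<in> borel_measurable (lebesgue_on \<Omega>)"
      by (intro borel_measurable_sum borel_measurable_integrable i)
    have m2: "(\<lambda>x. \<Sum>i\<in>UNIV. u x $ i * curl_comp \<Omega> (weak_grad \<Omega> v) i x) \<in> borel_measurable (lebesgue_on \<Omega>)"
      by (intro borel_measurable_sum borel_measurable_integrable
          sq_integrable_mult[OF vsobolev_1_partial(1)[OF u] curl_comp_sq_integrable[OF gu]])
    show "(\<lambda>x. (\<Sum>i\<in>UNIV. weak_partial \<Omega> i v x * curl_comp \<Omega> u i x)
        - (\<Sum>i\<in>UNIV. u x $ i * curl_comp \<Omega> (weak_grad \<Omega> v) i x)) \<in> borel_measurable (lebesgue_on \<Omega>)"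
      by (rule borel_measurable_diff[OF m1 m2])
    show "(\<lambda>x. \<Sum>i\<in>UNIV. weak_partial \<Omega> i v x * curl_comp \<Omega> u i x) \<in> borel_measurable (lebesgue_on \<Omega>)" by (rule m1)
    have "AE x in lebesgue_on \<Omega>. \<forall>i. curl_comp \<Omega> (weak_grad \<Omega> v) i x = 0"
      using curl_comp_weak_grad[OF \<Omega> v] by (simp add: AE_all_countable)
    then show "AE x in lebesgue_on \<Omega>. (\<Sum>i\<in>UNIV. weak_partial \<Omega> i v x * curl_comp \<Omega> u i x)
        - (\<Sum>i\<in>UNIV. u x $ i * curl_comp \<Omega> (weak_grad \<Omega> v) i x) = (\<Sum>i\<in>UNIV. weak_partial \<Omega> i v x * curl_comp \<Omega> u i x)"
      by eventually_elim simp
  qed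
  also have "\<dots> = (\<Sum>i\<in>UNIV. LINT x|lebesgue_on \<Omega>. weak_partial \<Omega> i v x * curl_comp \<Omega> u i x)"
    by (rule Bochner_Integration.integral_sum[OF i])
  finally show ?thesis .
qed

text \<open>Allows the gradient of an extension, or a linear combination of weak gradients, in place
  of the chosen derivatives.\<close>

lemma stokes_form_weak_grad_AE:
  assumes \<Omega>: "open \<Omega>" and v: "v \<in> sobolev 2 \<Omega>" and u: "u \<in> vsobolev 1 \<Omega>"
    and g: "\<And>i. sq_integrable (lebesgue_on \<Omega>) (g i)" "\<And>i. AE x in lebesgue_on \<Omega>. weak_partial \<Omega> i v x = g i x"
  shows "stokes_form \<Omega> (weak_grad \<Omega> v) u = (\<Sum>i\<in>UNIV. LINT x|lebesgue_on \<Omega>. g i x * curl_comp \<Omega> u i x)"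
  unfolding stokes_form_weak_grad[OF \<Omega> v u]
proof (intro sum.cong refl integral_cong_AE)
  fix i
  have v': "v \<in> sobolev (Suc (Suc 0)) \<Omega>" using v by (simp add: numeral_2_eq_2)
  have w: "weak_partial \<Omega> i v \<in> borel_measurable (lebesgue_on \<Omega>)"
    using weak_partialD(1)[OF v', of i] by (simp add: L2_def)
  note c = sq_integrableD(1)[OF curl_comp_sq_integrable[OF u]]
  show "(\<lambda>x. weak_partial \<Omega> i v x * curl_comp \<Omega> u i x) \<in> borel_measurable (lebesgue_on \<Omega>)"
    by (rule borel_measurable_times[OF w c])
  show "(\<lambda>x. g i x * curl_comp \<Omega> u i x) \<in> borel_measurable (lebesgue_on \<Omega>)"
    by (rule borel_measurable_times[OF sq_integrableD(1)[OF g(1)] c])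
  show "AE x in lebesgue_on \<Omega>. weak_partial \<Omega> i v x * curl_comp \<Omega> u i x = g i x * curl_comp \<Omega> u i x"
    using g(2)[of i] by eventually_elim simp
qed

section \<open>Well-definedness and linearity on traces\<close>

lemma lift_in_vsobolev: "lift \<Omega> f \<in> vsobolev 1 \<Omega>"
proof (cases "\<exists>w\<in>ker_tan_trace_perp \<Omega>. tan_trace \<Omega> w = f")
  case True
  then have "\<exists>w. w \<in> ker_tan_trace_perp \<Omega> \<and> tan_trace \<Omega> w = f" by blast
  from someI_ex[OF this] have "lift \<Omega> f \<in> ker_tan_trace_perp \<Omega>" using True by (simp add: lift_def)
  then show ?thesis by (simp add: ker_tan_trace_perp_def)
next
  case False
  then have "lift \<Omega> f = (\<lambda>_. 0)" by (simp add: lift_def)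
  then show ?thesis using zero_in_sobolev[of 1 \<Omega>] by (simp add: vsobolev_def)
qed

text \<open>\<open>pi_T\<close> sees a field only through its Stokes form against lifts, and every
  value of \<open>lift\<close>, including the zero fallback, is in H^1.\<close>

lemma pi_T_weak_grad_eqI:
  assumes "\<And>u. u \<in> vsobolev 1 \<Omega> \<Longrightarrow> stokes_form \<Omega> (weak_grad \<Omega> v) u = stokes_form \<Omega> (weak_grad \<Omega> v') u"
  shows "pi_T \<Omega> (weak_grad \<Omega> v) = pi_T \<Omega> (weak_grad \<Omega> v')"
  by (intro ext) (simp add: pi_T_def assms[OF lift_in_vsobolev])

lemma has_trace_H2_iff:
  assumes "open \<Omega>" "v \<in> sobolev 2 \<Omega>" "H2_representative \<Omega> v w V G C"
  shows "has_trace \<Omega> v f \<longleftrightarrow> capacity {x \<in> frontier \<Omega>. f x \<noteq> V x} = 0"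
proof (rule has_trace_iff[OF assms(1)])
  show "v \<in> borel_measurable (lebesgue_on \<Omega>)"
    using assms(2) sobolev_subset_L2 by (auto simp: L2_def)
qed (use assms(3) in \<open>simp_all add: H2_representative_def\<close>)

text \<open>The difference of the two extensions has the continuous representative V - V', which is
  0 at every boundary point where f agrees with both V and V'. The union of the two exceptional sets
  has capacity zero, so \<open>gradient_orthogonal\<close> applies with c the curl of u.\<close>

lemma stokes_form_weak_grad_unique:
  assumes ext: "sobolev_extension_domain 2 \<Omega>" and v: "v \<in> sobolev 2 \<Omega>" "v' \<in> sobolev 2 \<Omega>"
    and tr: "has_trace \<Omega> v f" "has_trace \<Omega> v' f" and u: "u \<in> vsobolev 1 \<Omega>"
  shows "stokes_form \<Omega> (weak_grad \<Omega> v) u = stokes_form \<Omega> (weak_grad \<Omega> v') u"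
proof -
  have \<Omega>: "open \<Omega>" "bounded \<Omega>" using ext by (simp_all add: sobolev_extension_domain_def bounded_domain_def)
  have s: "\<Omega> \<in> sets lebesgue" by (rule open_lebesgue[OF \<Omega>(1)])
  obtain w V G C where r: "H2_representative \<Omega> v w V G C"
    by (rule H2_representative_exists[OF ext v(1)])
  obtain w' V' G' C' where r': "H2_representative \<Omega> v' w' V' G' C'"
    by (rule H2_representative_exists[OF ext v(2)])
  note R = r[unfolded H2_representative_def] and R' = r'[unfolded H2_representative_def]
  have w: "sq_integrable lebesgue w" "sq_integrable lebesgue w'" using R R' by blast+
  have Gq: "sq_integrable lebesgue (G i)" "sq_integrable lebesgue (G' i)" for i using R R' by blast+
  interpret gradient_orthogonality \<Omega> "curl_comp \<Omega> u" "\<lambda>x. w x - w' x" "\<lambda>x. V x - V' x" "\<lambda>i x. G i x - G' i x" "C + C'"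
  proof
    show "open \<Omega>" "bounded \<Omega>" by (fact \<Omega>)+
    show "sq_integrable (lebesgue_on \<Omega>) (curl_comp \<Omega> u i)" for i by (rule curl_comp_sq_integrable[OF u])
    show "(\<Sum>i\<in>UNIV. LINT x|lebesgue_on \<Omega>. partial i \<psi> x * curl_comp \<Omega> u i x) = 0" if "\<psi> \<in> test_functions \<Omega>" for \<psi>
      by (rule curl_orthogonal_test_gradient[OF \<Omega>(1) u that])
    show "sq_integrable lebesgue (\<lambda>x. w x - w' x)" by (rule sq_integrable_diff[OF w])
    show "sq_integrable lebesgue (\<lambda>x. G i x - G' i x)" for i by (rule sq_integrable_diff[OF Gq])
    show "is_weak_partial UNIV i (\<lambda>x. w x - w' x) (\<lambda>x. G i x - G' i x)" for i
    proof -
      have p: "is_weak_partial UNIV i w (G i)" "is_weak_partial UNIV i w' (G' i)" using R R' by blast+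
      have "is_weak_partial UNIV i (\<lambda>x. w x + (-1) * w' x) (\<lambda>x. G i x + (-1) * G' i x)"
        by (rule is_weak_partial_add[OF open_UNIV _ _ _ _ p(1) is_weak_partial_cmult[OF p(2)]])
           (unfold L2_UNIV_iff, (intro w Gq sq_integrable_cmult)+)
      then show ?thesis by simp
    qed
    show "continuous_on UNIV (\<lambda>x. V x - V' x)" using R R' by (intro continuous_intros) auto
    have ae: "AE x in lebesgue. w x = V x" "AE x in lebesgue. w' x = V' x" using R R' by blast+
    show "AE x in lebesgue. w x - w' x = V x - V' x" using ae by eventually_elim simp
    show "\<bar>conv (\<lambda>x. w x - w' x) (moll r) x - (V x - V' x)\<bar> \<le> (C + C') * sqrt r" if "0 < r" for r x
    proof -
      have "\<bar>conv w (moll r) x - V x\<bar> \<le> C * sqrt r" "\<bar>conv w' (moll r) x - V' x\<bar> \<le> C' * sqrt r"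
        using R R' that by blast+
      then show ?thesis unfolding conv_diff[OF w that] distrib_right by linarith
    qed
  qed
  have "capacity ({x \<in> frontier \<Omega>. f x \<noteq> V x} \<union> {x \<in> frontier \<Omega>. f x \<noteq> V' x}) = 0"
    using tr has_trace_H2_iff[OF \<Omega>(1) v(1) r] has_trace_H2_iff[OF \<Omega>(1) v(2) r']
    by (intro capacity_null_Un) auto
  then have "capacity {x \<in> frontier \<Omega>. V x - V' x \<noteq> 0} = 0"
    by (rule capacity_null_subset) auto
  from gradient_orthogonal[OF this]
  have "(\<Sum>i\<in>UNIV. LINT x|lebesgue_on \<Omega>. (G i x - G' i x) * curl_comp \<Omega> u i x) = 0" .
  moreover have Gr: "sq_integrable (lebesgue_on \<Omega>) (G i)" "sq_integrable (lebesgue_on \<Omega>) (G' i)" for i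
    by (rule sq_integrable_restrict[OF Gq(1) s], rule sq_integrable_restrict[OF Gq(2) s])
  moreover have "(LINT x|lebesgue_on \<Omega>. (G i x - G' i x) * curl_comp \<Omega> u i x) =
     (LINT x|lebesgue_on \<Omega>. G i x * curl_comp \<Omega> u i x) - (LINT x|lebesgue_on \<Omega>. G' i x * curl_comp \<Omega> u i x)" for i
    unfolding left_diff_distrib
    by (rule Bochner_Integration.integral_diff[OF sq_integrable_mult[OF Gr(1) curl_comp_sq_integrable[OF u]]
          sq_integrable_mult[OF Gr(2) curl_comp_sq_integrable[OF u]]])
  ultimately have "(\<Sum>i\<in>UNIV. LINT x|lebesgue_on \<Omega>. G i x * curl_comp \<Omega> u i x) =
    (\<Sum>i\<in>UNIV. LINT x|lebesgue_on \<Omega>. G' i x * curl_comp \<Omega> u i x)"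
    by (simp add: sum_subtractf)
  moreover have "stokes_form \<Omega> (weak_grad \<Omega> v) u = (\<Sum>i\<in>UNIV. LINT x|lebesgue_on \<Omega>. G i x * curl_comp \<Omega> u i x)"
    using R by (intro stokes_form_weak_grad_AE[OF \<Omega>(1) v(1) u Gr(1)]) blast
  moreover have "stokes_form \<Omega> (weak_grad \<Omega> v') u = (\<Sum>i\<in>UNIV. LINT x|lebesgue_on \<Omega>. G' i x * curl_comp \<Omega> u i x)"
    using R' by (intro stokes_form_weak_grad_AE[OF \<Omega>(1) v(2) u Gr(2)]) blast
  ultimately show ?thesis by simp
qed

lemma tan_grad_eq:
  assumes ext: "sobolev_extension_domain 2 \<Omega>" and v: "v \<in> sobolev 2 \<Omega>" and tr: "has_trace \<Omega> v f"
  shows "tan_grad \<Omega> f = pi_T \<Omega> (weak_grad \<Omega> v)"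
  unfolding tan_grad_def
proof (rule the_equality)
  show "\<exists>v'\<in>sobolev 2 \<Omega>. has_trace \<Omega> v' f \<and> pi_T \<Omega> (weak_grad \<Omega> v) = pi_T \<Omega> (weak_grad \<Omega> v')"
    using v tr by blast
  fix h assume "\<exists>v'\<in>sobolev 2 \<Omega>. has_trace \<Omega> v' f \<and> h = pi_T \<Omega> (weak_grad \<Omega> v')"
  then obtain v' where v': "v' \<in> sobolev 2 \<Omega>" "has_trace \<Omega> v' f" and h: "h = pi_T \<Omega> (weak_grad \<Omega> v')" by blast
  show "h = pi_T \<Omega> (weak_grad \<Omega> v)"
    unfolding h by (rule pi_T_weak_grad_eqI[OF stokes_form_weak_grad_unique[OF ext v'(1) v v'(2) tr]])
qed

text \<open>The representatives chosen by \<open>weak_partial\<close> may fail to be additive or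
  homogeneous as functions; the identities hold almost everywhere and become exact under the
  integral.\<close>

lemma stokes_form_weak_grad_linear:
  assumes \<Omega>: "open \<Omega>" and v: "v \<in> sobolev 2 \<Omega>" "v' \<in> sobolev 2 \<Omega>" and u: "u \<in> vsobolev 1 \<Omega>"
  shows "stokes_form \<Omega> (weak_grad \<Omega> (\<lambda>x. v x + v' x)) u =
      stokes_form \<Omega> (weak_grad \<Omega> v) u + stokes_form \<Omega> (weak_grad \<Omega> v') u" (is ?add)
    "stokes_form \<Omega> (weak_grad \<Omega> (\<lambda>x. c * v x)) u = c * stokes_form \<Omega> (weak_grad \<Omega> v) u" (is ?cmult)
proof -
  have S: "z \<in> sobolev (Suc (Suc 0)) \<Omega>" if "z \<in> sobolev 2 \<Omega>" for z using that by (simp add: numeral_2_eq_2)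
  have L: "weak_partial \<Omega> i z \<in> L2 \<Omega>" "is_weak_partial \<Omega> i z (weak_partial \<Omega> i z)" if "z \<in> sobolev 2 \<Omega>" for z i
    by (rule weak_partialD[OF S[OF that]])+
  have Z: "z \<in> L2 \<Omega>" if "z \<in> sobolev 2 \<Omega>" for z using that sobolev_subset_L2 by blast
  have q: "sq_integrable (lebesgue_on \<Omega>) (weak_partial \<Omega> i z)" if "z \<in> sobolev 2 \<Omega>" for z i
    using L(1)[OF that] by (simp add: L2_iff)
  note cu = curl_comp_sq_integrable[OF u]
  note va = sobolev_add[OF \<Omega> v] and vc = sobolev_cmult[OF v(1), of c]
  have a2: "(\<lambda>x. weak_partial \<Omega> i v x + weak_partial \<Omega> i v' x) \<in> L2 \<Omega>" for i
    unfolding L2_iff by (rule sq_integrable_add[OF q[OF v(1)] q[OF v(2)]])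
  have "AE x in lebesgue_on \<Omega>. weak_partial \<Omega> i (\<lambda>x. v x + v' x) x = weak_partial \<Omega> i v x + weak_partial \<Omega> i v' x" for i
    by (rule weak_partial_unique[OF \<Omega> L(1)[OF va] a2 L(2)[OF va]
          is_weak_partial_add[OF \<Omega> Z[OF v(1)] Z[OF v(2)] L(1)[OF v(1)] L(1)[OF v(2)] L(2)[OF v(1)] L(2)[OF v(2)]]])
  from stokes_form_weak_grad_AE[OF \<Omega> va u a2[unfolded L2_iff] this]
  have "stokes_form \<Omega> (weak_grad \<Omega> (\<lambda>x. v x + v' x)) u =
    (\<Sum>i\<in>UNIV. LINT x|lebesgue_on \<Omega>. (weak_partial \<Omega> i v x + weak_partial \<Omega> i v' x) * curl_comp \<Omega> u i x)" .
  also have "\<dots> = (\<Sum>i\<in>UNIV. (LINT x|lebesgue_on \<Omega>. weak_partial \<Omega> i v x * curl_comp \<Omega> u i x) +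
      (LINT x|lebesgue_on \<Omega>. weak_partial \<Omega> i v' x * curl_comp \<Omega> u i x))"
    unfolding distrib_right
    by (intro sum.cong refl Bochner_Integration.integral_add sq_integrable_mult[OF q[OF v(1)] cu] sq_integrable_mult[OF q[OF v(2)] cu])
  finally show ?add
    by (simp add: sum.distrib stokes_form_weak_grad[OF \<Omega> v(1) u] stokes_form_weak_grad[OF \<Omega> v(2) u])
  have c2: "(\<lambda>x. c * weak_partial \<Omega> i v x) \<in> L2 \<Omega>" for i
    unfolding L2_iff by (rule sq_integrable_cmult[OF q[OF v(1)]])
  have "AE x in lebesgue_on \<Omega>. weak_partial \<Omega> i (\<lambda>x. c * v x) x = c * weak_partial \<Omega> i v x" for i
    by (rule weak_partial_unique[OF \<Omega> L(1)[OF vc] c2 L(2)[OF vc] is_weak_partial_cmult[OF L(2)[OF v(1)]]])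
  from stokes_form_weak_grad_AE[OF \<Omega> vc u c2[unfolded L2_iff] this]
  show ?cmult by (simp add: stokes_form_weak_grad[OF \<Omega> v(1) u] mult.assoc sum_distrib_left)
qed

text \<open>V + V' and c V are continuous representatives of the new functions, and the new traces
  can differ from them only on the given exceptional sets, whose union has capacity zero.\<close>

lemma has_trace_H2_linear:
  assumes ext: "sobolev_extension_domain 2 \<Omega>" and v: "v \<in> sobolev 2 \<Omega>" "v' \<in> sobolev 2 \<Omega>"
    and tr: "has_trace \<Omega> v f" "has_trace \<Omega> v' f'"
  shows "has_trace \<Omega> (\<lambda>x. v x + v' x) (\<lambda>x. f x + f' x)" "has_trace \<Omega> (\<lambda>x. c * v x) (\<lambda>x. c * f x)"
proof -
  have \<Omega>: "open \<Omega>" using ext by (simp add: sobolev_extension_domain_def bounded_domain_def)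
  obtain w V G C where r: "H2_representative \<Omega> v w V G C"
    by (rule H2_representative_exists[OF ext v(1)])
  obtain w' V' G' C' where r': "H2_representative \<Omega> v' w' V' G' C'"
    by (rule H2_representative_exists[OF ext v(2)])
  note R = r[unfolded H2_representative_def] and R' = r'[unfolded H2_representative_def]
  have n: "capacity {x \<in> frontier \<Omega>. f x \<noteq> V x} = 0" "capacity {x \<in> frontier \<Omega>. f' x \<noteq> V' x} = 0"
    using tr has_trace_H2_iff[OF \<Omega> v(1) r] has_trace_H2_iff[OF \<Omega> v(2) r'] by auto
  have m: "v \<in> borel_measurable (lebesgue_on \<Omega>)" "v' \<in> borel_measurable (lebesgue_on \<Omega>)"
    using v sobolev_subset_L2 by (auto simp: L2_def)
  have ae: "AE x in lebesgue_on \<Omega>. v x = V x" "AE x in lebesgue_on \<Omega>. v' x = V' x" using R R' by blast+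
  have c: "continuous_on UNIV V" "continuous_on UNIV V'" using R R' by blast+
  have a: "AE x in lebesgue_on \<Omega>. v x + v' x = V x + V' x" using ae by eventually_elim simp
  have "capacity {x \<in> frontier \<Omega>. f x + f' x \<noteq> V x + V' x} = 0"
    by (rule capacity_null_subset[OF capacity_null_Un[OF n]]) auto
  then show "has_trace \<Omega> (\<lambda>x. v x + v' x) (\<lambda>x. f x + f' x)"
    by (subst has_trace_iff[OF \<Omega> continuous_on_add[OF c] borel_measurable_add[OF m] a])
  have s: "AE x in lebesgue_on \<Omega>. c * v x = c * V x" using ae(1) by eventually_elim simp
  have "capacity {x \<in> frontier \<Omega>. c * f x \<noteq> c * V x} = 0"
    by (rule capacity_null_subset[OF n(1)]) auto
  then show "has_trace \<Omega> (\<lambda>x. c * v x) (\<lambda>x. c * f x)"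
    by (subst has_trace_iff[OF \<Omega> continuous_on_mult_left[OF c(1)] borel_measurable_times[OF borel_measurable_const m(1)] s])
qed

theorem theorem6p8:
  fixes \<Omega> :: "(real^3) set"
  assumes "sobolev_extension_domain 1 \<Omega>" and "sobolev_extension_domain 2 \<Omega>"
  shows "(\<forall>v\<in>sobolev 2 \<Omega>. (\<exists>f. has_trace \<Omega> v f) \<and>
            (\<forall>f. has_trace \<Omega> v f \<longrightarrow> tan_grad \<Omega> f = pi_T \<Omega> (weak_grad \<Omega> v))) \<and>
         bounded_linear_between (trace_space 2 \<Omega>) (trace_norm 2 \<Omega>)
           (B_T \<Omega>) (B_T_norm \<Omega>) (=) (tan_grad \<Omega>)"
proof -
  note ext = assms(2)
  have \<Omega>: "open \<Omega>" using ext by (simp add: sobolev_extension_domain_def bounded_domain_def)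
  have "\<exists>f. has_trace \<Omega> v f" if v: "v \<in> sobolev 2 \<Omega>" for v
  proof -
    obtain w V G C where r: "H2_representative \<Omega> v w V G C"
      by (rule H2_representative_exists[OF ext v])
    \<comment> \<open>The continuous representative V itself is a trace of v, with empty exceptional
      set.\<close>
    have "capacity {} = 0"
    proof (rule capacity_null_if_witness)
      fix e :: real assume "0 < e"
      then have "capacity_witness {} e (\<lambda>x. 0) (\<lambda>i x. 0) {}"
        by (simp add: capacity_witness_def is_weak_partial_def)
      then show "\<exists>u g U. capacity_witness {} e u g U" by blast
    qed
    then have "has_trace \<Omega> v V" by (simp add: has_trace_H2_iff[OF \<Omega> v r])
    then show ?thesis by blast
  qed
  moreover have "bounded_linear_between (trace_space 2 \<Omega>) (trace_norm 2 \<Omega>) (B_T \<Omega>) (B_T_norm \<Omega>) (=) (tan_grad \<Omega>)"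
    unfolding bounded_linear_between_def
  proof (intro conjI ballI allI)
    fix f assume "f \<in> trace_space 2 \<Omega>"
    then obtain v where v: "v \<in> sobolev 2 \<Omega>" "has_trace \<Omega> v f" by (auto simp: trace_space_def)
    then show "tan_grad \<Omega> f \<in> B_T \<Omega>"
      unfolding tan_grad_eq[OF ext v] B_T_def by (intro imageI weak_grad_in_vsobolev \<Omega>)
    fix c :: real
    show "tan_grad \<Omega> (\<lambda>x. c *\<^sub>R f x) = (\<lambda>y. c *\<^sub>R tan_grad \<Omega> f y)"
      unfolding real_scaleR_def tan_grad_eq[OF ext v]
        tan_grad_eq[OF ext sobolev_cmult[OF v(1)] has_trace_H2_linear(2)[OF ext v(1) v(1) v(2) v(2)]]
      by (simp add: pi_T_def fun_eq_iff stokes_form_weak_grad_linear(2)[OF \<Omega> v(1) v(1) lift_in_vsobolev])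
  next
    fix f f' assume "f \<in> trace_space 2 \<Omega>" "f' \<in> trace_space 2 \<Omega>"
    then obtain v v' where v: "v \<in> sobolev 2 \<Omega>" "has_trace \<Omega> v f" "v' \<in> sobolev 2 \<Omega>" "has_trace \<Omega> v' f'"
      by (auto simp: trace_space_def)
    show "tan_grad \<Omega> (\<lambda>x. f x + f' x) = (\<lambda>y. tan_grad \<Omega> f y + tan_grad \<Omega> f' y)"
      unfolding tan_grad_eq[OF ext v(1,2)] tan_grad_eq[OF ext v(3,4)]
        tan_grad_eq[OF ext sobolev_add[OF \<Omega> v(1,3)] has_trace_H2_linear(1)[OF ext v(1,3,2,4)]]
      by (simp add: pi_T_def fun_eq_iff stokes_form_weak_grad_linear(1)[OF \<Omega> v(1,3) lift_in_vsobolev])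
  next
    have "B_T_norm \<Omega> (tan_grad \<Omega> f) \<le> 1 * trace_norm 2 \<Omega> f" if f: "f \<in> trace_space 2 \<Omega>" for f
    proof -
      have "B_T_norm \<Omega> (tan_grad \<Omega> f) \<le> trace_norm 2 \<Omega> f"
        unfolding trace_norm_def
      proof (rule cInf_greatest)
        show "{sobolev_norm 2 \<Omega> v |v. v \<in> sobolev 2 \<Omega> \<and> has_trace \<Omega> v f} \<noteq> {}"
          using f by (auto simp: trace_space_def)
        fix y assume "y \<in> {sobolev_norm 2 \<Omega> v |v. v \<in> sobolev 2 \<Omega> \<and> has_trace \<Omega> v f}"
        then obtain v where v: "v \<in> sobolev 2 \<Omega>" "has_trace \<Omega> v f" and y: "y = sobolev_norm 2 \<Omega> v" by blast
        let ?S = "{vsobolev_norm 1 \<Omega> z |z. z \<in> vsobolev 1 \<Omega> \<and> pi_T \<Omega> z = pi_T \<Omega> (weak_grad \<Omega> v)}"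
        have "bdd_below ?S"
          by (rule bdd_belowI[where m = 0]) (use vsobolev_norm_nonneg[of 1 \<Omega>] in blast)
        \<comment> \<open>The gradient of v is one of the fields competing in the quotient
          norm.\<close>
        then have "Inf ?S \<le> vsobolev_norm 1 \<Omega> (weak_grad \<Omega> v)"
          using weak_grad_in_vsobolev[OF \<Omega> v(1)] by (intro cInf_lower) auto
        also have "\<dots> \<le> y" unfolding y by (rule vsobolev_norm_weak_grad_le)
        finally show "B_T_norm \<Omega> (tan_grad \<Omega> f) \<le> y"
          by (simp only: B_T_norm_def tan_grad_eq[OF ext v])
      qed
      then show ?thesis by simp
    qed
    then show "\<exists>C. \<forall>f\<in>trace_space 2 \<Omega>. B_T_norm \<Omega> (tan_grad \<Omega> f) \<le> C * trace_norm 2 \<Omega> f" by blast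
  qed
  ultimately show ?thesis using tan_grad_eq[OF ext] by blast
qed

end
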